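(* Let $\kappa>\omega_1$ be a regular cardinal such that there is a non-reflecting stationary set $S\subset\kappa$. Then for each ordinal $\alpha<\kappa^+$ there is a $0$-dimensional space $Y$ with $\operatorname{ord}_\ell(Y)=\kappa\cdot\alpha$.
   Context: A well-ordering $\prec$ of (the underlying set of) a topological space $X$ is left-separating if $\{x\in X: x\prec y\}$ is closed in $X$ for every $y\in X$. A space is left-separated if it has a left-separating well-ordering. For a left-separated space $X$, its left-separating type $\operatorname{ord}_\ell(X)$ is the minimum of the order types of the left-separating well-orderings of $X$; write $\operatorname{ord}_\ell(X)=\infty$ if $X$ is not left-separated. A space is $0$-dimensional if it has a base consisting of clopen sets. A stationary set $S\subset\kappa$ is non-reflecting if for every limit ordinal $\delta<\kappa$ of uncountable cofinality, $S\cap\delta$ is not stationary in $\delta$. The product $\kappa\cdot\alpha$ is ordinal multiplication. *)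

theory Defs
  imports "HOL-Analysis.Abstract_Topology"
begin

unbundle cardinal_syntax

text \<open>
  Ordinals are represented by well-orders up to order isomorphism (\<open>=o\<close>). An element \<open>d\<close> of
  \<open>Field w\<close> stands for the ordinal given by the order that \<open>w\<close> induces on the strict
  predecessors of \<open>d\<close>; the ordinals obtained in this way are exactly those below \<open>w\<close>.
\<close>

definition below :: "'a rel \<Rightarrow> 'a \<Rightarrow> 'a rel" where
  "below w d = Restr w (underS w d)"

text \<open>
  The library predicate \<open>cofinal\<close> is strict: above every point there is a strictly larger
  point of the cofinal set. Hence an order with a largest element has no cofinal subset.
\<close>

definition limit_order :: "'a rel \<Rightarrow> bool" where
  "limit_order w \<longleftrightarrow> Field w \<noteq> {} \<and> cofinal (Field w) w"

definition limit_of_uncountable_cofinality :: "'a rel \<Rightarrow> bool" where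
  "limit_of_uncountable_cofinality w \<longleftrightarrow>
     limit_order w \<and> (\<forall>K. K \<subseteq> Field w \<and> cofinal K w \<longrightarrow> \<not> countable K)"

definition club :: "'a set \<Rightarrow> 'a rel \<Rightarrow> bool" where
  "club C w \<longleftrightarrow>
     C \<subseteq> Field w \<and> cofinal C w \<and>
     (\<forall>d \<in> Field w. limit_order (below w d) \<and> cofinal (C \<inter> underS w d) (below w d) \<longrightarrow> d \<in> C)"

definition stationary :: "'a set \<Rightarrow> 'a rel \<Rightarrow> bool" where
  "stationary S w \<longleftrightarrow> S \<subseteq> Field w \<and> (\<forall>C. club C w \<longrightarrow> S \<inter> C \<noteq> {})"

definition non_reflecting :: "'a set \<Rightarrow> 'a rel \<Rightarrow> bool" where
  "non_reflecting S w \<longleftrightarrow>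
     (\<forall>d \<in> Field w. limit_of_uncountable_cofinality (below w d) \<longrightarrow>
        \<not> stationary (S \<inter> underS w d) (below w d))"

text \<open>
  The ordinal product \<open>r \<cdot> s\<close>, that is, \<open>s\<close> many copies of \<open>r\<close> one after the other: the second
  component is the more significant one.
\<close>

definition ord_prod :: "'a rel \<Rightarrow> 'b rel \<Rightarrow> ('a \<times> 'b) rel" where
  "ord_prod r s = {((x1, y1), (x2, y2)).
     (x1 \<in> Field r \<and> x2 \<in> Field r \<and> (y1, y2) \<in> s \<and> y1 \<noteq> y2) \<or>
     ((x1, x2) \<in> r \<and> y1 = y2 \<and> y1 \<in> Field s)}"

definition zero_dimensional :: "'a topology \<Rightarrow> bool" where
  "zero_dimensional X \<longleftrightarrow>
     (\<exists>B. (\<forall>U \<in> B. openin X U \<and> closedin X U) \<and>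
          openin X = arbitrary union_of (\<lambda>U. U \<in> B))"

definition left_separating :: "'a topology \<Rightarrow> 'a rel \<Rightarrow> bool" where
  "left_separating X r \<longleftrightarrow>
     well_order_on (topspace X) r \<and> (\<forall>y \<in> topspace X. closedin X (underS r y))"

definition left_separated :: "'a topology \<Rightarrow> bool" where
  "left_separated X \<longleftrightarrow> (\<exists>r. left_separating X r)"

text \<open>
  The left-separating type is given by a left-separating well-order of minimal order type,
  which is determined up to order isomorphism; \<open>None\<close> plays the role of \<open>\<infinity>\<close>.
\<close>

definition ord_l :: "'a topology \<Rightarrow> 'a rel option" where
  "ord_l X =
     (if left_separated X
      then Some (SOME r. left_separating X r \<and> (\<forall>r'. left_separating X r' \<longrightarrow> r \<le>o r'))
      else None)"

lemma ord_l_minimal: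
  assumes "ord_l X = Some t"
  shows "left_separating X t \<and> (\<forall>r. left_separating X r \<longrightarrow> t \<le>o r)"
proof -
  have ls: "left_separated X"
    and t: "t = (SOME r. left_separating X r \<and> (\<forall>r'. left_separating X r' \<longrightarrow> r \<le>o r'))"
    using assms by (auto simp: ord_l_def split: if_splits)
  have ne: "{r. left_separating X r} \<noteq> {}"
    using ls by (auto simp: left_separated_def)
  have wo: "\<forall>r \<in> {r. left_separating X r}. Well_order r"
    by (auto simp: left_separating_def dest: well_order_on_Well_order)
  have "\<exists>r. left_separating X r \<and> (\<forall>r'. left_separating X r' \<longrightarrow> r \<le>o r')"
    using exists_minim_Well_order[OF ne wo] by blast
  then show ?thesis
    unfolding t by (rule someI_ex)
qed

end

theory Submission
  imports Defs
begin

text \<open>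
  The underlying set of the space is \<open>\<kappa>\<close> itself. Every point gets a \<^emph>\<open>layer\<close> below \<open>\<alpha>\<close>, and the
  topology is generated by sets \<open>nbhd p\<close> and their complements, where \<open>nbhd p\<close> consists of \<open>p\<close> and of
  certain \<open>\<eta> < p\<close> of higher layers, said to be attached to \<open>p\<close>. Such a space is 0-dimensional. As
  \<open>nbhd p\<close> contains no other point of the layer of \<open>p\<close> and no point of a lower one, the
  lexicographic order by layer and position is left-separating, and its type is at most
  \<open>\<kappa> \<cdot> \<alpha>\<close>. So a shorter left-separating order has to be ruled out
  (\<open>left_separating_lower_bound\<close>). It would put unboundedly many points on a level below
  their layer, and its initial segments are closed. For a contradiction one needs that many sets
  \<open>T\<close> have limits (\<open>accumulation_point\<close>): if \<open>T\<close> is unbounded in \<open>\<kappa>\<close> and lies in layers above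
  those of enough candidates \<open>y\<close>, then some candidate \<open>y\<close> is in the closure of the points of \<open>T\<close>
  below \<open>y\<close>.

  To this end the attachment has to satisfy the condition \<open>captures\<close>: whatever finite set of points
  \<open>p > y\<close> the neighbourhoods of each \<open>y\<close> depend on, for some candidate \<open>y\<close> some \<open>\<eta> \<in> T\<close> below \<open>y\<close>
  is attached to \<open>y\<close> and behaves like \<open>y\<close> towards these \<open>p\<close>. The attachment is read off from
  walks. Because \<open>S\<close> does not reflect, one can choose steps downwards from each point such that
  close to a point \<open>d \<in> S\<close> every walk from above passes through \<open>d\<close> (\<open>path_near\<close>). The points of
  \<open>S\<close> carry letters from a smaller regular cardinal \<open>\<theta>\<close>, all letters stationarily often
  (\<open>stationary_partition\<close>), so that a walk spells a word. Ladders to the letters determine the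
  rank of a word and its dominant letter. The combinatorial core is
  \<open>dominating_word\<close>, transferred to walks in \<open>dominating_walk\<close>: there are a letter \<open>\<beta>\<close>, a
  candidate \<open>y\<close> with this letter and an \<open>\<eta> \<in> T\<close> close to \<open>y\<close> such that \<open>\<beta>\<close> dominates the walk to
  \<open>\<eta>\<close> from \<open>y\<close> and from all the given points above \<open>y\<close>.

  If \<open>\<kappa> > \<omega>\<^sub>2\<close>, take \<open>\<theta> = \<omega>\<^sub>2\<close> and ladders that guess clubs (\<open>club_guessing\<close>). Then also the rank of the
  word is under control, and it is used to tell which stop with the dominant letter is \<open>y\<close>. Thus
  \<open>\<eta>\<close> knows \<open>y\<close>, and its attachment can be defined recursively from that of \<open>y\<close>
  (\<open>attached_captures\<close>). If \<open>\<kappa> = \<omega>\<^sub>2\<close>, then \<open>\<theta> = \<omega>\<^sub>1\<close>, and the rank cannot be controlled in this way. But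
  \<open>\<kappa> \<le> 2\<^sup>\<theta>\<close>, so the points of \<open>\<kappa>\<close> are given by distinct subsets of \<open>\<theta>\<close>, and any decision about
  finitely many points is encoded by one of \<open>\<theta>\<close> many finite tables. The dominant letter then
  names the table (\<open>table_captures\<close>).
\<close>

section \<open>Well-orders and regular cardinals\<close>

definition lt :: "'a \<Rightarrow> 'a rel \<Rightarrow> 'a \<Rightarrow> bool" ("(_ \<prec>\<^bsub>_\<^esub> _)" [51, 0, 51] 50) where
  "x \<prec>\<^bsub>r\<^esub> y \<longleftrightarrow> (x, y) \<in> r \<and> x \<noteq> y"

locale wellorder_rel =
  fixes r :: "'a rel"
  assumes well_order: "Well_order r"
begin

abbreviation less (infix "\<prec>" 50) where "x \<prec> y \<equiv> x \<prec>\<^bsub>r\<^esub> y"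
abbreviation leq (infix "\<preceq>" 50) where "x \<preceq> y \<equiv> (x, y) \<in> r"
abbreviation K where "K \<equiv> Field r"

lemma less_in: "x \<prec> y \<Longrightarrow> x \<in> K" "x \<prec> y \<Longrightarrow> y \<in> K"
  unfolding lt_def by (auto simp: Field_def)

lemma leq_in: "x \<preceq> y \<Longrightarrow> x \<in> K" "x \<preceq> y \<Longrightarrow> y \<in> K"
  by (auto simp: Field_def)

lemma leq_refl: "x \<in> K \<Longrightarrow> x \<preceq> x"
  using well_order unfolding well_order_on_def linear_order_on_def partial_order_on_def
    preorder_on_def refl_on_def by blast

lemma leq_iff: "x \<preceq> y \<longleftrightarrow> x \<prec> y \<or> x = y \<and> x \<in> K"
  using leq_refl unfolding lt_def by (auto simp: Field_def)

lemma less_imp_leq: "x \<prec> y \<Longrightarrow> x \<preceq> y"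
  unfolding lt_def by blast

lemma leq_neq: "x \<preceq> y \<Longrightarrow> x \<noteq> y \<Longrightarrow> x \<prec> y"
  unfolding lt_def by blast

lemma leq_trans: "x \<preceq> y \<Longrightarrow> y \<preceq> z \<Longrightarrow> x \<preceq> z"
  using well_order unfolding well_order_on_def linear_order_on_def partial_order_on_def
    preorder_on_def trans_def by blast

lemma leq_antisym: "x \<preceq> y \<Longrightarrow> y \<preceq> x \<Longrightarrow> x = y"
  using well_order unfolding well_order_on_def linear_order_on_def partial_order_on_def
    antisym_def by blast

lemma less_trans: "x \<prec> y \<Longrightarrow> y \<prec> z \<Longrightarrow> x \<prec> z"
  using leq_trans leq_antisym unfolding lt_def by blast

lemma leq_less_trans: "x \<preceq> y \<Longrightarrow> y \<prec> z \<Longrightarrow> x \<prec> z"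
  using leq_trans leq_antisym unfolding lt_def by blast

lemma less_leq_trans: "x \<prec> y \<Longrightarrow> y \<preceq> z \<Longrightarrow> x \<prec> z"
  using leq_trans leq_antisym unfolding lt_def by blast

lemma less_irrefl: "\<not> x \<prec> x"
  unfolding lt_def by blast

lemma less_asym: "x \<prec> y \<Longrightarrow> \<not> y \<prec> x"
  using less_trans less_irrefl by blast

lemma linear: "x \<in> K \<Longrightarrow> y \<in> K \<Longrightarrow> x \<prec> y \<or> x = y \<or> y \<prec> x"
  using well_order unfolding well_order_on_def linear_order_on_def total_on_def lt_def by blast

lemma not_less: "x \<in> K \<Longrightarrow> y \<in> K \<Longrightarrow> \<not> x \<prec> y \<longleftrightarrow> y \<preceq> x"
  using linear[of x y] less_asym[of x y] less_irrefl[of x] leq_iff[of y x] by blast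

lemma wf_less: "wf {(x, y). x \<prec> y}"
proof -
  have "{(x, y). x \<prec> y} = r - Id" by (auto simp: lt_def)
  then show ?thesis using well_order unfolding well_order_on_def by simp
qed

lemma less_induct [consumes 0, case_names less]:
  assumes "\<And>x. (\<And>y. y \<prec> x \<Longrightarrow> P y) \<Longrightarrow> P x"
  shows "P x"
  using wf_induct[OF wf_less, of P x] assms by blast

lemma least_ex:
  assumes "A \<subseteq> K" "A \<noteq> {}"
  shows "\<exists>m\<in>A. \<forall>x\<in>A. m \<preceq> x"
proof -
  obtain a where "a \<in> A" using assms(2) by blast
  then obtain m where "m \<in> A" and min: "\<And>y. (y, m) \<in> {(x, y). x \<prec> y} \<Longrightarrow> y \<notin> A"
    by (rule wfE_min[OF wf_less]) blast
  then have m: "m \<in> A" "\<And>y. y \<prec> m \<Longrightarrow> y \<notin> A" by auto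
  have "m \<preceq> x" if "x \<in> A" for x
    using m that assms(1) not_less[of x m] by blast
  with m(1) show ?thesis by blast
qed

definition mx :: "'a \<Rightarrow> 'a \<Rightarrow> 'a" where "mx x y = (if x \<preceq> y then y else x)"

lemma mx:
  assumes "x \<in> K" "y \<in> K"
  shows "x \<preceq> mx x y" "y \<preceq> mx x y" "mx x y \<in> K" "mx x y = x \<or> mx x y = y"
  using assms linear[of x y] leq_iff[of x y] leq_iff[of y x] leq_refl by (auto simp: mx_def)

lemma mx_less: "mx x y \<prec> z \<longleftrightarrow> x \<prec> z \<and> y \<prec> z" if "x \<in> K" "y \<in> K"
  using mx[OF that] leq_less_trans by metis

lemma finite_bound:
  assumes "finite A" "\<And>a. a \<in> A \<Longrightarrow> a \<prec> y" "z \<prec> y"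
  shows "\<exists>m. m \<prec> y \<and> (\<forall>a\<in>A. a \<preceq> m) \<and> z \<preceq> m"
  using assms(1,2)
proof (induction A)
  case empty
  then show ?case using assms(3) leq_refl less_in by blast
next
  case (insert a A)
  then obtain m where m: "m \<prec> y" "\<forall>a\<in>A. a \<preceq> m" "z \<preceq> m" by auto
  have a: "a \<prec> y" using insert by auto
  have K: "m \<in> K" "a \<in> K" using m(1) a less_in by blast+
  have "mx m a \<prec> y" using mx_less[OF K] m(1) a by blast
  moreover have "x \<preceq> mx m a" if "x \<in> insert a A" for x
    using that m(2) mx(1,2)[OF K] leq_trans by blast
  moreover have "z \<preceq> mx m a" using m(3) mx(1)[OF K] by (rule leq_trans)
  ultimately show ?case by blast
qed

text \<open>
  Clubs enter only through the sets of closure points of functions: every club contains one of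
  them, and they are easy to intersect, also diagonally.
\<close>

definition cl :: "('a \<Rightarrow> 'a) \<Rightarrow> 'a set" where
  "cl b = {d \<in> K. (\<exists>z. z \<prec> d) \<and> (\<forall>z. z \<prec> d \<longrightarrow> b z \<prec> d)}"

definition limit_pt :: "'a \<Rightarrow> bool" where
  "limit_pt d \<longleftrightarrow> (\<exists>z. z \<prec> d) \<and> (\<forall>z. z \<prec> d \<longrightarrow> (\<exists>y. z \<prec> y \<and> y \<prec> d))"

definition unbdd :: "'a set \<Rightarrow> bool" where
  "unbdd A \<longleftrightarrow> A \<subseteq> K \<and> (\<forall>x\<in>K. \<exists>a\<in>A. x \<prec> a)"

lemma clD: "d \<in> cl b \<Longrightarrow> z \<prec> d \<Longrightarrow> b z \<prec> d"
  unfolding cl_def by blast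

lemma cl_in: "d \<in> cl b \<Longrightarrow> d \<in> K"
  unfolding cl_def by blast

lemma cl_mono: "d \<in> cl b \<Longrightarrow> (\<And>z. z \<prec> d \<Longrightarrow> b' z \<preceq> b z) \<Longrightarrow> d \<in> cl b'"
  unfolding cl_def using leq_less_trans by blast

lemma limit_ptI: "d \<in> cl b \<Longrightarrow> (\<And>z. z \<prec> d \<Longrightarrow> z \<prec> b z) \<Longrightarrow> limit_pt d"
  unfolding cl_def limit_pt_def by blast

definition ladder :: "'a \<Rightarrow> (nat \<Rightarrow> 'a) \<Rightarrow> bool" where
  "ladder p s \<longleftrightarrow> (\<forall>n. s n \<prec> s (Suc n)) \<and> (\<forall>n. s n \<prec> p) \<and> (\<forall>z. z \<prec> p \<longrightarrow> (\<exists>n. z \<prec> s n))"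

lemma ladder_less: "ladder p s \<Longrightarrow> m < n \<Longrightarrow> s m \<prec> s n"
  by (induction n) (auto simp: ladder_def less_Suc_eq intro: less_trans)

lemma ladder_leq: "ladder p s \<Longrightarrow> m \<le> n \<Longrightarrow> s m \<preceq> s n"
  using ladder_less[of p s m n] leq_refl[of "s n"] less_in(2)[of _ "s n"]
  by (metis ladder_def leq_iff le_less less_in(1))

lemma ladder_from_sequence:
  assumes "\<And>n. s n \<prec> p" "\<And>z. z \<prec> p \<Longrightarrow> \<exists>n. z \<prec> s n"
  obtains k where "ladder p (s \<circ> k)" "strict_mono (k :: nat \<Rightarrow> nat)"
proof -
  define nx where "nx n = (SOME n'. n' > n \<and> (\<forall>i\<le>n. s i \<prec> s n'))" for n
  have nx: "nx n > n \<and> (\<forall>i\<le>n. s i \<prec> s (nx n))" for n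
  proof -
    obtain m where m: "m \<prec> p" "\<forall>a\<in>s ` {..n}. a \<preceq> m"
      using finite_bound[of "s ` {..n}" p "s n"] assms(1) by auto
    obtain n' where n': "m \<prec> s n'" using assms(2) m(1) by blast
    have *: "\<forall>i\<le>n. s i \<prec> s n'" using m(2) n' leq_less_trans by auto
    then have "n' > n" using less_irrefl not_le by blast
    with * have "\<exists>n'. n' > n \<and> (\<forall>i\<le>n. s i \<prec> s n')" by blast
    then show ?thesis unfolding nx_def by (rule someI_ex)
  qed
  define k where "k n = (nx ^^ n) 0" for n
  have kS: "k (Suc n) = nx (k n)" for n by (simp add: k_def)
  have mono: "strict_mono k" unfolding strict_mono_Suc_iff using kS nx by simp
  have cof: "\<exists>n. z \<prec> s (k n)" if z: "z \<prec> p" for z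
  proof -
    obtain n where n: "z \<prec> s n" using assms(2) z by blast
    have "n \<le> k n" using mono by (rule seq_suble)
    then have "s n \<prec> s (k (Suc n))" using nx kS by simp
    then show ?thesis using n less_trans by blast
  qed
  have "ladder p (s \<circ> k)"
    unfolding ladder_def using kS nx assms(1) cof by auto
  then show ?thesis using mono that by blast
qed

end

locale regular_rel = wellorder_rel +
  assumes card_order: "Card_order r"
    and regular: "regularCard r"
    and uncountable: "natLeq <o r"
begin

lemma infinite_K: "infinite K"
proof
  assume "finite K"
  then have "|K| <o natLeq" using finite_iff_ordLess_natLeq by blast
  then show False
    using uncountable card_of_Field_ordIso[OF card_order]
    by (metis ordIso_ordLess_trans ordIso_symmetric ordLess_irreflexive ordLess_transitive)
qed

lemma cinf: "Cinfinite r"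
  using infinite_K card_order unfolding cinfinite_def by blast

lemma bounded:
  assumes "A \<subseteq> K" "|A| <o r"
  shows "\<exists>b\<in>K. \<forall>a\<in>A. a \<prec> b"
proof -
  have "\<not> cofinal A r"
    using regular assms not_ordLess_ordIso unfolding regularCard_def by blast
  then obtain x where x: "x \<in> K" "\<forall>a\<in>A. \<not> x \<prec> a"
    unfolding cofinal_def lt_def by blast
  obtain b where b: "b \<in> K" "x \<noteq> b" "(x, b) \<in> r"
    using infinite_Card_order_limit[OF card_order infinite_K x(1)] by blast
  have "a \<prec> b" if "a \<in> A" for a
    using x that assms(1) not_less[of x a] b leq_less_trans unfolding lt_def by blast
  with b(1) show ?thesis by blast
qed

definition small :: "'c set \<Rightarrow> bool" where "small A \<longleftrightarrow> |A| <o r"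

lemma small_image: "small A \<Longrightarrow> small (f ` A)"
  unfolding small_def using card_of_image ordLeq_ordLess_trans by blast

lemma small_subset: "small B \<Longrightarrow> A \<subseteq> B \<Longrightarrow> small A"
  unfolding small_def using card_of_mono1 ordLeq_ordLess_trans by blast

lemma small_UN: "small I \<Longrightarrow> (\<And>i. i \<in> I \<Longrightarrow> small (A i)) \<Longrightarrow> small (\<Union>i\<in>I. A i)"
  unfolding small_def
  using card_of_UNION_ordLess_infinite_Field_regularCard[OF regular cinf] by blast

lemma small_nat: "small (UNIV :: nat set)"
  unfolding small_def using uncountable card_of_nat ordIso_ordLess_trans by blast

lemma small_countable: "countable A \<Longrightarrow> small A"
proof -
  assume "countable A"
  then have "A = {} \<or> (\<exists>f. A = f ` (UNIV :: nat set))"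
    using uncountable_def by blast
  then show ?thesis using small_image[OF small_nat] small_subset by blast
qed

lemma small_below: "small {x. x \<prec> y}"
proof (cases "y \<in> K")
  case True
  have "{x. x \<prec> y} = underS r y" by (auto simp: underS_def lt_def)
  then show ?thesis unfolding small_def using card_of_underS[OF card_order True] by simp
next
  case False
  then have "{x. x \<prec> y} = {}" using less_in by blast
  then show ?thesis by (simp add: small_countable)
qed

lemma small_upto: "small {x. x \<preceq> y}"
proof -
  have "{x. x \<preceq> y} \<subseteq> {x. x \<prec> y} \<union> {y}" using leq_iff by auto
  also have "\<dots> = (\<Union>i\<in>{True, False}. if i then {x. x \<prec> y} else {y})" by auto
  finally have sub: "{x. x \<preceq> y} \<subseteq> (\<Union>i\<in>{True, False}. if i then {x. x \<prec> y} else {y})" .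
  have "small (\<Union>i\<in>{True, False}. if i then {x. x \<prec> y} else {y})"
    by (rule small_UN) (auto intro: small_below small_countable)
  then show ?thesis using small_subset sub by blast
qed

lemma bounded_family:
  assumes "small I" "\<And>i. i \<in> I \<Longrightarrow> f i \<in> K"
  shows "\<exists>b\<in>K. \<forall>i\<in>I. f i \<prec> b"
  using bounded[of "f ` I"] small_image[OF assms(1), of f] assms(2) unfolding small_def by blast

lemma above: "x \<in> K \<Longrightarrow> \<exists>y. x \<prec> y"
  using bounded_family[of "{()}" "\<lambda>_. x"] small_countable[of "{()}"] by auto

lemma not_unbdd_iff: "A \<subseteq> K \<Longrightarrow> \<not> unbdd A \<longleftrightarrow> small A"
proof
  assume A: "A \<subseteq> K" "\<not> unbdd A"
  then obtain x where "x \<in> K" "\<And>a. a \<in> A \<Longrightarrow> \<not> x \<prec> a" unfolding unbdd_def by blast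
  then have "A \<subseteq> {a. a \<preceq> x}" using not_less A(1) by blast
  then show "small A" using small_upto small_subset by blast
next
  assume A: "A \<subseteq> K" "small A"
  then obtain b where "b \<in> K" "\<forall>a\<in>A. a \<prec> b"
    using bounded unfolding small_def by blast
  then show "\<not> unbdd A" unfolding unbdd_def using less_asym by blast
qed

lemma countable_sup:
  assumes "\<And>n :: nat. s n \<in> K"
  shows "\<exists>d\<in>K. (\<forall>n. s n \<preceq> d) \<and> (\<forall>z. z \<prec> d \<longrightarrow> (\<exists>n. z \<prec> s n))"
proof -
  define U where "U = {x \<in> K. \<forall>n. s n \<preceq> x}"
  obtain b where b: "b \<in> K" "\<forall>n. s n \<prec> b"
    using bounded_family[OF small_nat, of s] assms by blast
  then have "b \<in> U" using leq_iff by (simp add: U_def)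
  then obtain d where d: "d \<in> U" "\<forall>x\<in>U. d \<preceq> x"
    using least_ex[of U] unfolding U_def by blast
  have "\<exists>n. z \<prec> s n" if "z \<prec> d" for z
  proof (rule ccontr)
    assume "\<nexists>n. z \<prec> s n"
    then have "\<forall>n. s n \<preceq> z" using not_less less_in that assms by blast
    then have "d \<preceq> z" using d(2) less_in that unfolding U_def by blast
    then show False using that leq_less_trans less_irrefl by blast
  qed
  then show ?thesis using d(1) unfolding U_def by blast
qed

text \<open>Iterate the function and take the supremum.\<close>

lemma closure_point_sequence:
  assumes b: "\<And>z. z \<in> K \<Longrightarrow> b z \<in> K" and x: "x \<in> K"
  shows "\<exists>d\<in>cl b. x \<prec> d \<and> (\<exists>s. ladder d s)"
proof -
  define c where "c z = (SOME y. z \<prec> y \<and> (\<forall>u. u \<preceq> z \<longrightarrow> b u \<prec> y))" for z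
  have c: "z \<prec> c z \<and> (\<forall>u. u \<preceq> z \<longrightarrow> b u \<prec> c z)" if z: "z \<in> K" for z
  proof -
    obtain y1 where y1: "y1 \<in> K" "\<forall>u\<in>{u. u \<preceq> z}. b u \<prec> y1"
      using bounded_family[OF small_upto[of z], of b] b leq_in by blast
    obtain y2 where y2: "z \<prec> y2" using above z by blast
    have "y1 \<preceq> mx y1 y2" "y2 \<preceq> mx y1 y2" using mx[of y1 y2] y1 y2 less_in by blast+
    then have "z \<prec> mx y1 y2 \<and> (\<forall>u. u \<preceq> z \<longrightarrow> b u \<prec> mx y1 y2)"
      using y1 y2 less_leq_trans by blast
    then show ?thesis unfolding c_def by (rule someI)
  qed
  define s where "s n = (c ^^ n) x" for n
  have sK: "s n \<in> K" for n
  proof (induction n)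
    case 0 then show ?case using x by (simp add: s_def)
  next
    case (Suc n)
    then have "s n \<prec> c (s n)" using c by blast
    then show ?case using less_in(2) by (simp add: s_def)
  qed
  have sS: "s (Suc n) = c (s n)" for n by (simp add: s_def)
  obtain d where d: "d \<in> K" "\<And>n. s n \<preceq> d" "\<And>z. z \<prec> d \<Longrightarrow> \<exists>n. z \<prec> s n"
    using countable_sup[of s] sK by blast
  have step: "s n \<prec> s (Suc n)" for n using c[OF sK[of n]] sS by simp
  have lt: "s n \<prec> d" for n using less_leq_trans[OF step d(2)] .
  have "ladder d s" unfolding ladder_def using lt d(3) step by blast
  moreover have "d \<in> cl b"
    unfolding cl_def
  proof (safe intro!: d(1))
    show "\<exists>z. z \<prec> d" using lt by blast
    fix z assume "z \<prec> d"
    then obtain n where "z \<prec> s n" using d(3) by blast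
    then have "b z \<prec> s (Suc n)" using c[OF sK[of n]] sS leq_iff by simp
    then show "b z \<prec> d" using lt less_trans by blast
  qed
  moreover have "x \<prec> d" using lt[of 0] by (simp add: s_def)
  ultimately show ?thesis by blast
qed

text \<open>
  Positivity with respect to a normal ideal. A point \<open>d\<close> meets a demand \<open>b\<close> if \<open>\<Phi> d b\<close>; the demands
  are functions, and a demand may be weakened to one that it dominates diagonally from some
  point below \<open>d\<close> on. Stationarity is the case in which \<open>d\<close> only has to be a closure point.
\<close>

definition admissible :: "('a \<Rightarrow> ('a \<Rightarrow> 'a) \<Rightarrow> bool) \<Rightarrow> bool" where
  "admissible \<Phi> \<longleftrightarrow> (\<forall>d b. \<Phi> d b \<longrightarrow> d \<in> cl b) \<and>
     (\<forall>d b b' v. \<Phi> d b \<longrightarrow> v \<prec> d \<longrightarrow> (\<forall>z u. v \<preceq> z \<longrightarrow> u \<preceq> z \<longrightarrow> b' u \<preceq> b z) \<longrightarrow> \<Phi> d b')"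

definition pos :: "('a \<Rightarrow> ('a \<Rightarrow> 'a) \<Rightarrow> bool) \<Rightarrow> 'a set \<Rightarrow> bool" where
  "pos \<Phi> X \<longleftrightarrow> (\<forall>b. (\<forall>z\<in>K. b z \<in> K) \<longrightarrow> (\<exists>d\<in>X. \<Phi> d b))"

abbreviation stat :: "'a set \<Rightarrow> bool" where "stat X \<equiv> pos (\<lambda>d b. d \<in> cl b) X"

lemma admissible_cl: "admissible \<Phi> \<Longrightarrow> \<Phi> d b \<Longrightarrow> d \<in> cl b"
  unfolding admissible_def by blast

lemma admissible_weaken:
  assumes "admissible \<Phi>" "\<Phi> d b" "v \<prec> d" "\<And>z u. v \<preceq> z \<Longrightarrow> u \<preceq> z \<Longrightarrow> b' u \<preceq> b z"
  shows "\<Phi> d b'"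
proof -
  have "\<forall>z u. v \<preceq> z \<longrightarrow> u \<preceq> z \<longrightarrow> b' u \<preceq> b z" using assms(4) by simp
  then show ?thesis
    using assms(1)[unfolded admissible_def, THEN conjunct2, rule_format, OF assms(2,3)] by simp
qed

lemma cl_weaken:
  assumes "d \<in> cl b" "v \<prec> d" "\<And>z u. v \<preceq> z \<Longrightarrow> u \<preceq> z \<Longrightarrow> b' u \<preceq> b z"
  shows "d \<in> cl b'"
proof -
  have "b' u \<prec> d" if u: "u \<prec> d" for u
  proof -
    have vu: "v \<in> K" "u \<in> K" using assms(2) u less_in by blast+
    then have "b' u \<preceq> b (mx v u)" using assms(3) mx by blast
    moreover have "mx v u \<prec> d" using mx_less[OF vu] u assms(2) by blast
    ultimately show ?thesis using assms(1) clD leq_less_trans by blast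
  qed
  then show ?thesis using assms(1) unfolding cl_def by blast
qed

lemma admissible_stat: "admissible (\<lambda>d b. d \<in> cl b)"
  unfolding admissible_def using cl_weaken by blast

lemma pos_mono: "pos \<Phi> X \<Longrightarrow> X \<subseteq> Y \<Longrightarrow> pos \<Phi> Y"
  unfolding pos_def by blast

lemma dominate:
  assumes "small I" "\<And>i u. i \<in> I \<Longrightarrow> u \<in> K \<Longrightarrow> B i u \<in> K"
  shows "\<exists>b. (\<forall>z\<in>K. b z \<in> K) \<and> (\<forall>i\<in>I. \<forall>z u. u \<preceq> z \<longrightarrow> B i u \<prec> b z)"
proof -
  have "\<exists>y\<in>K. \<forall>i\<in>I. \<forall>u. u \<preceq> z \<longrightarrow> B i u \<prec> y" for z
  proof -
    have "small (\<Union>i\<in>I. B i ` {u. u \<preceq> z})"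
      by (intro small_UN assms(1) small_image small_upto)
    moreover have "(\<Union>i\<in>I. B i ` {u. u \<preceq> z}) \<subseteq> K" using assms(2) leq_in by blast
    ultimately obtain y where "y \<in> K" "\<forall>a\<in>(\<Union>i\<in>I. B i ` {u. u \<preceq> z}). a \<prec> y"
      using bounded unfolding small_def by blast
    then show ?thesis by blast
  qed
  then have "\<forall>z. \<exists>y. y \<in> K \<and> (\<forall>i\<in>I. \<forall>u. u \<preceq> z \<longrightarrow> B i u \<prec> y)" by blast
  from choice[OF this]
  obtain b where "\<forall>z. b z \<in> K \<and> (\<forall>i\<in>I. \<forall>u. u \<preceq> z \<longrightarrow> B i u \<prec> b z)" ..
  then show ?thesis by (intro exI[of _ b]) simp
qed

lemma dominate_diagonal:
  assumes "\<And>v u. v \<in> K \<Longrightarrow> u \<in> K \<Longrightarrow> B v u \<in> K"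
  shows "\<exists>b. (\<forall>z\<in>K. b z \<in> K) \<and> (\<forall>z v u. v \<preceq> z \<longrightarrow> u \<preceq> z \<longrightarrow> B v u \<prec> b z)"
proof -
  have "\<exists>y\<in>K. \<forall>v u. v \<preceq> z \<longrightarrow> u \<preceq> z \<longrightarrow> B v u \<prec> y" for z
  proof -
    have "\<exists>b. (\<forall>z\<in>K. b z \<in> K) \<and> (\<forall>i\<in>{v. v \<preceq> z}. \<forall>z u. u \<preceq> z \<longrightarrow> B i u \<prec> b z)"
      by (rule dominate) (use small_upto leq_in assms in auto)
    moreover have "\<exists>y. y \<in> K" using infinite_K by (metis ex_in_conv finite.emptyI)
    ultimately show ?thesis using leq_in by (cases "z \<in> K") blast+
  qed
  then have "\<forall>z. \<exists>y. y \<in> K \<and> (\<forall>v u. v \<preceq> z \<longrightarrow> u \<preceq> z \<longrightarrow> B v u \<prec> y)" by blast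
  from choice[OF this]
  obtain b where "\<forall>z. b z \<in> K \<and> (\<forall>v u. v \<preceq> z \<longrightarrow> u \<preceq> z \<longrightarrow> B v u \<prec> b z)" ..
  then show ?thesis by (intro exI[of _ b]) simp
qed

text \<open>
  Fodor's pressing-down lemma and completeness hold for every such ideal: if every fibre fails a
  demand, a point that meets a demand dominating all of these is in no fibre.
\<close>

lemma fodor:
  assumes adm: "admissible \<Phi>" and X: "pos \<Phi> X" and f: "\<And>d. d \<in> X \<Longrightarrow> f d \<prec> d"
  shows "\<exists>v. pos \<Phi> {d \<in> X. f d = v}"
proof (rule ccontr)
  assume "\<nexists>v. pos \<Phi> {d \<in> X. f d = v}"
  then have "\<forall>v. \<exists>b. (\<forall>z\<in>K. b z \<in> K) \<and> (\<forall>d\<in>X. f d = v \<longrightarrow> \<not> \<Phi> d b)"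
    unfolding pos_def by blast
  then obtain B where B: "\<And>v z. z \<in> K \<Longrightarrow> B v z \<in> K" "\<And>d. d \<in> X \<Longrightarrow> \<not> \<Phi> d (B (f d))"
    by metis
  obtain b where b: "\<forall>z\<in>K. b z \<in> K" "\<And>z v u. v \<preceq> z \<Longrightarrow> u \<preceq> z \<Longrightarrow> B v u \<prec> b z"
    using dominate_diagonal[of B] B(1) by blast
  obtain d where d: "d \<in> X" "\<Phi> d b" using X b(1) unfolding pos_def by blast
  have "B (f d) u \<preceq> b z" if "f d \<preceq> z" "u \<preceq> z" for z u
    using b(2)[OF that] by (rule less_imp_leq)
  then have "\<Phi> d (B (f d))"
    by (rule admissible_weaken[where \<Phi>=\<Phi> and b=b and v="f d", OF adm d(2) f[OF d(1)]])
  then show False using B(2) d(1) by blast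
qed

lemma pos_complete:
  assumes adm: "admissible \<Phi>" and X: "pos \<Phi> X" and I: "small I" and g: "\<And>d. d \<in> X \<Longrightarrow> g d \<in> I"
  shows "\<exists>i\<in>I. pos \<Phi> {d \<in> X. g d = i}"
proof (rule ccontr)
  assume "\<not> (\<exists>i\<in>I. pos \<Phi> {d \<in> X. g d = i})"
  then have "\<forall>i\<in>I. \<exists>b. (\<forall>z\<in>K. b z \<in> K) \<and> (\<forall>d\<in>X. g d = i \<longrightarrow> \<not> \<Phi> d b)"
    unfolding pos_def by blast
  then obtain B where B: "\<And>i z. i \<in> I \<Longrightarrow> z \<in> K \<Longrightarrow> B i z \<in> K"
      "\<And>i d. i \<in> I \<Longrightarrow> d \<in> X \<Longrightarrow> g d = i \<Longrightarrow> \<not> \<Phi> d (B i)"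
    by metis
  obtain b where b: "\<forall>z\<in>K. b z \<in> K" "\<And>i z u. i \<in> I \<Longrightarrow> u \<preceq> z \<Longrightarrow> B i u \<prec> b z"
    using dominate[OF I, of B] B(1) by blast
  obtain d where d: "d \<in> X" "\<Phi> d b" using X b(1) unfolding pos_def by blast
  obtain v where v: "v \<prec> d" using admissible_cl[OF adm d(2)] unfolding cl_def by blast
  have "B (g d) u \<preceq> b z" if "u \<preceq> z" for z u
    using b(2)[OF g[OF d(1)] that] by (rule less_imp_leq)
  then have "\<Phi> d (B (g d))"
    by (rule admissible_weaken[where \<Phi>=\<Phi> and b=b and v=v, OF adm d(2) v])
  then show False using B(2) d(1) g by blast
qed

lemma pos_cl:
  assumes adm: "admissible \<Phi>" and X: "pos \<Phi> X" and c: "\<And>z. z \<in> K \<Longrightarrow> c z \<in> K"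
  shows "pos \<Phi> {d \<in> X. d \<in> cl c}"
  unfolding pos_def
proof (intro allI impI)
  fix b assume b: "\<forall>z\<in>K. b z \<in> K"
  obtain a where a: "\<forall>z\<in>K. a z \<in> K"
      "\<And>i z u. u \<preceq> z \<Longrightarrow> (if i then b else c) u \<prec> a z"
  proof -
    have "\<exists>a. (\<forall>z\<in>K. a z \<in> K) \<and> (\<forall>i\<in>UNIV. \<forall>z u. u \<preceq> z \<longrightarrow> (if i then b else c) u \<prec> a z)"
      by (rule dominate) (use b c small_countable[of "UNIV :: bool set"] in auto)
    then show ?thesis using that by blast
  qed
  obtain d where d: "d \<in> X" "\<Phi> d a" using X a(1) unfolding pos_def by blast
  obtain v where v: "v \<prec> d" using admissible_cl[OF adm d(2)] unfolding cl_def by blast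
  have "\<Phi> d (if i then b else c)" for i
  proof (rule admissible_weaken[where \<Phi>=\<Phi> and b=a and v=v, OF adm d(2) v])
    fix z u assume "u \<preceq> z"
    then show "(if i then b else c) u \<preceq> a z" using a(2)[of u z i] by (simp add: less_imp_leq)
  qed
  from this[of True] this[of False] show "\<exists>d\<in>{d \<in> X. d \<in> cl c}. \<Phi> d b"
    using d(1) admissible_cl[OF adm] by auto
qed

lemma pos_above:
  assumes "admissible \<Phi>" "pos \<Phi> X" "v \<in> K"
  shows "pos \<Phi> {d \<in> X. v \<prec> d}"
proof -
  have "pos \<Phi> {d \<in> X. d \<in> cl (\<lambda>_. v)}" by (rule pos_cl[OF assms(1,2)]) (rule assms(3))
  then show ?thesis by (rule pos_mono) (auto simp: cl_def)
qed

lemma pos_unbdd: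
  assumes "admissible \<Phi>" "pos \<Phi> X" "X \<subseteq> K"
  shows "unbdd X"
  unfolding unbdd_def
proof (intro conjI ballI assms(3))
  fix x assume "x \<in> K"
  then have "\<exists>d\<in>{d \<in> X. x \<prec> d}. \<Phi> d (\<lambda>_. x)"
    using pos_above[OF assms(1,2)] unfolding pos_def by simp
  then show "\<exists>a\<in>X. x \<prec> a" by blast
qed

lemma fodor_finite_sets:
  assumes adm: "admissible \<Phi>" and X: "pos \<Phi> X"
    and F: "\<And>d. d \<in> X \<Longrightarrow> finite (F d)" "\<And>d x. d \<in> X \<Longrightarrow> x \<in> F d \<Longrightarrow> x \<prec> d"
  shows "\<exists>R. finite R \<and> pos \<Phi> {d \<in> X. F d = R}"
proof -
  have *: "\<exists>R. finite R \<and> pos \<Phi> {d \<in> X. F d = R}"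
    if "pos \<Phi> X" "\<And>d. d \<in> X \<Longrightarrow> finite (F d) \<and> card (F d) = k \<and> (\<forall>x\<in>F d. x \<prec> d)" for X F k
    using that
  proof (induction k arbitrary: X F)
    case 0
    then have "F d = {}" if "d \<in> X" for d using that by (metis card_0_eq)
    then have "{d \<in> X. F d = {}} = X" by auto
    with 0 show ?case by (metis finite.emptyI)
  next
    case (Suc k)
    define f where "f d = (SOME x. x \<in> F d)" for d
    have f: "f d \<in> F d" if "d \<in> X" for d
      using Suc.prems(2)[OF that] unfolding f_def by (metis card.empty ex_in_conv nat.simps(3) someI)
    obtain v where v: "pos \<Phi> {d \<in> X. f d = v}"
      using fodor[OF adm Suc.prems(1), of f] f Suc.prems(2) by blast
    have "\<exists>R. finite R \<and> pos \<Phi> {d \<in> {d \<in> X. f d = v}. F d - {v} = R}"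
      by (rule Suc.IH[OF v]) (use Suc.prems(2) f in auto)
    then obtain R where R: "finite R" "pos \<Phi> {d \<in> {d \<in> X. f d = v}. F d - {v} = R}" by blast
    have "pos \<Phi> {d \<in> X. F d = insert v R}"
      by (rule pos_mono[OF R(2)]) (use f in auto)
    then show ?case using R(1) by blast
  qed
  obtain k where k: "pos \<Phi> {d \<in> X. card (F d) = k}"
    using pos_complete[OF adm X small_nat, of "\<lambda>d. card (F d)"] by auto
  obtain R where "finite R" "pos \<Phi> {d \<in> {d \<in> X. card (F d) = k}. F d = R}"
    using *[OF k, of F k] F by auto
  then show ?thesis using pos_mono[of \<Phi> _ "{d \<in> X. F d = R}"] by blast
qed

lemma stat_ladder: "stat {d. \<exists>s. ladder d s}"
proof -
  obtain x where "x \<in> K" using infinite_K by (metis ex_in_conv finite.emptyI)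
  then show ?thesis unfolding pos_def using closure_point_sequence by blast
qed

end

section \<open>Walks\<close>

context wellorder_rel
begin

lemma below_iff: "(x, y) \<in> below r d \<longleftrightarrow> x \<preceq> y \<and> x \<prec> d \<and> y \<prec> d"
  unfolding below_def underS_def lt_def by auto

lemma Field_below: "Field (below r d) = {x. x \<prec> d}"
proof
  show "Field (below r d) \<subseteq> {x. x \<prec> d}" by (auto simp: Field_def below_iff)
  have "(x, x) \<in> below r d" if "x \<prec> d" for x
    using that leq_refl less_in unfolding below_iff by blast
  then show "{x. x \<prec> d} \<subseteq> Field (below r d)" by (auto intro: FieldI1)
qed

lemma cofinal_below_iff:
  "cofinal A (below r d) \<longleftrightarrow> (\<forall>z. z \<prec> d \<longrightarrow> (\<exists>x\<in>A. z \<prec> x \<and> x \<prec> d))"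
proof
  assume c: "cofinal A (below r d)"
  show "\<forall>z. z \<prec> d \<longrightarrow> (\<exists>x\<in>A. z \<prec> x \<and> x \<prec> d)"
  proof (intro allI impI)
    fix z assume "z \<prec> d"
    then obtain x where "x \<in> A" "z \<noteq> x" "(z, x) \<in> below r d"
      using c unfolding cofinal_def Field_below by blast
    then show "\<exists>x\<in>A. z \<prec> x \<and> x \<prec> d" unfolding below_iff using leq_neq by blast
  qed
next
  assume c: "\<forall>z. z \<prec> d \<longrightarrow> (\<exists>x\<in>A. z \<prec> x \<and> x \<prec> d)"
  show "cofinal A (below r d)"
    unfolding cofinal_def Field_below
  proof
    fix z assume z: "z \<in> {x. x \<prec> d}"
    then obtain x where x: "x \<in> A" "z \<prec> x" "x \<prec> d" using c by blast
    then have "z \<noteq> x" "(z, x) \<in> below r d"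
      unfolding below_iff using z less_imp_leq less_irrefl by auto
    then show "\<exists>b\<in>A. z \<noteq> b \<and> (z, b) \<in> below r d" using x(1) by blast
  qed
qed

lemma limit_below_iff: "limit_order (below r d) \<longleftrightarrow> limit_pt d"
  unfolding limit_order_def cofinal_below_iff Field_below limit_pt_def by blast

definition lst :: "'a set \<Rightarrow> 'a" where "lst A = (SOME m. m \<in> A \<and> (\<forall>x\<in>A. m \<preceq> x))"

lemma lst: "A \<subseteq> K \<Longrightarrow> A \<noteq> {} \<Longrightarrow> lst A \<in> A" "A \<subseteq> K \<Longrightarrow> x \<in> A \<Longrightarrow> lst A \<preceq> x"
  using someI_ex[of "\<lambda>m. m \<in> A \<and> (\<forall>x\<in>A. m \<preceq> x)"] least_ex[of A]
  unfolding lst_def by blast+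

text \<open>
  \<open>step p e\<close> is the first stop on the way from \<open>p\<close> down to \<open>e\<close>. The point is that near a point
  \<open>d\<close> of \<open>S\<close> every walk that comes from above \<open>d\<close> does the same as the walk to \<open>d\<close> itself.
\<close>

definition stepping :: "'a set \<Rightarrow> ('a \<Rightarrow> 'a \<Rightarrow> 'a) \<Rightarrow> bool" where
  "stepping S step \<longleftrightarrow> (\<forall>p e. e \<prec> p \<longrightarrow> e \<preceq> step p e \<and> step p e \<prec> p) \<and>
     (\<forall>p. \<forall>d\<in>S. d \<prec> p \<longrightarrow> (\<exists>l. l \<prec> d \<and> (\<forall>e. l \<prec> e \<longrightarrow> e \<prec> d \<longrightarrow> step p e = step p d)))"

text \<open>
  From a limit point one steps to the next point of a cofinal set none of whose accumulation
  points lies in \<open>S\<close>; a ladder has no accumulation points at all.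
\<close>

lemma stepping_exists:
  assumes lim: "\<And>d. d \<in> S \<Longrightarrow> limit_pt d"
    and cof: "\<And>p. limit_pt p \<Longrightarrow> (\<exists>s. ladder p s) \<or>
      (\<exists>C. (\<forall>z. z \<prec> p \<longrightarrow> (\<exists>x\<in>C. z \<prec> x \<and> x \<prec> p)) \<and>
           (\<forall>d\<in>S. d \<prec> p \<longrightarrow> \<not> (\<forall>z. z \<prec> d \<longrightarrow> (\<exists>x\<in>C. z \<prec> x \<and> x \<prec> d))))"
  shows "\<exists>step. stepping S step"
proof -
  have "\<exists>C. (\<forall>x\<in>C. x \<prec> p) \<and> (\<forall>z. z \<prec> p \<longrightarrow> (\<exists>x\<in>C. z \<prec> x)) \<and>
         (\<forall>d\<in>S. d \<prec> p \<longrightarrow> (\<exists>l. l \<prec> d \<and> (\<forall>x\<in>C. \<not> (l \<prec> x \<and> x \<prec> d))))" if p: "limit_pt p" for p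
    using cof[OF p]
  proof
    assume "\<exists>s. ladder p s"
    then obtain s where s: "ladder p s" ..
    have "\<exists>l. l \<prec> d \<and> (\<forall>x\<in>range s. \<not> (l \<prec> x \<and> x \<prec> d))" if d: "d \<in> S" "d \<prec> p" for d
    proof -
      obtain n where n: "d \<prec> s n" using s d(2) unfolding ladder_def by blast
      have "{x \<in> range s. x \<prec> d} \<subseteq> s ` {..<n}"
      proof safe
        fix m assume "s m \<prec> d"
        then have "\<not> n \<le> m" using ladder_leq[OF s, of n m] n less_trans leq_less_trans less_irrefl by blast
        then show "s m \<in> s ` {..<n}" by auto
      qed
      then have fin: "finite {x \<in> range s. x \<prec> d}" using finite_subset by blast
      obtain z where z: "z \<prec> d" using lim[OF d(1)] unfolding limit_pt_def by blast
      obtain m where "m \<prec> d" "\<forall>a\<in>{x \<in> range s. x \<prec> d}. a \<preceq> m"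
        using finite_bound[OF fin _ z] by blast
      then show ?thesis using leq_less_trans less_irrefl by blast
    qed
    then show ?thesis using s unfolding ladder_def by (intro exI[of _ "range s"]) auto
  next
    assume "\<exists>C. (\<forall>z. z \<prec> p \<longrightarrow> (\<exists>x\<in>C. z \<prec> x \<and> x \<prec> p)) \<and>
           (\<forall>d\<in>S. d \<prec> p \<longrightarrow> \<not> (\<forall>z. z \<prec> d \<longrightarrow> (\<exists>x\<in>C. z \<prec> x \<and> x \<prec> d)))"
    then obtain C where C: "\<forall>z. z \<prec> p \<longrightarrow> (\<exists>x\<in>C. z \<prec> x \<and> x \<prec> p)"
      "\<forall>d\<in>S. d \<prec> p \<longrightarrow> \<not> (\<forall>z. z \<prec> d \<longrightarrow> (\<exists>x\<in>C. z \<prec> x \<and> x \<prec> d))" by blast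
    show ?thesis by (rule exI[of _ "{x \<in> C. x \<prec> p}"]) (use C in blast)
  qed
  then obtain C where C: "\<And>p x. limit_pt p \<Longrightarrow> x \<in> C p \<Longrightarrow> x \<prec> p"
      "\<And>p z. limit_pt p \<Longrightarrow> z \<prec> p \<Longrightarrow> \<exists>x\<in>C p. z \<prec> x"
      "\<And>p d. limit_pt p \<Longrightarrow> d \<in> S \<Longrightarrow> d \<prec> p \<Longrightarrow> \<exists>l. l \<prec> d \<and> (\<forall>x\<in>C p. \<not> (l \<prec> x \<and> x \<prec> d))"
    by metis
  define pre where "pre p = (SOME q. q \<prec> p \<and> (\<forall>y. y \<prec> p \<longrightarrow> y \<preceq> q))" for p
  have pre: "pre p \<prec> p \<and> (\<forall>y. y \<prec> p \<longrightarrow> y \<preceq> pre p)" if e: "e \<prec> p" "\<not> limit_pt p" for p e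
  proof -
    obtain z where z: "z \<prec> p" "\<nexists>y. z \<prec> y \<and> y \<prec> p" using e unfolding limit_pt_def by blast
    then have "\<forall>y. y \<prec> p \<longrightarrow> y \<preceq> z" using not_less less_in by blast
    with z(1) show ?thesis unfolding pre_def using someI_ex[of "\<lambda>q. q \<prec> p \<and> (\<forall>y. y \<prec> p \<longrightarrow> y \<preceq> q)"] by blast
  qed
  define step where "step p e = (if limit_pt p then lst {x \<in> C p. e \<preceq> x} else pre p)" for p e
  have 1: "e \<preceq> step p e \<and> step p e \<prec> p" if e: "e \<prec> p" for p e
  proof (cases "limit_pt p")
    case True
    have "{x \<in> C p. e \<preceq> x} \<subseteq> K" using leq_in by blast
    moreover have "{x \<in> C p. e \<preceq> x} \<noteq> {}" using C(2)[OF True e] less_imp_leq by blast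
    ultimately have "lst {x \<in> C p. e \<preceq> x} \<in> {x \<in> C p. e \<preceq> x}" by (rule lst(1))
    then show ?thesis using C(1)[OF True] True by (simp add: step_def)
  next
    case False
    then show ?thesis using pre[OF e False] e unfolding step_def by simp
  qed
  have 2: "\<exists>l. l \<prec> d \<and> (\<forall>e. l \<prec> e \<longrightarrow> e \<prec> d \<longrightarrow> step p e = step p d)" if d: "d \<in> S" "d \<prec> p" for p d
  proof (cases "limit_pt p")
    case True
    obtain l where l: "l \<prec> d" "\<forall>x\<in>C p. \<not> (l \<prec> x \<and> x \<prec> d)" using C(3)[OF True d] by blast
    have "step p e = step p d" if e: "l \<prec> e" "e \<prec> d" for e
    proof -
      have "e \<preceq> x \<longleftrightarrow> d \<preceq> x" if x: "x \<in> C p" for x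
      proof
        assume "e \<preceq> x"
        then have "\<not> x \<prec> d" using l(2) x e less_leq_trans by blast
        then show "d \<preceq> x" using not_less less_in[OF d(2)] less_in[OF C(1)[OF True x]] by blast
      qed (use e leq_trans less_imp_leq in blast)
      then have "{x \<in> C p. e \<preceq> x} = {x \<in> C p. d \<preceq> x}" by blast
      then show ?thesis unfolding step_def using True by simp
    qed
    then show ?thesis using l(1) by blast
  next
    case False
    then show ?thesis using lim[OF d(1)] unfolding step_def limit_pt_def by auto
  qed
  show ?thesis unfolding stepping_def using 1 2 by blast
qed

end

context regular_rel
begin

lemma pos_nonempty: "pos \<Phi> X \<Longrightarrow> \<exists>d. d \<in> X"
  unfolding pos_def by (drule spec[of _ "\<lambda>z. z"]) auto

lemma stationary_imp_stat:
  assumes "stationary S r"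
  shows "stat S"
  unfolding pos_def
proof (intro allI impI)
  fix b assume b: "\<forall>z\<in>K. b z \<in> K"
  have "\<exists>c. (\<forall>z\<in>K. c z \<in> K) \<and> (\<forall>i\<in>UNIV. \<forall>z u. u \<preceq> z \<longrightarrow> (if i then b u else u) \<prec> c z)"
    by (rule dominate) (use b small_countable[of "UNIV :: bool set"] in auto)
  then obtain c where c: "\<forall>z\<in>K. c z \<in> K" "\<And>i z u. u \<preceq> z \<Longrightarrow> (if i then b u else u) \<prec> c z"
    by blast
  have cb: "b z \<prec> c z" "z \<prec> c z" if "z \<in> K" for z
    using c(2)[of z z True] c(2)[of z z False] leq_refl[OF that] by auto
  have "club (cl c) r"
    unfolding club_def
  proof (intro conjI ballI impI)
    show "cl c \<subseteq> Field r" using cl_in by blast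
    show "cofinal (cl c) r"
      unfolding cofinal_def using closure_point_sequence[of c] c(1) by (metis lt_def)
    fix d assume d: "d \<in> Field r" "limit_order (below r d) \<and> cofinal (cl c \<inter> underS r d) (below r d)"
    then have lim: "limit_pt d" and cof: "\<And>z. z \<prec> d \<Longrightarrow> \<exists>x\<in>cl c. z \<prec> x \<and> x \<prec> d"
      unfolding limit_below_iff cofinal_below_iff by blast+
    have "c z \<prec> d" if "z \<prec> d" for z
      using cof[OF that] clD less_trans by blast
    then show "d \<in> cl c" using lim d(1) unfolding cl_def limit_pt_def by blast
  qed
  then obtain d where d: "d \<in> S" "d \<in> cl c" using assms unfolding stationary_def by blast
  have "d \<in> cl b" by (rule cl_mono[OF d(2)]) (rule less_imp_leq, rule cb(1), erule less_in(1))
  then show "\<exists>d\<in>S. d \<in> cl b" using d(1) by blast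
qed

lemma stat_limit_pts:
  assumes "stat S"
  shows "stat {d \<in> S. limit_pt d}"
proof -
  have "\<forall>z\<in>K. \<exists>y\<in>K. z \<prec> y" using above less_in by blast
  then obtain c where c: "\<And>z. z \<in> K \<Longrightarrow> c z \<in> K \<and> z \<prec> c z" by metis
  have "stat {d \<in> S. d \<in> cl c}" by (rule pos_cl[OF admissible_stat assms]) (use c in blast)
  then show ?thesis by (rule pos_mono) (use c limit_ptI less_in in blast)
qed

text \<open>
  Below a point of uncountable cofinality there is a club that misses \<open>S\<close>, and a club contains its
  accumulation points.
\<close>

lemma non_reflecting_stepping:
  assumes nr: "non_reflecting S r" and SK: "S \<subseteq> K"
  shows "\<exists>step. stepping {d \<in> S. limit_pt d} step"
proof (rule stepping_exists)
  fix p assume p: "limit_pt p"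
  then obtain z where z: "z \<prec> p" unfolding limit_pt_def by blast
  then have pK: "p \<in> K" using less_in by blast
  show "(\<exists>s. ladder p s) \<or> (\<exists>C. (\<forall>z. z \<prec> p \<longrightarrow> (\<exists>x\<in>C. z \<prec> x \<and> x \<prec> p)) \<and>
           (\<forall>d\<in>{d \<in> S. limit_pt d}. d \<prec> p \<longrightarrow> \<not> (\<forall>z. z \<prec> d \<longrightarrow> (\<exists>x\<in>C. z \<prec> x \<and> x \<prec> d))))"
  proof (cases "limit_of_uncountable_cofinality (below r p)")
    case True
    have "\<not> stationary (S \<inter> underS r p) (below r p)"
      using nr True pK unfolding non_reflecting_def by blast
    moreover have "S \<inter> underS r p \<subseteq> Field (below r p)"
      unfolding Field_below underS_def lt_def by blast
    ultimately obtain C where C: "club C (below r p)" "S \<inter> underS r p \<inter> C = {}"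
      unfolding stationary_def by blast
    have cof: "\<forall>z. z \<prec> p \<longrightarrow> (\<exists>x\<in>C. z \<prec> x \<and> x \<prec> p)"
      using C(1)[unfolded club_def cofinal_below_iff] by (elim conjE)
    have "\<not> (\<forall>z. z \<prec> d \<longrightarrow> (\<exists>x\<in>C. z \<prec> x \<and> x \<prec> d))" if d: "d \<in> S" "limit_pt d" "d \<prec> p" for d
    proof
      assume *: "\<forall>z. z \<prec> d \<longrightarrow> (\<exists>x\<in>C. z \<prec> x \<and> x \<prec> d)"
      have ub: "underS (below r p) d = {x. x \<prec> d}"
      proof (intro set_eqI)
        fix x
        have "x \<prec> p" if "x \<prec> d" using that d(3) by (rule less_trans)
        then show "x \<in> underS (below r p) d \<longleftrightarrow> x \<in> {x. x \<prec> d}"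
          unfolding underS_def below_iff using d(3) by (auto simp: lt_def)
      qed
      have bb: "below (below r p) d = below r d"
      proof (intro set_eqI)
        fix x :: "'a \<times> 'a"
        obtain u v where x: "x = (u, v)" by (cases x)
        have "u \<prec> p" if "u \<prec> d" for u using that d(3) by (rule less_trans)
        then show "x \<in> below (below r p) d \<longleftrightarrow> x \<in> below r d"
          unfolding below_def[of "below r p"] ub x by (auto simp: below_iff)
      qed
      have "limit_order (below (below r p) d) \<and> cofinal (C \<inter> underS (below r p) d) (below (below r p) d)"
        unfolding bb limit_below_iff cofinal_below_iff ub using d(2) * by blast
      then have "d \<in> C" using C(1)[unfolded club_def Field_below] d(3) by (elim conjE) simp
      moreover have "d \<in> underS r p" using d(3) unfolding underS_def lt_def by blast
      ultimately show False using C(2) d(1) by blast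
    qed
    then show ?thesis using cof by (intro disjI2 exI[of _ C]) simp
  next
    case False
    then obtain A where A: "A \<subseteq> {x. x \<prec> p}" "\<forall>z. z \<prec> p \<longrightarrow> (\<exists>x\<in>A. z \<prec> x \<and> x \<prec> p)" "countable A"
      using p unfolding limit_of_uncountable_cofinality_def limit_below_iff Field_below
        cofinal_below_iff by blast
    then have "A \<noteq> {}" using z by blast
    then obtain s :: "nat \<Rightarrow> 'a" where s: "A = range s" using A(3) uncountable_def by blast
    have 1: "s n \<prec> p" for n using A(1) unfolding s by auto
    have 2: "\<exists>n. z \<prec> s n" if "z \<prec> p" for z using A(2) that unfolding s by auto
    obtain k :: "nat \<Rightarrow> nat" where "ladder p (s \<circ> k)"
      using ladder_from_sequence[OF 1 2] by metis
    then show ?thesis by (intro disjI1 exI)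
  qed
qed blast

end

locale walk = regular_rel +
  fixes S :: "'a set" and step :: "'a \<Rightarrow> 'a \<Rightarrow> 'a"
  assumes stepping: "stepping S step"
    and S_stat: "stat S"
    and S_limit: "\<And>d. d \<in> S \<Longrightarrow> limit_pt d"
begin

lemma S_in: "d \<in> S \<Longrightarrow> d \<in> K"
  using S_limit less_in unfolding limit_pt_def by blast

lemma step: "e \<prec> p \<Longrightarrow> e \<preceq> step p e" "e \<prec> p \<Longrightarrow> step p e \<prec> p"
  using stepping unfolding stepping_def by blast+

lemma step_near:
  "d \<in> S \<Longrightarrow> d \<prec> p \<Longrightarrow> \<exists>l. l \<prec> d \<and> (\<forall>e. l \<prec> e \<longrightarrow> e \<prec> d \<longrightarrow> step p e = step p d)"
  using stepping[unfolded stepping_def, THEN conjunct2] by simp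

text \<open>The end of a walk is not listed, so that consecutive walks can be appended.\<close>

function path :: "'a \<Rightarrow> 'a \<Rightarrow> 'a list" where
  "path p e = (if e \<prec> p \<and> step p e \<prec> p then p # path (step p e) e else [])"
  by auto
termination
  by (relation "inv_image {(x, y). x \<prec> y} fst") (auto intro: wf_less)

declare path.simps [simp del]

lemma path_Cons: "e \<prec> p \<Longrightarrow> path p e = p # path (step p e) e"
  using step by (subst path.simps) simp

lemma path_self: "path p p = []"
  using less_irrefl by (subst path.simps) simp

text \<open>
  Each of the finitely many steps of the walk from \<open>p\<close> to \<open>d\<close> is also made on the way to any point
  close enough to \<open>d\<close>.
\<close>

lemma path_near:
  assumes d: "d \<in> S"
  shows "d \<prec> p \<Longrightarrow> \<exists>l. l \<prec> d \<and> (\<forall>e. l \<prec> e \<longrightarrow> e \<prec> d \<longrightarrow> path p e = path p d @ path d e)"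
proof (induction p rule: less_induct)
  case (less p)
  obtain l where l: "l \<prec> d" "\<And>e. l \<prec> e \<Longrightarrow> e \<prec> d \<Longrightarrow> step p e = step p d"
    using step_near[OF d less.prems] by blast
  have q: "d \<preceq> step p d" "step p d \<prec> p" using step[OF less.prems] by auto
  have pe: "path p e = p # path (step p d) e" if "l \<prec> e" "e \<prec> d" for e
    using path_Cons[of e p] l(2)[OF that] that(2) less.prems less_trans by simp
  show ?case
  proof (cases "step p d = d")
    case True
    then show ?thesis using l(1) pe path_Cons[OF less.prems] path_self by auto
  next
    case False
    then have "d \<prec> step p d" using q(1) leq_neq by metis
    then obtain l' where l': "l' \<prec> d" "\<And>e. l' \<prec> e \<Longrightarrow> e \<prec> d \<Longrightarrow> path (step p d) e = path (step p d) d @ path d e"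
      using less.IH[OF q(2)] by blast
    have "mx l l' \<prec> d" using mx_less[of l l' d] l(1) l'(1) less_in by blast
    moreover have "path p e = path p d @ path d e" if e: "mx l l' \<prec> e" "e \<prec> d" for e
    proof -
      have "l \<prec> e" "l' \<prec> e" using e(1) mx_less[of l l' e] l(1) l'(1) less_in by blast+
      then show ?thesis using pe l'(2) e(2) path_Cons[OF less.prems] by simp
    qed
    ultimately show ?thesis by (intro exI[of _ "mx l l'"]) simp
  qed
qed

text \<open>
  Solovay's partition theorem. For some \<open>e\<close> the regressive function \<open>\<lambda>d. step d e\<close> must be
  unbounded modulo the nonstationary ideal: otherwise, for two suitably closed points \<open>d' \<prec> d\<close> of
  \<open>S\<close>, the values \<open>step d e\<close> with \<open>e \<prec> d'\<close> would all lie below \<open>d'\<close>, while for \<open>e\<close> close to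
  \<open>d'\<close> they equal \<open>step d d' \<succeq> d'\<close>.
\<close>

lemma unbounded_regressive:
  "\<exists>e\<in>K. \<forall>c\<in>K. stat {d \<in> S. e \<prec> d \<and> c \<preceq> step d e}"
proof (rule ccontr)
  assume "\<not> ?thesis"
  then have "\<forall>e\<in>K. \<exists>c\<in>K. \<exists>b. (\<forall>z\<in>K. b z \<in> K) \<and> (\<forall>d\<in>S. e \<prec> d \<and> c \<preceq> step d e \<longrightarrow> d \<notin> cl b)"
    unfolding pos_def by blast
  then obtain c B where c: "\<And>e. e \<in> K \<Longrightarrow> c e \<in> K" and B: "\<And>e z. e \<in> K \<Longrightarrow> z \<in> K \<Longrightarrow> B e z \<in> K"
    and cB: "\<And>e d. e \<in> K \<Longrightarrow> d \<in> S \<Longrightarrow> e \<prec> d \<Longrightarrow> c e \<preceq> step d e \<Longrightarrow> d \<notin> cl (B e)"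
    by metis
  obtain b where b: "\<forall>z\<in>K. b z \<in> K" "\<And>z v u. v \<preceq> z \<Longrightarrow> u \<preceq> z \<Longrightarrow> mx (B v u) (c v) \<prec> b z"
    using dominate_diagonal[of "\<lambda>v u. mx (B v u) (c v)"] mx(3) B c by blast
  have bB: "B v u \<prec> b z" "c v \<prec> b z" if "v \<preceq> z" "u \<preceq> z" for v u z
    using b(2)[OF that] mx_less[of "B v u" "c v"] B c leq_in that by blast+
  obtain d' where d': "d' \<in> S" "d' \<in> cl b" using S_stat b(1) unfolding pos_def by blast
  obtain d where d: "d \<in> S" "d' \<prec> d" "d \<in> cl b"
    using pos_above[OF admissible_stat S_stat S_in[OF d'(1)]] b(1) unfolding pos_def by blast
  obtain l where l: "l \<prec> d'" "\<And>e. l \<prec> e \<Longrightarrow> e \<prec> d' \<Longrightarrow> step d e = step d d'"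
    using step_near[OF d'(1) d(2)] by blast
  obtain e where e: "l \<prec> e" "e \<prec> d'" using S_limit[OF d'(1)] l(1) unfolding limit_pt_def by blast
  have eK: "e \<in> K" and ed: "e \<prec> d" using e d(2) less_in less_trans by blast+
  have "d' \<preceq> step d e" using l(2)[OF e] step(1)[OF d(2)] by simp
  moreover have "c e \<prec> d'" using bB(2)[of e e e] clD[OF d'(2) e(2)] leq_refl[OF eK] less_trans by blast
  ultimately have "c e \<preceq> step d e" using less_leq_trans less_imp_leq by blast
  moreover have "d \<in> cl (B e)"
  proof (rule cl_weaken[OF d(3) ed])
    fix z u assume "e \<preceq> z" "u \<preceq> z"
    then show "B e u \<preceq> b z" using bB(1) less_imp_leq by simp
  qed
  ultimately show False using cB[OF eK d(1) ed] by blast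
qed

lemma stationary_partition:
  assumes I: "|I| \<le>o r"
  shows "\<exists>f. \<forall>i\<in>I. stat {d \<in> S. f d = i}"
proof -
  obtain e where e: "\<And>c. c \<in> K \<Longrightarrow> stat {d \<in> S. e \<prec> d \<and> c \<preceq> step d e}"
    using unbounded_regressive by blast
  define V where "V = {v \<in> K. stat {d \<in> S. e \<prec> d \<and> step d e = v}}"
  have "unbdd V"
    unfolding unbdd_def
  proof (intro conjI ballI)
    fix x assume "x \<in> K"
    then obtain c where c: "x \<prec> c" "c \<in> K" using above less_in by blast
    define X where "X = {d \<in> S. e \<prec> d \<and> c \<preceq> step d e}"
    obtain v where v: "stat {d \<in> X. step d e = v}"
      using fodor[OF admissible_stat e[OF c(2)], of "\<lambda>d. step d e"] step(2) unfolding X_def by blast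
    have "stat {d \<in> S. e \<prec> d \<and> step d e = v}" by (rule pos_mono[OF v]) (auto simp: X_def)
    moreover obtain d where "d \<in> X" "step d e = v"
      using pos_nonempty[OF v] by blast
    then have "c \<preceq> v" unfolding X_def by blast
    ultimately show "\<exists>a\<in>V. x \<prec> a" using c less_leq_trans leq_in unfolding V_def by blast
  qed (auto simp: V_def)
  then have "\<not> small V" using not_unbdd_iff unfolding unbdd_def by blast
  then have "r \<le>o |V|"
    unfolding small_def using not_ordLess_iff_ordLeq well_order card_of_Well_order by blast
  then have "|I| \<le>o |V|" using I ordLeq_transitive by blast
  then obtain g where g: "inj_on g I" "g ` I \<subseteq> V" using card_of_ordLeq[of I V] by blast
  have "stat {d \<in> S. inv_into I g (step d e) = i}" if i: "i \<in> I" for i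
  proof -
    have "stat {d \<in> S. e \<prec> d \<and> step d e = g i}" using g(2) i unfolding V_def by blast
    then show ?thesis by (rule pos_mono) (use g(1) i in auto)
  qed
  then show ?thesis by (intro exI[of _ "\<lambda>d. inv_into I g (step d e)"] ballI)
qed

end

section \<open>Words of letters and their ranks\<close>

locale ladder_system = regular_rel +
  fixes e :: "'a \<Rightarrow> nat \<Rightarrow> 'a"
begin

abbreviation lad :: "'a \<Rightarrow> bool" where "lad b \<equiv> ladder b (e b)"

definition rung :: "'a \<Rightarrow> 'a \<Rightarrow> nat" where
  "rung x b = (if lad b then card {k. e b k \<prec> x} else 0)"

lemma finite_rungs:
  assumes "lad b" "x \<prec> b"
  shows "finite {k. e b k \<prec> x}"
proof -
  obtain n where n: "x \<prec> e b n" using assms unfolding ladder_def by blast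
  have "k < n" if "e b k \<prec> x" for k
  proof (rule ccontr)
    assume "\<not> k < n"
    then have "e b n \<preceq> e b k" using ladder_leq[OF assms(1)] by simp
    then show False using n that leq_less_trans less_asym by blast
  qed
  then have "{k. e b k \<prec> x} \<subseteq> {..<n}" by auto
  then show ?thesis using finite_subset by blast
qed

lemma rung_mono:
  assumes "x \<preceq> y" "y \<prec> b"
  shows "rung x b \<le> rung y b"
proof (cases "lad b")
  case True
  have "{k. e b k \<prec> x} \<subseteq> {k. e b k \<prec> y}" using assms(1) less_leq_trans by blast
  then show ?thesis unfolding rung_def using finite_rungs[OF True assms(2)] True by (simp add: card_mono)
qed (simp add: rung_def)

lemma rung_le:
  assumes "lad b" "x \<preceq> e b n"
  shows "rung x b \<le> n"
proof -
  have "k < n" if k: "e b k \<prec> x" for k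
  proof (rule ccontr)
    assume "\<not> k < n"
    then have "e b n \<preceq> e b k" using ladder_leq[OF assms(1)] by simp
    then show False using k assms(2) leq_less_trans less_leq_trans less_irrefl by blast
  qed
  then have "{k. e b k \<prec> x} \<subseteq> {..<n}" by auto
  then have "card {k. e b k \<prec> x} \<le> card {..<n}" by (intro card_mono) auto
  then show ?thesis using assms(1) by (simp add: rung_def)
qed

lemma rung_eq:
  assumes "lad b" "1 \<le> n" "e b (n - 1) \<prec> x" "x \<preceq> e b n"
  shows "rung x b = n"
proof -
  have "e b k \<prec> x" if "k < n" for k
    using leq_less_trans[OF ladder_leq[OF assms(1)] assms(3)] that by simp
  then have "{..<n} \<subseteq> {k. e b k \<prec> x}" by auto
  moreover have "x \<prec> b" using assms(1,4) leq_less_trans unfolding ladder_def by blast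
  ultimately have "card {..<n} \<le> card {k. e b k \<prec> x}"
    using finite_rungs[OF assms(1)] by (intro card_mono)
  then show ?thesis using rung_le[OF assms(1,4)] assms(1) by (simp add: rung_def)
qed

text \<open>
  Ranks measure how far up the ladder of a letter the smaller letters after it reach. Later letters
  are those of stops closer to the end of the walk, which many walks share.
\<close>

definition pos_rank :: "'a \<Rightarrow> 'a set \<Rightarrow> nat" where
  "pos_rank b X = Max (insert 0 ((\<lambda>x. rung x b) ` {x \<in> X. x \<prec> b}))"

fun rk :: "'a list \<Rightarrow> nat" where
  "rk [] = 0"
| "rk (b # v) = max (pos_rank b (set v)) (rk v)"

definition dominant :: "'a list \<Rightarrow> 'a" where
  "dominant w = (SOME b. \<exists>u v. w = u @ b # v \<and> pos_rank b (set v) = rk w)"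

lemma pos_rank_le_iff:
  "finite X \<Longrightarrow> pos_rank b X \<le> n \<longleftrightarrow> (\<forall>x\<in>X. x \<prec> b \<longrightarrow> rung x b \<le> n)"
  unfolding pos_rank_def by (subst Max_le_iff) auto

lemma pos_rank_less_iff:
  "finite X \<Longrightarrow> pos_rank b X < n \<longleftrightarrow> 0 < n \<and> (\<forall>x\<in>X. x \<prec> b \<longrightarrow> rung x b < n)"
  unfolding pos_rank_def by (subst Max_less_iff) auto

lemma pos_rank_le_rk: "pos_rank b (set v) \<le> rk (u @ b # v)"
  by (induction u) auto

text \<open>
  Only the positions of \<open>\<beta>\<close> in \<open>A\<close> can have rank \<open>n\<close>, and each of them does because it is
  followed by \<open>m\<close>.
\<close>

lemma dominant_letter:
  assumes A: "set A \<subseteq> Z" "\<beta> \<in> set A" and \<beta>: "\<beta> \<notin> set u" and n: "0 < n" "rk u < n"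
    and m: "m \<in> set u" "m \<prec> \<beta>" "rung m \<beta> = n"
    and le: "\<And>x. x \<in> Z \<union> set u \<Longrightarrow> x \<prec> \<beta> \<Longrightarrow> rung x \<beta> \<le> n"
    and lt: "\<And>b x. b \<in> Z \<Longrightarrow> b \<noteq> \<beta> \<Longrightarrow> x \<in> Z \<union> set u \<Longrightarrow> x \<prec> b \<Longrightarrow> rung x b < n"
  shows "rk (A @ u) = n \<and> dominant (A @ u) = \<beta>"
proof -
  have eq: "pos_rank \<beta> (set (B @ u)) = n" if "set B \<subseteq> Z" for B
  proof (rule antisym)
    show "pos_rank \<beta> (set (B @ u)) \<le> n"
      using le that by (subst pos_rank_le_iff) auto
    show "n \<le> pos_rank \<beta> (set (B @ u))"
      using pos_rank_le_iff[of "set (B @ u)" \<beta> "pos_rank \<beta> (set (B @ u))"] m by auto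
  qed
  have less: "pos_rank b (set (B @ u)) < n" if "set B \<subseteq> Z" "b \<in> Z" "b \<noteq> \<beta>" for B b
    using lt that n(1) by (subst pos_rank_less_iff) auto
  have rk: "if \<beta> \<in> set B then rk (B @ u) = n else rk (B @ u) < n" if "set B \<subseteq> Z" for B
    using that
  proof (induction B)
    case Nil
    then show ?case using n(2) by simp
  next
    case (Cons b B)
    then have IH: "if \<beta> \<in> set B then rk (B @ u) = n else rk (B @ u) < n" and B: "set B \<subseteq> Z" "b \<in> Z"
      by auto
    show ?case
      using IH eq[OF B(1)] less[OF B] by (cases "b = \<beta>") (auto split: if_splits)
  qed
  have rkA: "rk (A @ u) = n" using rk[OF A(1)] A(2) by simp
  obtain A1 A2 where A12: "A = A1 @ \<beta> # A2" using A(2) split_list by metis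
  have "A @ u = A1 @ \<beta> # (A2 @ u)" "pos_rank \<beta> (set (A2 @ u)) = rk (A @ u)"
    using A12 eq[of A2] A(1) rkA by auto
  then have ex: "\<exists>b u' v. A @ u = u' @ b # v \<and> pos_rank b (set v) = rk (A @ u)" by blast
  obtain d where d: "d = dominant (A @ u)" by simp
  obtain u' v where uv: "A @ u = u' @ d # v" "pos_rank d (set v) = n"
    using someI_ex[OF ex, folded dominant_def, folded d] rkA by auto
  have "d = \<beta>"
  proof (rule ccontr)
    assume ne: "d \<noteq> \<beta>"
    obtain us where "A = u' @ us \<and> us @ u = d # v \<or> A @ us = u' \<and> u = us @ d # v"
      using uv(1) unfolding append_eq_append_conv2 by blast
    then show False
    proof
      assume us: "A = u' @ us \<and> us @ u = d # v"
      show False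
      proof (cases us)
        case Nil
        then show False using us pos_rank_le_rk[of d v "[]"] uv(2) n(2) by simp
      next
        case (Cons c us')
        then have "v = us' @ u" "d \<in> Z" "set us' \<subseteq> Z" using us A(1) by auto
        then show False using less[of us' d] ne uv(2) by simp
      qed
    next
      assume "A @ us = u' \<and> u = us @ d # v"
      then show False using pos_rank_le_rk[of d v us] uv(2) n(2) by simp
    qed
  qed
  then show ?thesis using rkA d by simp
qed

text \<open>
  Two closure points are asked for in a gap, so that one letter and all those chosen along with it
  fit in between.
\<close>

definition gaps :: "'a \<Rightarrow> ('a \<Rightarrow> 'a) \<Rightarrow> nat set" where
  "gaps \<beta> b = {n. 1 \<le> n \<and> (\<exists>x\<in>cl b. \<exists>y\<in>cl b. e \<beta> (n - 1) \<preceq> x \<and> x \<prec> y \<and> y \<preceq> e \<beta> n)}"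

text \<open>
  The index of a gap will become the rank of a word; so \<open>J\<close> consists of the values under \<open>F\<close> that
  can be prescribed for such a rank.
\<close>

definition guess :: "(nat \<Rightarrow> nat) \<Rightarrow> nat set \<Rightarrow> 'a \<Rightarrow> ('a \<Rightarrow> 'a) \<Rightarrow> bool" where
  "guess F J \<beta> b \<longleftrightarrow> \<beta> \<in> cl b \<and> lad \<beta> \<and> (\<forall>j\<in>J. infinite {n \<in> gaps \<beta> b. F n = j})"

text \<open>Only finitely many gaps of the ladder lie below a given \<open>v \<prec> \<beta>\<close>.\<close>

lemma admissible_guess: "admissible (guess F J)"
  unfolding admissible_def
proof (intro conjI allI impI)
  fix \<beta> b assume "guess F J \<beta> b"
  then show "\<beta> \<in> cl b" unfolding guess_def by blast
next
  fix \<beta> b b' v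
  assume g: "guess F J \<beta> b" and v: "v \<prec> \<beta>" and w: "\<forall>z u. v \<preceq> z \<longrightarrow> u \<preceq> z \<longrightarrow> b' u \<preceq> b z"
  have cl: "x \<in> cl b'" if "x \<in> cl b" "v \<prec> x" for x
    by (rule cl_weaken[OF that]) (use w in simp)
  have \<beta>: "\<beta> \<in> cl b" "lad \<beta>" using g unfolding guess_def by blast+
  obtain k where k: "v \<prec> e \<beta> k" using \<beta>(2) v unfolding ladder_def by blast
  have sub: "gaps \<beta> b - {..k} \<subseteq> gaps \<beta> b'"
  proof
    fix n assume n: "n \<in> gaps \<beta> b - {..k}"
    then obtain x y where xy: "x \<in> cl b" "y \<in> cl b" "e \<beta> (n - 1) \<preceq> x" "x \<prec> y" "y \<preceq> e \<beta> n" "1 \<le> n"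
      unfolding gaps_def by blast
    have "k \<le> n - 1" using n by auto
    then have "e \<beta> k \<preceq> e \<beta> (n - 1)" by (rule ladder_leq[OF \<beta>(2)])
    then have "v \<prec> x" using k xy(3) less_leq_trans by blast
    moreover have "v \<prec> y" using calculation xy(4) by (rule less_trans)
    ultimately show "n \<in> gaps \<beta> b'" unfolding gaps_def using xy cl by blast
  qed
  have "infinite {n \<in> gaps \<beta> b'. F n = j}" if j: "j \<in> J" for j
  proof
    assume "finite {n \<in> gaps \<beta> b'. F n = j}"
    then have "finite ({n \<in> gaps \<beta> b'. F n = j} \<union> {..k})" by simp
    moreover have "{n \<in> gaps \<beta> b. F n = j} \<subseteq> {n \<in> gaps \<beta> b'. F n = j} \<union> {..k}" using sub by blast
    ultimately have "finite {n \<in> gaps \<beta> b. F n = j}" using finite_subset by blast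
    then show False using g j unfolding guess_def by blast
  qed
  then show "guess F J \<beta> b'" unfolding guess_def using cl[OF \<beta>(1) v] \<beta>(2) by blast
qed

text \<open>
  The words \<open>word \<eta>\<close> belong to points \<open>\<eta>\<close> that converge to \<open>\<delta>\<close> in another well-order, and every
  letter \<open>\<alpha>\<close> occurs in words arbitrarily close to \<open>\<delta>\<close>. For positively many \<open>\<beta>'\<close>, Fodor's lemma makes
  the letters below \<open>\<beta>'\<close> of a word that contains \<open>\<alpha>\<close> a fixed finite set \<open>R \<alpha>\<close>, and for positively
  many \<open>\<alpha>\<close> the part of \<open>R \<alpha>\<close> below \<open>\<alpha>\<close> a fixed finite set. By guessing, \<open>\<alpha>\<close> and the rest of
  \<open>R \<alpha>\<close> then fit into one gap of the ladder of some \<open>\<beta>\<close>, so high up that nothing in \<open>Z \<beta>\<close>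
  competes; and with \<open>\<beta>'\<close> above \<open>Z \<beta>\<close>, the other letters of the word are too large to matter.
\<close>

lemma dominating_word:
  fixes \<kappa> :: "'b rel"
  assumes wo: "wellorder_rel \<kappa>"
    and pos: "pos (guess F J) \<Theta>" "\<Theta> \<subseteq> K"
    and tails: "\<And>\<alpha> z. \<alpha> \<in> K \<Longrightarrow> z \<prec>\<^bsub>\<kappa>\<^esub> \<delta> \<Longrightarrow> \<exists>\<eta>\<in>T. z \<prec>\<^bsub>\<kappa>\<^esub> \<eta> \<and> \<eta> \<prec>\<^bsub>\<kappa>\<^esub> \<delta> \<and> \<alpha> \<in> set (word \<eta>)"
    and word: "\<And>\<eta>. \<eta> \<in> T \<Longrightarrow> set (word \<eta>) \<subseteq> K"
    and g: "\<And>\<beta>. \<beta> \<in> \<Theta> \<Longrightarrow> g \<beta> \<prec>\<^bsub>\<kappa>\<^esub> \<delta>"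
    and Z: "\<And>\<beta>. \<beta> \<in> \<Theta> \<Longrightarrow> finite (Z \<beta>) \<and> Z \<beta> \<subseteq> K"
    and j: "\<And>\<beta>. \<beta> \<in> \<Theta> \<Longrightarrow> j \<beta> \<in> J"
  shows "\<exists>\<beta>\<in>\<Theta>. \<exists>\<eta>\<in>T. \<exists>n. g \<beta> \<prec>\<^bsub>\<kappa>\<^esub> \<eta> \<and> \<eta> \<prec>\<^bsub>\<kappa>\<^esub> \<delta> \<and> \<beta> \<notin> set (word \<eta>) \<and> F n = j \<beta> \<and>
    (\<forall>A. \<beta> \<in> set A \<and> set A \<subseteq> Z \<beta> \<longrightarrow> rk (A @ word \<eta>) = n \<and> dominant (A @ word \<eta>) = \<beta>)"
proof -
  interpret W: wellorder_rel \<kappa> by (rule wo)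
  note adm = admissible_guess[of F J]
  \<comment> \<open>Enough points \<open>\<beta>'\<close> have a \<open>\<mu> \<beta>'\<close> beyond a given \<open>g \<beta>\<close>: either positively many of the \<open>g \<beta>\<close>
     are bounded by some \<open>\<zeta>\<close>, which then serves as \<open>\<mu> \<beta>'\<close>, or \<open>\<mu> = g\<close> works.\<close>
  have "\<exists>B \<mu>. B \<subseteq> \<Theta> \<and> pos (guess F J) B \<and> (\<forall>\<beta>\<in>B. \<mu> \<beta> \<prec>\<^bsub>\<kappa>\<^esub> \<delta>) \<and>
     (\<forall>\<beta>\<in>B. \<forall>G b. G \<subseteq> B \<longrightarrow> pos (guess F J) G \<longrightarrow> b \<in> K \<longrightarrow>
        (\<exists>\<beta>'\<in>G. b \<prec> \<beta>' \<and> (g \<beta>, \<mu> \<beta>') \<in> \<kappa>))"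
  proof (cases "\<exists>\<zeta>. \<zeta> \<prec>\<^bsub>\<kappa>\<^esub> \<delta> \<and> pos (guess F J) {\<beta> \<in> \<Theta>. (g \<beta>, \<zeta>) \<in> \<kappa>}")
    case True
    then obtain \<zeta> where \<zeta>: "\<zeta> \<prec>\<^bsub>\<kappa>\<^esub> \<delta>" "pos (guess F J) {\<beta> \<in> \<Theta>. (g \<beta>, \<zeta>) \<in> \<kappa>}" by blast
    have "\<exists>\<beta>'\<in>G. b \<prec> \<beta>'" if "pos (guess F J) G" "b \<in> K" for G b
      using pos_nonempty[OF pos_above[OF adm that]] by auto
    then show ?thesis
      using \<zeta> by (intro exI[of _ "{\<beta> \<in> \<Theta>. (g \<beta>, \<zeta>) \<in> \<kappa>}"] exI[of _ "\<lambda>_. \<zeta>"]) simp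
  next
    case False
    have "\<exists>\<beta>'\<in>G. b \<prec> \<beta>' \<and> (g \<beta>, g \<beta>') \<in> \<kappa>"
      if G: "\<beta> \<in> \<Theta>" "G \<subseteq> \<Theta>" "pos (guess F J) G" "b \<in> K" for \<beta> G b
    proof (rule ccontr)
      assume neg: "\<not> ?thesis"
      have "(g \<beta>', g \<beta>) \<in> \<kappa>" if "\<beta>' \<in> G" "b \<prec> \<beta>'" for \<beta>'
      proof -
        have "g \<beta> \<in> W.K" "g \<beta>' \<in> W.K" using W.less_in(1)[OF g] G that by blast+
        then have "g \<beta>' \<prec>\<^bsub>\<kappa>\<^esub> g \<beta>" using W.not_less[of "g \<beta>'" "g \<beta>"] neg that by blast
        then show ?thesis by (rule W.less_imp_leq)
      qed
      then have sub: "{d \<in> G. b \<prec> d} \<subseteq> {\<beta>' \<in> \<Theta>. (g \<beta>', g \<beta>) \<in> \<kappa>}" using G(2) by blast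
      have "pos (guess F J) {\<beta>' \<in> \<Theta>. (g \<beta>', g \<beta>) \<in> \<kappa>}"
        by (rule pos_mono[OF pos_above[OF adm G(3,4)] sub])
      then show False using False g[OF G(1)] by blast
    qed
    then show ?thesis using pos g by (intro exI[of _ \<Theta>] exI[of _ g]) simp
  qed
  then obtain B \<mu> where B: "B \<subseteq> \<Theta>" "pos (guess F J) B"
    and \<mu>': "\<forall>\<beta>\<in>B. \<mu> \<beta> \<prec>\<^bsub>\<kappa>\<^esub> \<delta>"
    and star': "\<forall>\<beta>\<in>B. \<forall>G b. G \<subseteq> B \<longrightarrow> pos (guess F J) G \<longrightarrow> b \<in> K \<longrightarrow>
        (\<exists>\<beta>'\<in>G. b \<prec> \<beta>' \<and> (g \<beta>, \<mu> \<beta>') \<in> \<kappa>)"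
    by (elim exE conjE) (rule that)
  have \<mu>: "\<mu> \<beta> \<prec>\<^bsub>\<kappa>\<^esub> \<delta>" if "\<beta> \<in> B" for \<beta> using \<mu>' that by simp
  have star: "\<exists>\<beta>'\<in>G. b \<prec> \<beta>' \<and> (g \<beta>, \<mu> \<beta>') \<in> \<kappa>"
    if "\<beta> \<in> B" "G \<subseteq> B" "pos (guess F J) G" "b \<in> K" for \<beta> G b
    using star' that by simp
  have "\<forall>\<alpha> \<beta>'. \<exists>\<eta>. \<alpha> \<in> K \<longrightarrow> \<beta>' \<in> B \<longrightarrow> \<eta> \<in> T \<and> \<mu> \<beta>' \<prec>\<^bsub>\<kappa>\<^esub> \<eta> \<and> \<eta> \<prec>\<^bsub>\<kappa>\<^esub> \<delta> \<and> \<alpha> \<in> set (word \<eta>)"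
    using tails \<mu> by blast
  then obtain \<eta> where \<eta>: "\<And>\<alpha> \<beta>'. \<alpha> \<in> K \<Longrightarrow> \<beta>' \<in> B \<Longrightarrow>
      \<eta> \<alpha> \<beta>' \<in> T \<and> \<mu> \<beta>' \<prec>\<^bsub>\<kappa>\<^esub> \<eta> \<alpha> \<beta>' \<and> \<eta> \<alpha> \<beta>' \<prec>\<^bsub>\<kappa>\<^esub> \<delta> \<and> \<alpha> \<in> set (word (\<eta> \<alpha> \<beta>'))"
    by metis
  define Q where "Q \<alpha> R N G \<longleftrightarrow> finite R \<and> R \<subseteq> K \<and> \<alpha> \<in> R \<and> G \<subseteq> B \<and> pos (guess F J) G \<and>
      (\<forall>\<beta>'\<in>G. {x \<in> set (word (\<eta> \<alpha> \<beta>')). x \<prec> \<beta>'} = R \<and> rk (word (\<eta> \<alpha> \<beta>')) = N)"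
    for \<alpha> R N G
  have "\<exists>R N G. Q \<alpha> R N G" if \<alpha>: "\<alpha> \<in> K" for \<alpha>
  proof -
    define X where "X \<beta>' = {x \<in> set (word (\<eta> \<alpha> \<beta>')). x \<prec> \<beta>'}" for \<beta>'
    have "\<exists>R. finite R \<and> pos (guess F J) {\<beta>' \<in> B. X \<beta>' = R}"
      by (rule fodor_finite_sets[OF adm B(2)]) (auto simp: X_def)
    then obtain R where R: "finite R" "pos (guess F J) {\<beta>' \<in> B. X \<beta>' = R}" by blast
    obtain \<beta>' where "\<beta>' \<in> B" "X \<beta>' = R" "\<alpha> \<prec> \<beta>'"
      using pos_nonempty[OF pos_above[OF adm R(2) \<alpha>]] by blast
    then have "\<alpha> \<in> R" "R \<subseteq> K" using \<eta>[OF \<alpha>, of \<beta>'] less_in unfolding X_def by blast+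
    moreover obtain N where
      "pos (guess F J) {\<beta>' \<in> {\<beta>' \<in> B. X \<beta>' = R}. rk (word (\<eta> \<alpha> \<beta>')) = N}"
      using pos_complete[OF adm R(2) small_nat, of "\<lambda>\<beta>'. rk (word (\<eta> \<alpha> \<beta>'))"] by blast
    ultimately show ?thesis
      using R(1)
      by (intro exI[of _ R] exI[of _ N] exI[of _ "{\<beta>' \<in> {\<beta>' \<in> B. X \<beta>' = R}. rk (word (\<eta> \<alpha> \<beta>')) = N}"])
         (simp add: Q_def X_def)
  qed
  then obtain R N G where Q: "\<And>\<alpha>. \<alpha> \<in> K \<Longrightarrow> Q \<alpha> (R \<alpha>) (N \<alpha>) (G \<alpha>)" by metis
  have R: "\<And>\<alpha>. \<alpha> \<in> K \<Longrightarrow> finite (R \<alpha>)" "\<And>\<alpha>. \<alpha> \<in> K \<Longrightarrow> R \<alpha> \<subseteq> K"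
      "\<And>\<alpha>. \<alpha> \<in> K \<Longrightarrow> \<alpha> \<in> R \<alpha>"
    and G: "\<And>\<alpha>. \<alpha> \<in> K \<Longrightarrow> G \<alpha> \<subseteq> B" "\<And>\<alpha>. \<alpha> \<in> K \<Longrightarrow> pos (guess F J) (G \<alpha>)"
      "\<And>\<alpha> \<beta>'. \<alpha> \<in> K \<Longrightarrow> \<beta>' \<in> G \<alpha> \<Longrightarrow> {x \<in> set (word (\<eta> \<alpha> \<beta>')). x \<prec> \<beta>'} = R \<alpha>"
      "\<And>\<alpha> \<beta>'. \<alpha> \<in> K \<Longrightarrow> \<beta>' \<in> G \<alpha> \<Longrightarrow> rk (word (\<eta> \<alpha> \<beta>')) = N \<alpha>"
    using Q[unfolded Q_def] by simp_all
  have "\<exists>R0. finite R0 \<and> pos (guess F J) {\<alpha> \<in> \<Theta>. {x \<in> R \<alpha>. x \<prec> \<alpha>} = R0}"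
    by (rule fodor_finite_sets[OF adm pos(1)]) (use R(1) pos(2) in auto)
  then obtain R0 where R0: "finite R0" "pos (guess F J) {\<alpha> \<in> \<Theta>. {x \<in> R \<alpha>. x \<prec> \<alpha>} = R0}" by blast
  obtain n0 where n0: "pos (guess F J) {\<alpha> \<in> {\<alpha> \<in> \<Theta>. {x \<in> R \<alpha>. x \<prec> \<alpha>} = R0}. N \<alpha> = n0}"
    using pos_complete[OF adm R0(2) small_nat, of N] by blast
  define A' where "A' = {\<alpha> \<in> {\<alpha> \<in> \<Theta>. {x \<in> R \<alpha>. x \<prec> \<alpha>} = R0}. N \<alpha> = n0}"
  have A': "\<alpha> \<in> K" "{x \<in> R \<alpha>. x \<prec> \<alpha>} = R0" "N \<alpha> = n0" if "\<alpha> \<in> A'" for \<alpha>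
    using that pos(2) unfolding A'_def by blast+
  have unb: "\<exists>\<alpha>\<in>A'. z \<prec> \<alpha>" if "z \<in> K" for z
    using pos_nonempty[OF pos_above[OF adm n0 that]] unfolding A'_def by blast
  then obtain nA where nA: "\<And>z. z \<in> K \<Longrightarrow> nA z \<in> A' \<and> z \<prec> nA z" by metis
  have "\<exists>b\<in>K. \<forall>x\<in>R \<alpha>. x \<prec> b" if "\<alpha> \<in> K" for \<alpha>
    using bounded_family[of "R \<alpha>" "\<lambda>x. x"] small_countable[OF countable_finite] R(1,2) that by blast
  then obtain f where f: "\<And>\<alpha>. \<alpha> \<in> K \<Longrightarrow> f \<alpha> \<in> K" "\<And>\<alpha> x. \<alpha> \<in> K \<Longrightarrow> x \<in> R \<alpha> \<Longrightarrow> x \<prec> f \<alpha>" by metis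
  have "\<exists>b. (\<forall>z\<in>K. b z \<in> K) \<and> (\<forall>i\<in>UNIV. \<forall>z u. u \<preceq> z \<longrightarrow> (if i then f u else nA u) \<prec> b z)"
    by (rule dominate) (use f(1) nA A'(1) small_countable[of "UNIV :: bool set"] in auto)
  then obtain b where b: "\<forall>z\<in>K. b z \<in> K"
      "\<forall>i\<in>UNIV. \<forall>z u. u \<preceq> z \<longrightarrow> (if i then f u else nA u) \<prec> b z"
    by (elim exE conjE) (rule that)
  have bf: "f z \<prec> b z" "nA z \<prec> b z" if "z \<in> K" for z
    using b(2)[rule_format, of True z z] b(2)[rule_format, of False z z] leq_refl[OF that] by auto
  obtain \<beta> where \<beta>: "\<beta> \<in> B" "guess F J \<beta> b" using B(2) b(1) unfolding pos_def by blast
  have \<beta>\<Theta>: "\<beta> \<in> \<Theta>" "\<beta> \<in> K" using \<beta>(1) B(1) pos(2) by blast+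
  have lad: "lad \<beta>" and inf: "infinite {n \<in> gaps \<beta> b. F n = j \<beta>}"
    using \<beta>(2) j[OF \<beta>\<Theta>(1)] unfolding guess_def by blast+
  have fin: "finite (Z \<beta>)" "Z \<beta> \<subseteq> K" using Z[OF \<beta>\<Theta>(1)] by blast+
  define E where "E = insert n0 ((\<lambda>(z, b). rung z b) ` ((Z \<beta> \<union> R0 \<union> {\<beta>}) \<times> (Z \<beta> \<union> {\<beta>})))"
  have "finite E" unfolding E_def using fin(1) R0(1) by simp
  then have "infinite ({n \<in> gaps \<beta> b. F n = j \<beta>} - {..Max E})" using inf by simp
  then obtain n where "n \<in> {n \<in> gaps \<beta> b. F n = j \<beta>} - {..Max E}"
    by (metis ex_in_conv finite.emptyI)
  then have n: "n \<in> gaps \<beta> b" "F n = j \<beta>" "n > Max E" by auto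
  have En: "i < n" if "i \<in> E" for i using Max_ge[OF \<open>finite E\<close> that] n(3) by simp
  have n0n: "n0 < n" and rn: "\<And>z b. z \<in> Z \<beta> \<union> R0 \<union> {\<beta>} \<Longrightarrow> b \<in> Z \<beta> \<union> {\<beta>} \<Longrightarrow> rung z b < n"
    using En unfolding E_def by auto
  obtain x y where xy: "x \<in> cl b" "y \<in> cl b" "e \<beta> (n - 1) \<preceq> x" "x \<prec> y" "y \<preceq> e \<beta> n" "1 \<le> n"
    using n(1) unfolding gaps_def by blast
  define \<alpha> where "\<alpha> = nA x"
  have \<alpha>: "\<alpha> \<in> A'" "x \<prec> \<alpha>" using nA cl_in[OF xy(1)] unfolding \<alpha>_def by blast+
  have "\<alpha> \<prec> y" using bf(2)[OF cl_in[OF xy(1)]] clD[OF xy(2,4)] less_trans unfolding \<alpha>_def by blast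
  then have f\<alpha>: "f \<alpha> \<prec> y" using bf(1)[of \<alpha>] clD[OF xy(2)] A'(1)[OF \<alpha>(1)] less_trans by blast
  note \<alpha>K = A'(1)[OF \<alpha>(1)]
  have ey: "e \<beta> n \<prec> \<beta>" using lad unfolding ladder_def by blast
  then have y\<beta>: "y \<prec> \<beta>" using xy(5) leq_less_trans by blast
  have \<alpha>\<beta>: "\<alpha> \<prec> \<beta>" using \<open>\<alpha> \<prec> y\<close> y\<beta> by (rule less_trans)
  have r\<alpha>: "rung \<alpha> \<beta> = n"
    by (rule rung_eq[OF lad xy(6)])
       (use xy(3,5) \<alpha>(2) \<open>\<alpha> \<prec> y\<close> leq_less_trans less_leq_trans less_imp_leq in blast)+
  have R_y: "z \<prec> y" if "z \<in> R \<alpha>" for z using f(2)[OF \<alpha>K that] f\<alpha> less_trans by blast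
  have Z_\<alpha>: "z \<prec> \<alpha>" if z: "z \<in> Z \<beta>" "z \<prec> \<beta>" for z
  proof (rule ccontr)
    assume "\<not> z \<prec> \<alpha>"
    then have "\<alpha> \<preceq> z" using not_less less_in(1)[OF z(2)] \<alpha>K by blast
    then have "n \<le> rung z \<beta>" using rung_mono[OF _ z(2), of \<alpha>] r\<alpha> by simp
    moreover have "rung z \<beta> < n" using rn[of z \<beta>] z(1) by blast
    ultimately show False by simp
  qed
  obtain b0 where b0: "b0 \<in> K" "\<forall>z\<in>insert \<beta> (Z \<beta>). z \<prec> b0"
    using bounded_family[of "insert \<beta> (Z \<beta>)" "\<lambda>x. x"] small_countable[OF countable_finite, of "insert \<beta> (Z \<beta>)"]
      fin \<beta>\<Theta>(2) by blast
  obtain \<beta>' where \<beta>': "\<beta>' \<in> G \<alpha>" "b0 \<prec> \<beta>'" "(g \<beta>, \<mu> \<beta>') \<in> \<kappa>"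
    using star[OF \<beta>(1) G(1,2)[OF \<alpha>K] b0(1)] by blast
  define h where "h = \<eta> \<alpha> \<beta>'"
  have h: "h \<in> T" "\<mu> \<beta>' \<prec>\<^bsub>\<kappa>\<^esub> h" "h \<prec>\<^bsub>\<kappa>\<^esub> \<delta>" "\<alpha> \<in> set (word h)"
    using \<eta>[OF \<alpha>K, of \<beta>'] G(1)[OF \<alpha>K] \<beta>'(1) unfolding h_def by blast+
  have X: "{x \<in> set (word h). x \<prec> \<beta>'} = R \<alpha>" "rk (word h) = n0"
    using G(3,4)[OF \<alpha>K \<beta>'(1)] A'(3)[OF \<alpha>(1)] unfolding h_def by auto
  have Z': "z \<prec> \<beta>'" if "z \<in> insert \<beta> (Z \<beta>)" for z using b0(2) \<beta>'(2) that less_trans by blast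
  have XR: "z \<in> R \<alpha>" if "z \<in> set (word h)" "z \<prec> c" "c \<in> insert \<beta> (Z \<beta>)" for z c
    using X(1) that less_trans[OF that(2) Z'] by blast
  have \<beta>X: "\<beta> \<notin> set (word h)"
  proof
    assume "\<beta> \<in> set (word h)"
    then have "\<beta> \<in> R \<alpha>" using X(1) Z'[of \<beta>] by blast
    then show False using R_y y\<beta> less_asym by blast
  qed
  have le: "rung z \<beta> \<le> n" if z: "z \<in> Z \<beta> \<union> set (word h)" "z \<prec> \<beta>" for z
  proof (cases "z \<in> Z \<beta>")
    case True
    then show ?thesis using rn[of z \<beta>] by simp
  next
    case False
    then have "z \<in> R \<alpha>" using XR[OF _ z(2)] z(1) by blast
    then show ?thesis using rung_le[OF lad, of z n] R_y xy(5) less_leq_trans less_imp_leq by blast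
  qed
  have ltn: "rung z c < n" if c: "c \<in> Z \<beta>" "c \<noteq> \<beta>" and z: "z \<in> Z \<beta> \<union> set (word h)" "z \<prec> c" for z c
  proof (cases "z \<in> Z \<beta> \<union> R0")
    case True
    then show ?thesis using rn[of z c] c(1) by blast
  next
    case False
    then have zR: "z \<in> R \<alpha>" using XR[OF _ z(2)] z(1) c(1) by blast
    have "\<not> z \<prec> \<alpha>" using zR False A'(2)[OF \<alpha>(1)] by blast
    then have "\<not> c \<prec> \<alpha>" using z(2) less_trans by blast
    then have "\<not> c \<prec> \<beta>" using Z_\<alpha> c(1) by blast
    then have "\<beta> \<prec> c" using linear[of c \<beta>] c fin(2) \<beta>\<Theta>(2) by blast
    moreover have "z \<preceq> \<beta>" using R_y[OF zR] y\<beta> less_trans less_imp_leq by blast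
    ultimately have "rung z c \<le> rung \<beta> c" using rung_mono by blast
    also have "\<dots> < n" using rn[of \<beta> c] c(1) by blast
    finally show ?thesis .
  qed
  have dominant: "rk (A @ word h) = n \<and> dominant (A @ word h) = \<beta>" if "\<beta> \<in> set A" "set A \<subseteq> Z \<beta>" for A
    by (rule dominant_letter[OF that(2,1) \<beta>X _ _ h(4) \<alpha>\<beta> r\<alpha> le ltn])
       (use xy(6) X(2) n0n in auto)
  have "g \<beta> \<prec>\<^bsub>\<kappa>\<^esub> h" using W.leq_less_trans[OF \<beta>'(3) h(2)] .
  then show ?thesis
    using \<beta>\<Theta>(1) h(1,3) \<beta>X n(2) dominant by (intro bexI[of _ \<beta>] bexI[of _ h] exI[of _ n]) auto
qed

end

section \<open>Words along walks\<close>

context regular_rel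
begin

definition accumulates :: "'a set \<Rightarrow> 'a \<Rightarrow> bool" where
  "accumulates A d \<longleftrightarrow> (\<forall>z. z \<prec> d \<longrightarrow> (\<exists>x\<in>A. z \<prec> x \<and> x \<prec> d))"

lemma pos_accumulates:
  assumes adm: "admissible \<Phi>" and X: "pos \<Phi> X" and A: "unbdd A"
  shows "pos \<Phi> {d \<in> X. accumulates A d}"
proof -
  obtain c where c: "\<And>z. z \<in> K \<Longrightarrow> c z \<in> A \<and> z \<prec> c z" using A unfolding unbdd_def by metis
  have "pos \<Phi> {d \<in> X. d \<in> cl c}" by (rule pos_cl[OF adm X]) (use c less_in in blast)
  then show ?thesis
  proof (rule pos_mono)
    have "accumulates A d" if "d \<in> cl c" for d
      unfolding accumulates_def using c clD[OF that] less_in by blast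
    then show "{d \<in> X. d \<in> cl c} \<subseteq> {d \<in> X. accumulates A d}" by blast
  qed
qed

lemma pos_accumulates_family:
  assumes adm: "admissible \<Phi>" and X: "pos \<Phi> X" and I: "small I" and A: "\<And>i. i \<in> I \<Longrightarrow> unbdd (A i)"
  shows "pos \<Phi> {d \<in> X. \<forall>i\<in>I. accumulates (A i) d}"
proof -
  have "\<forall>i z. \<exists>x. i \<in> I \<longrightarrow> z \<in> K \<longrightarrow> x \<in> A i \<and> z \<prec> x" using A unfolding unbdd_def by blast
  then obtain c where c: "\<And>i z. i \<in> I \<Longrightarrow> z \<in> K \<Longrightarrow> c i z \<in> A i \<and> z \<prec> c i z" by metis
  have cK: "c i z \<in> K" if "i \<in> I" "z \<in> K" for i z using c[OF that] less_in by blast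
  have "\<exists>b. (\<forall>z\<in>K. b z \<in> K) \<and> (\<forall>i\<in>I. \<forall>z u. u \<preceq> z \<longrightarrow> c i u \<prec> b z)"
    by (rule dominate[OF I cK])
  then obtain b where b: "\<forall>z\<in>K. b z \<in> K" "\<forall>i\<in>I. \<forall>z u. u \<preceq> z \<longrightarrow> c i u \<prec> b z"
    by (elim exE conjE) (rule that)
  have "pos \<Phi> {d \<in> X. d \<in> cl b}" by (rule pos_cl[OF adm X]) (use b(1) in simp)
  then show ?thesis
  proof (rule pos_mono)
    have "\<forall>i\<in>I. accumulates (A i) d" if d: "d \<in> cl b" for d
      unfolding accumulates_def
    proof (intro ballI allI impI)
      fix i z assume i: "i \<in> I" and z: "z \<prec> d"
      have zK: "z \<in> K" using z less_in by blast
      have "c i z \<prec> b z" using b(2) i leq_refl[OF zK] by simp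
      then have "c i z \<prec> d" using clD[OF d z] by (rule less_trans)
      then show "\<exists>x\<in>A i. z \<prec> x \<and> x \<prec> d" using c[OF i zK] by blast
    qed
    then show "{d \<in> X. d \<in> cl b} \<subseteq> {d \<in> X. \<forall>i\<in>I. accumulates (A i) d}" by blast
  qed
qed

text \<open>
  Think of \<open>V \<eta> p\<close> as \<open>\<eta>\<close> being attached to \<open>p\<close>. The points of \<open>H y\<close> are those on which a
  neighbourhood of \<open>y\<close> depends; towards the ones above \<open>y\<close>, the point \<open>\<eta>\<close> has to behave like \<open>y\<close>,
  while \<open>g\<close> takes care of the ones below.
\<close>

definition captures :: "'a set \<Rightarrow> ('a \<Rightarrow> 'b) \<Rightarrow> 'b set \<Rightarrow> ('a \<Rightarrow> 'a \<Rightarrow> bool) \<Rightarrow> ('a \<Rightarrow> 'a \<Rightarrow> bool) \<Rightarrow> bool" where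
  "captures S h \<Theta> L V \<longleftrightarrow> (\<forall>T Y H g. unbdd T \<longrightarrow> Y \<subseteq> S \<longrightarrow> (\<forall>\<beta>\<in>\<Theta>. stat {y \<in> Y. h y = \<beta>}) \<longrightarrow>
     (\<forall>y\<in>Y. finite (H y) \<and> g y \<prec> y) \<longrightarrow>
     (\<exists>y\<in>Y. \<exists>\<eta>\<in>T. g y \<prec> \<eta> \<and> \<eta> \<prec> y \<and> V \<eta> y \<and>
        (\<forall>p\<in>H y. y \<prec> p \<longrightarrow> (V \<eta> p \<longleftrightarrow> L p y \<and> V y p))))"

end

locale word_walk = walk r S step + T: ladder_system \<theta> e
  for r :: "'a rel" and S step and \<theta> :: "'b rel" and e +
  fixes h :: "'a \<Rightarrow> 'b"
  assumes small_letters: "small (Field \<theta>)"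
    and h_in: "h d \<in> Field \<theta>"
    and h_stat: "\<alpha> \<in> Field \<theta> \<Longrightarrow> stat {d \<in> S. h d = \<alpha>}"
begin

abbreviation word :: "'a \<Rightarrow> 'a \<Rightarrow> 'b list" where "word p \<eta> \<equiv> map h (path p \<eta>)"
abbreviation letter :: "'a \<Rightarrow> 'a \<Rightarrow> 'b" where "letter p \<eta> \<equiv> T.dominant (word p \<eta>)"

text \<open>
  Among the stops with the dominant letter, the rank of the word selects one by means of \<open>F\<close>. They
  are counted from the low end because the walks from different points down to \<open>\<eta>\<close> differ at the
  high end.
\<close>

definition selected :: "(nat \<Rightarrow> nat) \<Rightarrow> 'a \<Rightarrow> 'a \<Rightarrow> 'a" where
  "selected F p \<eta> = rev (filter (\<lambda>q. h q = letter p \<eta>) (path p \<eta>)) ! F (T.rk (word p \<eta>))"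

lemma path_near_finite:
  assumes y: "y \<in> S" and H: "finite H" "\<And>p. p \<in> H \<Longrightarrow> y \<prec> p" and g: "g \<prec> y"
  shows "\<exists>l. l \<prec> y \<and> g \<preceq> l \<and> (\<forall>p\<in>H. \<forall>\<eta>. l \<prec> \<eta> \<longrightarrow> \<eta> \<prec> y \<longrightarrow> path p \<eta> = path p y @ path y \<eta>)"
proof -
  have "\<forall>p\<in>H. \<exists>l. l \<prec> y \<and> (\<forall>\<eta>. l \<prec> \<eta> \<longrightarrow> \<eta> \<prec> y \<longrightarrow> path p \<eta> = path p y @ path y \<eta>)"
    using path_near[OF y H(2)] by simp
  then have "\<exists>l. \<forall>p\<in>H. l p \<prec> y \<and> (\<forall>\<eta>. l p \<prec> \<eta> \<longrightarrow> \<eta> \<prec> y \<longrightarrow> path p \<eta> = path p y @ path y \<eta>)"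
    by (rule bchoice)
  then obtain l where l: "\<forall>p\<in>H. l p \<prec> y \<and> (\<forall>\<eta>. l p \<prec> \<eta> \<longrightarrow> \<eta> \<prec> y \<longrightarrow> path p \<eta> = path p y @ path y \<eta>)" ..
  obtain m where m: "m \<prec> y" "\<forall>a\<in>l ` H. a \<preceq> m" "g \<preceq> m"
    using finite_bound[of "l ` H" y g] H(1) l g by auto
  have "path p \<eta> = path p y @ path y \<eta>" if "p \<in> H" "m \<prec> \<eta>" "\<eta> \<prec> y" for p \<eta>
    using l that m(2) leq_less_trans[of "l p" m \<eta>] by simp
  then show ?thesis using m(1,3) by blast
qed

text \<open>
  The candidates \<open>y \<beta>\<close> are chosen above a common gate \<open>\<delta>\<close>. Near the gate every walk from one of
  them ends with the walk from the gate, so that only the words of the latter vary.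
\<close>

lemma dominating_walk:
  assumes T: "unbdd T" and pos: "T.pos (T.guess F J) \<Theta>" "\<Theta> \<subseteq> Field \<theta>" and J: "J \<noteq> {}"
    and Y: "\<And>\<beta>. \<beta> \<in> \<Theta> \<Longrightarrow> stat (Y \<beta>)" "\<And>\<beta> y. \<beta> \<in> \<Theta> \<Longrightarrow> y \<in> Y \<beta> \<Longrightarrow> y \<in> S \<and> h y = \<beta>"
    and H: "\<And>\<beta> y. \<beta> \<in> \<Theta> \<Longrightarrow> y \<in> Y \<beta> \<Longrightarrow> finite (H y)"
      "\<And>\<beta> y p. \<beta> \<in> \<Theta> \<Longrightarrow> y \<in> Y \<beta> \<Longrightarrow> p \<in> H y \<Longrightarrow> y \<prec> p"
    and g: "\<And>\<beta> y. \<beta> \<in> \<Theta> \<Longrightarrow> y \<in> Y \<beta> \<Longrightarrow> g y \<prec> y"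
  shows "\<exists>\<beta>\<in>\<Theta>. \<exists>y\<in>Y \<beta>. \<exists>\<eta>\<in>T. g y \<prec> \<eta> \<and> \<eta> \<prec> y \<and>
    (\<forall>p\<in>insert y (H y). letter p \<eta> = \<beta> \<and> (J = UNIV \<longrightarrow> selected F p \<eta> = y))"
proof -
  define near where "near y l \<longleftrightarrow> l \<prec> y \<and> g y \<preceq> l \<and>
      (\<forall>p\<in>H y. \<forall>\<eta>. l \<prec> \<eta> \<longrightarrow> \<eta> \<prec> y \<longrightarrow> path p \<eta> = path p y @ path y \<eta>)" for y l
  have "\<exists>l. near y l" if "\<beta> \<in> \<Theta>" "y \<in> Y \<beta>" for \<beta> y
    unfolding near_def
    by (rule path_near_finite) (use Y(2) H g that in auto)
  moreover define l where "l y = (SOME l. near y l)" for y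
  ultimately have l: "near y (l y)" if "\<beta> \<in> \<Theta>" "y \<in> Y \<beta>" for \<beta> y using that someI_ex by metis
  have l1: "l y \<prec> y" if "\<beta> \<in> \<Theta>" "y \<in> Y \<beta>" for \<beta> y using l[OF that] unfolding near_def by simp
  have "\<exists>\<zeta>. stat {y \<in> Y \<beta>. l y = \<zeta>}" if \<beta>: "\<beta> \<in> \<Theta>" for \<beta>
    by (rule fodor[OF admissible_stat Y(1)[OF \<beta>]]) (rule l1[OF \<beta>])
  then have "\<exists>\<zeta>. \<forall>\<beta>\<in>\<Theta>. stat {y \<in> Y \<beta>. l y = \<zeta> \<beta>}" by (intro bchoice ballI)
  then obtain \<zeta> where "\<forall>\<beta>\<in>\<Theta>. stat {y \<in> Y \<beta>. l y = \<zeta> \<beta>}" ..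
  then have \<zeta>: "stat {y \<in> Y \<beta>. l y = \<zeta> \<beta>}" if "\<beta> \<in> \<Theta>" for \<beta> using that by (rule bspec)
  have \<zeta>K: "\<zeta> \<beta> \<in> K" if \<beta>: "\<beta> \<in> \<Theta>" for \<beta>
  proof -
    obtain y where "y \<in> Y \<beta>" "l y = \<zeta> \<beta>" using pos_nonempty[OF \<zeta>[OF \<beta>]] by blast
    then show ?thesis using less_in(1)[OF l1[OF \<beta>]] by metis
  qed
  have small: "small \<Theta>" using small_subset[OF small_letters pos(2)] .
  obtain z where z: "z \<in> K" "\<And>\<beta>. \<beta> \<in> \<Theta> \<Longrightarrow> \<zeta> \<beta> \<prec> z" using bounded_family[of \<Theta> \<zeta>, OF small \<zeta>K] by blast
  define E where "E \<alpha> = {x \<in> {d \<in> S. h d = \<alpha>}. accumulates T x}" for \<alpha>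
  have E: "unbdd (E \<alpha>)" if "\<alpha> \<in> Field \<theta>" for \<alpha>
    unfolding E_def
    by (rule pos_unbdd[OF admissible_stat pos_accumulates[OF admissible_stat h_stat[OF that] T]])
       (use S_in in blast)
  have "stat {d \<in> {d \<in> S. z \<prec> d}. \<forall>\<alpha>\<in>Field \<theta>. accumulates (E \<alpha>) d}"
    by (rule pos_accumulates_family[OF admissible_stat pos_above[OF admissible_stat S_stat z(1)]
          small_letters E])
  then obtain \<delta> where \<delta>: "\<delta> \<in> S" "z \<prec> \<delta>" "\<And>\<alpha>. \<alpha> \<in> Field \<theta> \<Longrightarrow> accumulates (E \<alpha>) \<delta>"
    using pos_nonempty[of "\<lambda>d b. d \<in> cl b"] by blast
  have "\<exists>y. y \<in> Y \<beta> \<and> l y = \<zeta> \<beta> \<and> \<delta> \<prec> y" if \<beta>: "\<beta> \<in> \<Theta>" for \<beta>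
    using pos_nonempty[OF pos_above[OF admissible_stat \<zeta>[OF \<beta>] S_in[OF \<delta>(1)]]] by blast
  then obtain y where y: "\<And>\<beta>. \<beta> \<in> \<Theta> \<Longrightarrow> y \<beta> \<in> Y \<beta> \<and> l (y \<beta>) = \<zeta> \<beta> \<and> \<delta> \<prec> y \<beta>" by metis
  define gate where "gate \<beta> m \<longleftrightarrow> m \<prec> \<delta> \<and> \<zeta> \<beta> \<preceq> m \<and> (\<forall>p\<in>{y \<beta>}. \<forall>\<eta>. m \<prec> \<eta> \<longrightarrow> \<eta> \<prec> \<delta> \<longrightarrow>
      path p \<eta> = path p \<delta> @ path \<delta> \<eta>)" for \<beta> m
  have "\<exists>m. gate \<beta> m" if \<beta>: "\<beta> \<in> \<Theta>" for \<beta>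
    unfolding gate_def
    by (rule path_near_finite[OF \<delta>(1)]) (use y[OF \<beta>] less_trans[OF z(2)[OF \<beta>] \<delta>(2)] in auto)
  then obtain m where m: "\<And>\<beta>. \<beta> \<in> \<Theta> \<Longrightarrow> gate \<beta> (m \<beta>)" by metis
  have tails: "\<exists>\<eta>\<in>T. u \<prec> \<eta> \<and> \<eta> \<prec> \<delta> \<and> \<alpha> \<in> set (word \<delta> \<eta>)" if au: "\<alpha> \<in> Field \<theta>" "u \<prec> \<delta>" for \<alpha> u
  proof -
    obtain x where x: "x \<in> E \<alpha>" "u \<prec> x" "x \<prec> \<delta>" using \<delta>(3)[OF au(1)] au(2) unfolding accumulates_def by blast
    then have xS: "x \<in> S" "h x = \<alpha>" "accumulates T x" unfolding E_def by blast+
    obtain l' where l': "l' \<prec> x" "u \<preceq> l'"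
        "\<forall>p\<in>{\<delta>}. \<forall>\<eta>. l' \<prec> \<eta> \<longrightarrow> \<eta> \<prec> x \<longrightarrow> path p \<eta> = path p x @ path x \<eta>"
      using path_near_finite[OF xS(1), of "{\<delta>}" u] x by auto
    obtain \<eta> where \<eta>: "\<eta> \<in> T" "l' \<prec> \<eta>" "\<eta> \<prec> x" using xS(3) l'(1) unfolding accumulates_def by blast
    have "path \<delta> \<eta> = path \<delta> x @ x # path (step x \<eta>) \<eta>"
      using l'(3) \<eta>(2,3) path_Cons[OF \<eta>(3)] by simp
    then have "\<alpha> \<in> set (word \<delta> \<eta>)" using xS(2) by simp
    moreover have "u \<prec> \<eta>" using l'(2) \<eta>(2) by (rule leq_less_trans)
    moreover have "\<eta> \<prec> \<delta>" using \<eta>(3) x(3) by (rule less_trans)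
    ultimately show ?thesis using \<eta>(1) by blast
  qed
  define Z where "Z \<beta> = h ` ((\<Union>p\<in>H (y \<beta>). set (path p (y \<beta>))) \<union> set (path (y \<beta>) \<delta>))" for \<beta>
  \<comment> \<open>the number of stops with letter \<open>\<beta>\<close> on the walk from \<open>y \<beta>\<close> to the gate, without \<open>y \<beta>\<close>\<close>
  define j where "j \<beta> = (if J = UNIV then length (filter (\<lambda>q. h q = \<beta>) (tl (path (y \<beta>) \<delta>))) else SOME j. j \<in> J)" for \<beta>
  have "\<exists>\<beta>\<in>\<Theta>. \<exists>\<eta>\<in>T. \<exists>n. m \<beta> \<prec> \<eta> \<and> \<eta> \<prec> \<delta> \<and> \<beta> \<notin> set (word \<delta> \<eta>) \<and> F n = j \<beta> \<and>
    (\<forall>A. \<beta> \<in> set A \<and> set A \<subseteq> Z \<beta> \<longrightarrow> T.rk (A @ word \<delta> \<eta>) = n \<and> T.dominant (A @ word \<delta> \<eta>) = \<beta>)"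
  proof (rule T.dominating_word[OF wellorder_rel_axioms pos tails])
    show "set (word \<delta> \<eta>) \<subseteq> Field \<theta>" for \<eta> using h_in by auto
    show "m \<beta> \<prec> \<delta>" if "\<beta> \<in> \<Theta>" for \<beta> using m[OF that] unfolding gate_def by simp
    show "finite (Z \<beta>) \<and> Z \<beta> \<subseteq> Field \<theta>" if "\<beta> \<in> \<Theta>" for \<beta>
      using H(1)[OF that] y[OF that] h_in unfolding Z_def by auto
    show "j \<beta> \<in> J" for \<beta> using J unfolding j_def by (auto intro: someI)
  qed
  then obtain \<beta> \<eta> n where \<beta>: "\<beta> \<in> \<Theta>" and \<eta>: "\<eta> \<in> T" "m \<beta> \<prec> \<eta>" "\<eta> \<prec> \<delta>"
    and w: "\<beta> \<notin> set (word \<delta> \<eta>)" "F n = j \<beta>"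
    and dom: "\<forall>A. \<beta> \<in> set A \<and> set A \<subseteq> Z \<beta> \<longrightarrow>
      T.rk (A @ word \<delta> \<eta>) = n \<and> T.dominant (A @ word \<delta> \<eta>) = \<beta>" by blast
  define v where "v = y \<beta>"
  have v: "v \<in> Y \<beta>" "l v = \<zeta> \<beta>" "\<delta> \<prec> v" and hv: "h v = \<beta>"
    using y[OF \<beta>] Y(2)[OF \<beta>] unfolding v_def by auto
  note mg = m[OF \<beta>, unfolded gate_def]
  have \<zeta>\<eta>: "\<zeta> \<beta> \<prec> \<eta>" using mg \<eta>(2) leq_less_trans by blast
  have \<eta>v: "\<eta> \<prec> v" using \<eta>(3) v(3) by (rule less_trans)
  note nv = l[OF \<beta> v(1), unfolded near_def v(2)]
  have pv: "path v \<eta> = path v \<delta> @ path \<delta> \<eta>" using mg \<eta>(2,3) unfolding v_def by simp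
  have sv: "path v \<delta> = v # tl (path v \<delta>)" using path_Cons[OF v(3)] by simp
  have pp: "path p \<eta> = path p v @ path v \<delta> @ path \<delta> \<eta>" if "p \<in> insert v (H v)" for p
    using that nv \<zeta>\<eta> \<eta>v pv path_self by auto
  have "letter p \<eta> = \<beta> \<and> (J = UNIV \<longrightarrow> selected F p \<eta> = v)" if p: "p \<in> insert v (H v)" for p
  proof -
    define A where "A = map h (path p v @ path v \<delta>)"
    have "\<beta> \<in> set A" using hv sv unfolding A_def by (metis UnCI image_eqI list.set_intros(1) list.set_map set_append)
    moreover have "set A \<subseteq> Z \<beta>"
      using p path_self[of v] unfolding A_def Z_def v_def[symmetric] by auto
    ultimately have A: "T.rk (A @ word \<delta> \<eta>) = n" "T.dominant (A @ word \<delta> \<eta>) = \<beta>" using dom by simp_all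
    have wp: "word p \<eta> = A @ word \<delta> \<eta>" unfolding pp[OF p] A_def by simp
    then have let_p: "letter p \<eta> = \<beta>" using A by simp
    have "selected F p \<eta> = v" if "J = UNIV"
    proof -
      let ?f = "filter (\<lambda>q. h q = \<beta>)"
      have "?f (path \<delta> \<eta>) = []" using w(1) by (auto simp: filter_empty_conv)
      moreover have "?f (path v \<delta>) = v # ?f (tl (path v \<delta>))"
        using hv by (subst sv) simp
      ultimately have "rev (?f (path p \<eta>)) = rev (?f (tl (path v \<delta>))) @ v # rev (?f (path p v))"
        unfolding pp[OF p] by simp
      moreover have "F (T.rk (word p \<eta>)) = length (rev (?f (tl (path v \<delta>))))"
        using wp A(1) w(2) that unfolding j_def v_def by simp
      ultimately show ?thesis unfolding selected_def let_p by (simp only: nth_append_length)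
    qed
    then show ?thesis using let_p by blast
  qed
  moreover have "g v \<prec> \<eta>" using nv \<zeta>\<eta> leq_less_trans by blast
  ultimately show ?thesis using \<beta> v(1) \<eta>(1) \<eta>v by blast
qed

text \<open>
  If the value of the rank under \<open>F\<close> can be prescribed, the walks themselves tell which point is
  meant: \<open>\<eta>\<close> is attached to \<open>p\<close> if \<open>p\<close> is selected, and otherwise inherits from the selected
  point.
\<close>

inductive attached :: "(nat \<Rightarrow> nat) \<Rightarrow> ('a \<Rightarrow> 'a \<Rightarrow> bool) \<Rightarrow> 'a \<Rightarrow> 'a \<Rightarrow> bool" for F L where
  self: "selected F p \<eta> = p \<Longrightarrow> attached F L \<eta> p"
| inherit: "selected F p \<eta> = q \<Longrightarrow> q \<noteq> p \<Longrightarrow> L p q \<Longrightarrow> attached F L q p \<Longrightarrow> attached F L \<eta> p"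

lemma attached_captures:
  assumes "T.pos (T.guess F UNIV) (Field \<theta>)"
  shows "captures S h (Field \<theta>) L (attached F L)"
  unfolding captures_def
proof (intro allI impI)
  fix T Y :: "'a set" and H :: "'a \<Rightarrow> 'a set" and g
  assume T: "unbdd T" and Y: "Y \<subseteq> S" "\<forall>\<beta>\<in>Field \<theta>. stat {y \<in> Y. h y = \<beta>}"
    and H: "\<forall>y\<in>Y. finite (H y) \<and> g y \<prec> y"
  define H' where "H' y = {p \<in> H y. y \<prec> p}" for y
  have "\<exists>\<beta>\<in>Field \<theta>. \<exists>y\<in>{y \<in> Y. h y = \<beta>}. \<exists>\<eta>\<in>T. g y \<prec> \<eta> \<and> \<eta> \<prec> y \<and>
    (\<forall>p\<in>insert y (H' y). letter p \<eta> = \<beta> \<and> ((UNIV :: nat set) = UNIV \<longrightarrow> selected F p \<eta> = y))"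
    by (rule dominating_walk[where Y = "\<lambda>\<beta>. {y \<in> Y. h y = \<beta>}", OF T assms]) (use Y H in \<open>auto simp: H'_def\<close>)
  then obtain y \<eta> where y: "y \<in> Y" "\<eta> \<in> T" "g y \<prec> \<eta>" "\<eta> \<prec> y"
    and sel: "\<And>p. p \<in> insert y (H' y) \<Longrightarrow> selected F p \<eta> = y" by blast
  have "attached F L \<eta> p \<longleftrightarrow> L p y \<and> attached F L y p" if "p \<in> H y" "y \<prec> p" for p
  proof -
    have "selected F p \<eta> = y" using sel that unfolding H'_def by blast
    moreover have "p \<noteq> y" using that(2) less_irrefl by blast
    ultimately show ?thesis by (subst attached.simps) auto
  qed
  then show "\<exists>y\<in>Y. \<exists>\<eta>\<in>T. g y \<prec> \<eta> \<and> \<eta> \<prec> y \<and> attached F L \<eta> y \<and>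
      (\<forall>p\<in>H y. y \<prec> p \<longrightarrow> attached F L \<eta> p = (L p y \<and> attached F L y p))"
    using y sel attached.self[of F y \<eta> L] by blast
qed

end

section \<open>Letters beyond the second uncountable cardinal: club guessing\<close>

context regular_rel
begin

lemma unbdd_cl:
  assumes "\<forall>z\<in>K. b z \<in> K"
  shows "unbdd (cl b)"
  unfolding unbdd_def
proof (intro conjI ballI)
  show "cl b \<subseteq> K" using cl_in by blast
  fix x assume "x \<in> K"
  then obtain d where "d \<in> cl b" "x \<prec> d" using closure_point_sequence[of b x] assms by blast
  then show "\<exists>a\<in>cl b. x \<prec> a" by blast
qed

lemma stat_K: "stat K"
proof -
  obtain x where "x \<in> K" using infinite_K by (metis ex_in_conv finite.emptyI)
  show ?thesis
    unfolding pos_def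
  proof (intro allI impI)
    fix b assume "\<forall>z\<in>K. b z \<in> K"
    then obtain d where "d \<in> cl b" using unbdd_cl \<open>x \<in> K\<close> unfolding unbdd_def by blast
    then show "\<exists>d\<in>K. d \<in> cl b" using cl_in by (intro bexI[of _ d])
  qed
qed

lemma greatest_closure_point:
  assumes d0: "d0 \<in> cl b" "d0 \<preceq> x"
  shows "\<exists>d\<in>cl b. d \<preceq> x \<and> (\<forall>d'\<in>cl b. d' \<preceq> x \<longrightarrow> d' \<preceq> d)"
proof -
  define U where "U = {u \<in> K. \<forall>d\<in>cl b. d \<preceq> x \<longrightarrow> d \<preceq> u}"
  have "x \<in> U" using d0(2) leq_in unfolding U_def by blast
  then obtain d where d: "d \<in> U" "\<forall>u\<in>U. d \<preceq> u" using least_ex[of U] unfolding U_def by blast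
  have "d0 \<preceq> d" using d(1) d0 unfolding U_def by blast
  have "b z \<prec> d" if z: "z \<prec> d" for z
  proof -
    have "z \<notin> U" using d(2) z leq_less_trans less_irrefl by blast
    then obtain d' where d': "d' \<in> cl b" "d' \<preceq> x" "\<not> d' \<preceq> z" using z less_in unfolding U_def by blast
    then have "z \<prec> d'" using not_less[of z d'] cl_in z less_in by blast
    then have "b z \<prec> d'" using clD[OF d'(1)] by blast
    moreover have "d' \<preceq> d" using d(1) d'(1,2) unfolding U_def by blast
    ultimately show ?thesis by (rule less_leq_trans)
  qed
  moreover have "\<exists>z. z \<prec> d" using d0(1) \<open>d0 \<preceq> d\<close> less_leq_trans unfolding cl_def by blast
  ultimately have "d \<in> cl b" using d(1) unfolding cl_def U_def by blast
  moreover have "d \<preceq> x" using d(2) \<open>x \<in> U\<close> by blast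
  ultimately show ?thesis using d(1) unfolding U_def by blast
qed

definition retract :: "('a \<Rightarrow> 'a) \<Rightarrow> 'a \<Rightarrow> 'a" where
  "retract b x = (if \<exists>d\<in>cl b. d \<preceq> x
     then SOME d. d \<in> cl b \<and> d \<preceq> x \<and> (\<forall>d'\<in>cl b. d' \<preceq> x \<longrightarrow> d' \<preceq> d) else x)"

lemma retract:
  assumes "d0 \<in> cl b" "d0 \<preceq> x"
  shows "retract b x \<in> cl b" "retract b x \<preceq> x" "d' \<in> cl b \<Longrightarrow> d' \<preceq> x \<Longrightarrow> d' \<preceq> retract b x"
proof -
  have "\<exists>d. d \<in> cl b \<and> d \<preceq> x \<and> (\<forall>d'\<in>cl b. d' \<preceq> x \<longrightarrow> d' \<preceq> d)"
    using greatest_closure_point[OF assms] by blast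
  from someI_ex[OF this]
  have "retract b x \<in> cl b \<and> retract b x \<preceq> x \<and> (\<forall>d'\<in>cl b. d' \<preceq> x \<longrightarrow> d' \<preceq> retract b x)"
    unfolding retract_def using assms by auto
  then show "retract b x \<in> cl b" "retract b x \<preceq> x" "d' \<in> cl b \<Longrightarrow> d' \<preceq> x \<Longrightarrow> d' \<preceq> retract b x"
    by blast+
qed

lemma retract_leq: "x \<in> K \<Longrightarrow> retract b x \<preceq> x"
  using retract(2)[of _ b x] leq_refl[of x] unfolding retract_def by (cases "\<exists>d\<in>cl b. d \<preceq> x") auto

text \<open>
  Shelah's club guessing at points of countable cofinality. Start with arbitrary ladders and push
  their points down to the next point of a club. If no club makes these ladders guess, every
  attempt yields a club on which it fails; shrink the clubs in this way uncountably often. At a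
  point that is good for all of them, each ladder point moves down only finitely often, hence all of
  them have come to rest at some stage, in spite of the failure there.
\<close>

lemma club_guessing:
  fixes W :: "'w rel"
  assumes W: "regular_rel W" "W <o r"
  shows "\<exists>e. \<forall>c. (\<forall>z\<in>K. c z \<in> K) \<longrightarrow>
    (\<exists>\<beta>\<in>cl c. ladder \<beta> (e \<beta>) \<and> (\<exists>N. \<forall>n\<ge>N. e \<beta> n \<in> cl c))"
proof (rule ccontr)
  interpret W: regular_rel W by (rule W(1))
  define good where "good e c \<longleftrightarrow> (\<exists>\<beta>\<in>cl c. ladder \<beta> (e \<beta>) \<and> (\<exists>N. \<forall>n\<ge>N. e \<beta> n \<in> cl c))"
    for e :: "'a \<Rightarrow> nat \<Rightarrow> 'a" and c
  assume "\<nexists>e. \<forall>c. (\<forall>z\<in>K. c z \<in> K) \<longrightarrow>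
    (\<exists>\<beta>\<in>cl c. ladder \<beta> (e \<beta>) \<and> (\<exists>N. \<forall>n\<ge>N. e \<beta> n \<in> cl c))"
  then have bad: "\<exists>c. (\<forall>z\<in>K. c z \<in> K) \<and> \<not> good e c" for e unfolding good_def by simp
  define e0 where "e0 \<beta> = (SOME s. ladder \<beta> s)" for \<beta>
  define L where "L = {\<beta>. \<exists>s. ladder \<beta> s}"
  have e0: "ladder \<beta> (e0 \<beta>)" if "\<beta> \<in> L" for \<beta>
    using someI_ex[of "ladder \<beta>"] that unfolding L_def e0_def by simp
  define sub where "sub b \<beta> = (SOME s. ladder \<beta> s \<and>
      (\<exists>k. s = (\<lambda>n. retract b (e0 \<beta> n)) \<circ> k \<and> strict_mono (k :: nat \<Rightarrow> nat)))" for b \<beta>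
  define G where "G b = (SOME c. (\<forall>z\<in>K. c z \<in> K) \<and> \<not> good (sub b) c)" for b
  have "(\<forall>z\<in>K. G b z \<in> K) \<and> \<not> good (sub b) (G b)" for b
    using someI_ex[OF bad[of "sub b"]] unfolding G_def .
  then have GK: "G b z \<in> K" and G: "\<not> good (sub b) (G b)" if "z \<in> K" for b z using that by simp_all
  have miss: "\<exists>n\<ge>N. retract b (e0 \<beta> n) \<notin> cl (G b)"
    if \<beta>: "\<beta> \<in> L" "\<beta> \<in> cl (G b)" "accumulates (cl b) \<beta>" for b \<beta> N
  proof (rule ccontr)
    assume "\<not> ?thesis"
    then have in_cl: "retract b (e0 \<beta> n) \<in> cl (G b)" if "n \<ge> N" for n using that by simp
    have lt: "retract b (e0 \<beta> n) \<prec> \<beta>" for n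
    proof -
      have "e0 \<beta> n \<prec> \<beta>" using e0[OF \<beta>(1)] unfolding ladder_def by simp
      then show ?thesis using retract_leq[of "e0 \<beta> n" b] less_in leq_less_trans by blast
    qed
    have cof: "\<exists>n. z \<prec> retract b (e0 \<beta> n)" if z: "z \<prec> \<beta>" for z
    proof -
      obtain d where d: "d \<in> cl b" "z \<prec> d" "d \<prec> \<beta>" using \<beta>(3) z unfolding accumulates_def by blast
      obtain n where "d \<prec> e0 \<beta> n" using e0[OF \<beta>(1)] d(3) unfolding ladder_def by blast
      then have "d \<preceq> e0 \<beta> n" by (rule less_imp_leq)
      then have "d \<preceq> retract b (e0 \<beta> n)" using retract(3)[OF d(1) _ d(1)] by blast
      then show ?thesis using d(2) less_leq_trans by blast
    qed
    obtain k :: "nat \<Rightarrow> nat" where k: "ladder \<beta> ((\<lambda>n. retract b (e0 \<beta> n)) \<circ> k)" "strict_mono k"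
      by (rule ladder_from_sequence[OF lt cof])
    then have "\<exists>s. ladder \<beta> s \<and> (\<exists>k. s = (\<lambda>n. retract b (e0 \<beta> n)) \<circ> k \<and> strict_mono (k :: nat \<Rightarrow> nat))"
      by (intro exI[of _ "(\<lambda>n. retract b (e0 \<beta> n)) \<circ> k"] conjI exI[of _ k] refl)
    from someI_ex[OF this, folded sub_def]
    obtain k' :: "nat \<Rightarrow> nat" where s: "ladder \<beta> (sub b \<beta>)"
      and k': "sub b \<beta> = (\<lambda>n. retract b (e0 \<beta> n)) \<circ> k'" "strict_mono k'" by (elim exE conjE)
    have "sub b \<beta> n \<in> cl (G b)" if "n \<ge> N" for n
      using in_cl[of "k' n"] seq_suble[OF k'(2), of n] that unfolding k'(1) by simp
    then have "good (sub b) (G b)" unfolding good_def using \<beta>(2) s by blast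
    then show False using G[OF cl_in[OF \<beta>(2)]] by simp
  qed
  define R where "R = {(\<xi>, \<xi>'). \<xi> \<prec>\<^bsub>W\<^esub> \<xi>'}"
  define P where "P f \<xi> b \<longleftrightarrow> (\<forall>z\<in>K. b z \<in> K) \<and>
      (\<forall>\<zeta>. (\<zeta>, \<xi>) \<in> R \<longrightarrow> (\<forall>z u. u \<preceq> z \<longrightarrow> mx (f \<zeta> u) (G (f \<zeta>) u) \<prec> b z))" for f \<xi> b
  have smallW: "small (Field W)"
    unfolding small_def using W.card_order card_of_Field_ordIso W(2) ordIso_ordLess_trans by blast
  have "\<exists>f. \<forall>\<xi>. P f \<xi> (f \<xi>)"
  proof (rule dependent_wf_choice)
    show "wf R" unfolding R_def by (rule W.wf_less)
    show "P f \<xi> b = P g \<xi> b" if "\<And>\<zeta>. (\<zeta>, \<xi>) \<in> R \<Longrightarrow> f \<zeta> = g \<zeta>" for f g \<xi> b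
      unfolding P_def using that by simp
    fix \<xi> f assume IH: "\<And>\<zeta>. (\<zeta>, \<xi>) \<in> R \<Longrightarrow> P f \<zeta> (f \<zeta>)"
    have sm: "small {\<zeta>. (\<zeta>, \<xi>) \<in> R}"
      by (rule small_subset[OF smallW]) (use W.less_in(1) in \<open>auto simp: R_def\<close>)
    have "mx (f \<zeta> u) (G (f \<zeta>) u) \<in> K" if "\<zeta> \<in> {\<zeta>. (\<zeta>, \<xi>) \<in> R}" "u \<in> K" for \<zeta> u
    proof -
      have "f \<zeta> u \<in> K" using IH that unfolding P_def by simp
      then show ?thesis using mx(3) GK[OF that(2)] by simp
    qed
    then have "\<exists>b. (\<forall>z\<in>K. b z \<in> K) \<and>
        (\<forall>\<zeta>\<in>{\<zeta>. (\<zeta>, \<xi>) \<in> R}. \<forall>z u. u \<preceq> z \<longrightarrow> mx (f \<zeta> u) (G (f \<zeta>) u) \<prec> b z)"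
      by (rule dominate[OF sm])
    then show "\<exists>b. P f \<xi> b" unfolding P_def by simp
  qed
  then obtain B where "\<forall>\<xi>. P B \<xi> (B \<xi>)" ..
  then have P: "P B \<xi> (B \<xi>)" for \<xi> by (rule spec)
  have BK: "B \<xi> z \<in> K" if "z \<in> K" for \<xi> z using P[of \<xi>] that unfolding P_def by simp
  have Bmx: "B \<zeta> z \<prec> B \<xi> z" "G (B \<zeta>) z \<prec> B \<xi> z" if "\<zeta> \<prec>\<^bsub>W\<^esub> \<xi>" "z \<in> K" for \<zeta> \<xi> z
  proof -
    have "mx (B \<zeta> z) (G (B \<zeta>) z) \<prec> B \<xi> z"
      using P[of \<xi>] that leq_refl[OF that(2)] unfolding P_def R_def by simp
    then show "B \<zeta> z \<prec> B \<xi> z" "G (B \<zeta>) z \<prec> B \<xi> z"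
      using mx_less[of "B \<zeta> z" "G (B \<zeta>) z"] BK[OF that(2)] GK[OF that(2)] by simp_all
  qed
  have clB: "d \<in> cl (B \<zeta>)" "d \<in> cl (G (B \<zeta>))" if "\<zeta> \<prec>\<^bsub>W\<^esub> \<xi>" "d \<in> cl (B \<xi>)" for \<zeta> \<xi> d
    by (rule cl_mono[OF that(2)], rule less_imp_leq, rule Bmx[OF that(1)], erule less_in(1))+
  have "\<exists>b. (\<forall>z\<in>K. b z \<in> K) \<and> (\<forall>\<xi>\<in>Field W. \<forall>z u. u \<preceq> z \<longrightarrow> B \<xi> u \<prec> b z)"
    by (rule dominate[OF smallW BK])
  then obtain b where bK: "\<forall>z\<in>K. b z \<in> K" and b: "\<forall>\<xi>\<in>Field W. \<forall>z u. u \<preceq> z \<longrightarrow> B \<xi> u \<prec> b z"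
    by (elim exE conjE) (rule that)
  have clb: "d \<in> cl (B \<xi>)" if \<xi>: "\<xi> \<in> Field W" and d: "d \<in> cl b" for \<xi> d
  proof (rule cl_mono[OF d])
    fix z assume "z \<prec> d"
    then have "z \<preceq> z" using less_in leq_refl by blast
    then show "B \<xi> z \<preceq> b z" using b \<xi> less_imp_leq by simp
  qed
  have "stat {\<beta> \<in> {\<beta> \<in> L. accumulates (cl b) \<beta>}. \<beta> \<in> cl b}"
    by (rule pos_cl[OF admissible_stat pos_accumulates[OF admissible_stat _ unbdd_cl[OF bK]]])
       (use bK stat_ladder in \<open>simp_all add: L_def\<close>)
  then obtain \<beta> where \<beta>: "\<beta> \<in> L" "accumulates (cl b) \<beta>" "\<beta> \<in> cl b"
    using pos_nonempty[of "\<lambda>d b. d \<in> cl b"] by blast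
  have acc: "accumulates (cl (B \<xi>)) \<beta>" if "\<xi> \<in> Field W" for \<xi>
    using \<beta>(2) clb[OF that] unfolding accumulates_def by blast
  obtain z0 where "z0 \<prec> \<beta>" using \<beta>(3) unfolding cl_def by blast
  then obtain d0 where d0: "d0 \<in> cl b" "d0 \<prec> \<beta>" using \<beta>(2) unfolding accumulates_def by blast
  obtain N where N: "d0 \<prec> e0 \<beta> N" using e0[OF \<beta>(1)] d0(2) unfolding ladder_def by blast
  define x where "x n = e0 \<beta> (N + n)" for n
  have d0x: "d0 \<preceq> x n" for n
  proof -
    have "e0 \<beta> N \<preceq> x n" unfolding x_def by (rule ladder_leq[OF e0[OF \<beta>(1)]]) simp
    then show ?thesis using N less_leq_trans less_imp_leq by blast
  qed
  define v where "v \<xi> n = retract (B \<xi>) (x n)" for \<xi> n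
  have v: "v \<xi> n \<in> cl (B \<xi>)" "v \<xi> n \<preceq> x n" "d \<in> cl (B \<xi>) \<Longrightarrow> d \<preceq> x n \<Longrightarrow> d \<preceq> v \<xi> n"
    if "\<xi> \<in> Field W" for \<xi> n d
    using retract[OF clb[OF that d0(1)] d0x] unfolding v_def by simp_all
  have vmono: "v \<xi> n \<preceq> v \<zeta> n" if "\<zeta> \<prec>\<^bsub>W\<^esub> \<xi>" for \<zeta> \<xi> n
    using v[OF W.less_in(2)[OF that]] v(3)[OF W.less_in(1)[OF that]] clB(1)[OF that] by blast
  have "\<exists>\<xi>\<in>Field W. \<forall>\<zeta>. \<xi> \<prec>\<^bsub>W\<^esub> \<zeta> \<longrightarrow> v \<zeta> n = v \<xi> n" for n
  proof -
    have ne: "(\<lambda>\<xi>. v \<xi> n) ` Field W \<noteq> {}" using W.infinite_K by auto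
    have sub: "(\<lambda>\<xi>. v \<xi> n) ` Field W \<subseteq> K" using v(2) leq_in by blast
    obtain \<xi> where \<xi>: "\<xi> \<in> Field W" "\<forall>\<zeta>\<in>Field W. v \<xi> n \<preceq> v \<zeta> n"
      using least_ex[OF sub ne] by blast
    have "v \<zeta> n = v \<xi> n" if "\<xi> \<prec>\<^bsub>W\<^esub> \<zeta>" for \<zeta>
      using \<xi>(2) W.less_in(2)[OF that] vmono[OF that] leq_antisym by blast
    then show ?thesis using \<xi>(1) by blast
  qed
  then obtain \<xi> where \<xi>: "\<And>n. \<xi> n \<in> Field W" "\<And>n \<zeta>. \<xi> n \<prec>\<^bsub>W\<^esub> \<zeta> \<Longrightarrow> v \<zeta> n = v (\<xi> n) n" by metis
  obtain \<xi>' where \<xi>': "\<xi>' \<in> Field W" "\<And>n. \<xi> n \<prec>\<^bsub>W\<^esub> \<xi>'"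
    using W.bounded_family[OF W.small_nat, of \<xi>] \<xi>(1) by blast
  obtain \<zeta> where \<zeta>: "\<xi>' \<prec>\<^bsub>W\<^esub> \<zeta>" using W.above[OF \<xi>'(1)] by blast
  have \<beta>G: "\<beta> \<in> cl (G (B \<xi>'))" using clB(2)[OF \<zeta>] clb[OF W.less_in(2)[OF \<zeta>] \<beta>(3)] by blast
  obtain n where n: "n \<ge> N" "retract (B \<xi>') (e0 \<beta> n) \<notin> cl (G (B \<xi>'))"
    using miss[OF \<beta>(1) \<beta>G acc[OF \<xi>'(1)]] by blast
  define i where "i = n - N"
  have i: "v \<xi>' i \<notin> cl (G (B \<xi>'))" using n unfolding v_def x_def i_def by simp
  have "v \<zeta> i = v \<xi>' i" using \<xi>(2)[OF \<xi>'(2)] \<xi>(2)[OF W.less_trans[OF \<xi>'(2) \<zeta>]] by metis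
  then have "v \<xi>' i \<in> cl (B \<zeta>)" using v(1)[OF W.less_in(2)[OF \<zeta>]] by metis
  then show False using clB(2)[OF \<zeta>] i by blast
qed

lemma guessing_ladders:
  fixes W :: "'w rel"
  assumes W: "regular_rel W" "W <o r" and F: "\<And>j. infinite {n. F n = j}"
  shows "\<exists>e. pos (ladder_system.guess r e F UNIV) K"
proof -
  obtain e where e: "\<forall>c. (\<forall>z\<in>K. c z \<in> K) \<longrightarrow>
      (\<exists>\<beta>\<in>cl c. ladder \<beta> (e \<beta>) \<and> (\<exists>N. \<forall>n\<ge>N. e \<beta> n \<in> cl c))"
    using club_guessing[OF W] by (elim exE)
  interpret ladder_system r e by unfold_locales
  have "\<exists>\<beta>\<in>K. guess F UNIV \<beta> c" if c: "\<forall>z\<in>K. c z \<in> K" for c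
  proof -
    obtain \<beta> N where \<beta>: "\<beta> \<in> cl c" "lad \<beta>" "\<forall>n\<ge>N. e \<beta> n \<in> cl c" using e[rule_format, of c] c by blast
    have "n \<in> gaps \<beta> c" if n: "n \<ge> Suc N" for n
    proof -
      have "e \<beta> (n - 1) \<in> cl c" "e \<beta> n \<in> cl c" using \<beta>(3) n by simp_all
      moreover have "e \<beta> (n - 1) \<prec> e \<beta> n" using ladder_less[OF \<beta>(2), of "n - 1" n] n by simp
      moreover have "e \<beta> (n - 1) \<preceq> e \<beta> (n - 1)" "e \<beta> n \<preceq> e \<beta> n"
        using calculation cl_in leq_refl by blast+
      ultimately show ?thesis unfolding gaps_def using n by auto
    qed
    then have sub: "{n. F n = j} - {..N} \<subseteq> {n \<in> gaps \<beta> c. F n = j}" for j by auto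
    have "infinite ({n. F n = j} - {..N})" for j using F by simp
    then have "infinite {n \<in> gaps \<beta> c. F n = j}" for j using sub finite_subset by blast
    then show ?thesis unfolding guess_def using \<beta>(1,2) cl_in by blast
  qed
  then have "pos (guess F UNIV) K" unfolding pos_def by simp
  then show ?thesis by (rule exI[of _ e])
qed

end

section \<open>Letters on the first uncountable cardinal: tables\<close>

context ladder_system
begin

text \<open>
  If \<open>\<beta>\<close> is a limit of limits \<open>a\<close> of closure points, the first ladder point beyond such an \<open>a\<close>
  closes a gap that contains both \<open>a\<close> and a closure point below it.
\<close>

lemma guess_limits:
  assumes X: "stat X" and lad: "\<And>d. d \<in> X \<Longrightarrow> lad d"
  shows "pos (guess (\<lambda>_. 0) {0}) X"
  unfolding pos_def
proof (intro allI impI)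
  fix b assume b: "\<forall>z\<in>K. b z \<in> K"
  note ub = unbdd_cl[OF b]
  define A where "A = {d \<in> {d \<in> K. accumulates (cl b) d}. d \<in> cl b}"
  have "stat A"
    unfolding A_def
    by (rule pos_cl[OF admissible_stat pos_accumulates[OF admissible_stat stat_K ub]]) (use b in simp)
  then have uA: "unbdd A" by (rule pos_unbdd[OF admissible_stat]) (simp add: A_def)
  have "stat {d \<in> {d \<in> X. accumulates A d}. d \<in> cl b}"
    by (rule pos_cl[OF admissible_stat pos_accumulates[OF admissible_stat X uA]]) (use b in simp)
  then obtain \<beta> where \<beta>: "\<beta> \<in> X" "accumulates A \<beta>" "\<beta> \<in> cl b"
    using pos_nonempty[of "\<lambda>d b. d \<in> cl b"] by blast
  note l\<beta> = lad[OF \<beta>(1)]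
  have "\<exists>n\<ge>N. n \<in> gaps \<beta> b" for N
  proof -
    have "e \<beta> N \<prec> \<beta>" using l\<beta> unfolding ladder_def by simp
    then obtain a where a: "a \<in> A" "e \<beta> N \<prec> a" "a \<prec> \<beta>" using \<beta>(2) unfolding accumulates_def by blast
    have ex: "\<exists>n. a \<preceq> e \<beta> n" using l\<beta> a(3) less_imp_leq unfolding ladder_def by blast
    define n where "n = (LEAST n. a \<preceq> e \<beta> n)"
    have n: "a \<preceq> e \<beta> n" using LeastI_ex[OF ex] unfolding n_def .
    have "\<not> n \<le> N" using ladder_leq[OF l\<beta>, of n N] n a(2) leq_trans leq_less_trans less_irrefl by blast
    then have "n - 1 < n" by simp
    then have "\<not> a \<preceq> e \<beta> (n - 1)" using not_less_Least unfolding n_def by blast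
    moreover have "e \<beta> (n - 1) \<in> K" "a \<in> K"
      using l\<beta> less_in(1) a(3) unfolding ladder_def by blast+
    ultimately have "e \<beta> (n - 1) \<prec> a" using not_less by blast
    then obtain x where x: "x \<in> cl b" "e \<beta> (n - 1) \<prec> x" "x \<prec> a"
      using a(1) unfolding A_def accumulates_def by blast
    have "a \<in> cl b" using a(1) unfolding A_def by blast
    moreover have "1 \<le> n" using \<open>\<not> n \<le> N\<close> by simp
    ultimately have "n \<in> gaps \<beta> b" unfolding gaps_def using x n less_imp_leq by blast
    then show ?thesis using \<open>\<not> n \<le> N\<close> by (meson linear nle_le)
  qed
  then have "infinite (gaps \<beta> b)" unfolding infinite_nat_iff_unbounded_le by simp
  then show "\<exists>d\<in>X. guess (\<lambda>_. 0) {0} d b" unfolding guess_def using \<beta>(1,3) l\<beta> by (intro bexI[of _ \<beta>]) auto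
qed

end

context word_walk
begin

text \<open>
  Here the dominant letter is read as a code \<open>t \<beta>\<close> for the finite piece of information that is
  wanted. As there are few codes, one of them serves stationarily many \<open>y\<close>, which can be chosen
  above a point \<open>d\<close> with a letter that has this code; the walks pass near \<open>d\<close> instead of \<open>y\<close>.
\<close>

lemma table_captures:
  assumes t: "\<And>c. c \<in> C \<Longrightarrow> T.pos (T.guess (\<lambda>_. 0) {0}) {\<beta> \<in> Field \<theta>. t \<beta> = c}"
    and C: "small C"
    and U: "\<And>P D. finite P \<Longrightarrow> P \<subseteq> K \<Longrightarrow> \<exists>c\<in>C. \<forall>p\<in>P. U c p \<longleftrightarrow> D p"
  shows "captures S h (Field \<theta>) L (\<lambda>\<eta> p. U (t (letter p \<eta>)) p)"
  unfolding captures_def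
proof (intro allI impI)
  fix T Y :: "'a set" and H :: "'a \<Rightarrow> 'a set" and g
  assume T: "unbdd T" and Y: "Y \<subseteq> S" "\<forall>\<beta>\<in>Field \<theta>. stat {y \<in> Y. h y = \<beta>}"
    and H: "\<forall>y\<in>Y. finite (H y) \<and> g y \<prec> y"
  define V where "V \<eta> p = U (t (letter p \<eta>)) p" for \<eta> p
  define P where "P y = insert y {p \<in> H y. y \<prec> p}" for y
  define c where "c y = (SOME c. c \<in> C \<and> (\<forall>p\<in>P y. U c p \<longleftrightarrow> p = y \<or> L p y \<and> V y p))" for y
  have c: "c y \<in> C \<and> (\<forall>p\<in>P y. U (c y) p \<longleftrightarrow> p = y \<or> L p y \<and> V y p)" if y: "y \<in> Y" for y
  proof -
    have "finite (P y)" "P y \<subseteq> K" using H y Y(1) S_in less_in(2) unfolding P_def by auto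
    from U[OF this, of "\<lambda>p. p = y \<or> L p y \<and> V y p"]
    have "\<exists>c. c \<in> C \<and> (\<forall>p\<in>P y. U c p \<longleftrightarrow> p = y \<or> L p y \<and> V y p)" by blast
    then show ?thesis unfolding c_def by (rule someI_ex)
  qed
  obtain \<beta>0 where "\<beta>0 \<in> Field \<theta>" using T.infinite_K by (metis ex_in_conv finite.emptyI)
  then have Yst: "stat Y" using Y(2) pos_mono[of "\<lambda>d b. d \<in> cl b" "{y \<in> Y. h y = \<beta>0}" Y] by blast
  obtain c0 where c0: "c0 \<in> C" "stat {y \<in> Y. c y = c0}"
    using pos_complete[OF admissible_stat Yst C, of c] c by blast
  have "\<exists>\<zeta>. stat {y \<in> {y \<in> Y. c y = c0}. g y = \<zeta>}"
    by (rule fodor[OF admissible_stat c0(2)]) (use H in simp)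
  then obtain \<zeta> where \<zeta>: "stat {y \<in> {y \<in> Y. c y = c0}. g y = \<zeta>}" ..
  obtain y0 where "y0 \<in> Y" "g y0 = \<zeta>" using pos_nonempty[OF \<zeta>] by blast
  then have \<zeta>K: "\<zeta> \<in> K" using H less_in by blast
  have "\<exists>y. y \<in> Y \<and> c y = c0 \<and> g y = \<zeta> \<and> d \<prec> y" if "d \<in> S" for d
    using pos_nonempty[OF pos_above[OF admissible_stat \<zeta> S_in[OF that]]] by blast
  then obtain y where y: "\<And>d. d \<in> S \<Longrightarrow> y d \<in> Y \<and> c (y d) = c0 \<and> g (y d) = \<zeta> \<and> d \<prec> y d" by metis
  have "\<exists>\<beta>\<in>{\<beta> \<in> Field \<theta>. t \<beta> = c0}. \<exists>d\<in>{d \<in> {d \<in> S. h d = \<beta>}. \<zeta> \<prec> d}. \<exists>\<eta>\<in>T. \<zeta> \<prec> \<eta> \<and> \<eta> \<prec> d \<and>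
    (\<forall>p\<in>insert d (P (y d)). letter p \<eta> = \<beta> \<and> ({0 :: nat} = UNIV \<longrightarrow> selected (\<lambda>_. 0) p \<eta> = d))"
  proof (rule dominating_walk[where Y = "\<lambda>\<beta>. {d \<in> {d \<in> S. h d = \<beta>}. \<zeta> \<prec> d}", OF T t[OF c0(1)]])
    fix \<beta> assume \<beta>: "\<beta> \<in> {\<beta> \<in> Field \<theta>. t \<beta> = c0}"
    then have "\<beta> \<in> Field \<theta>" by simp
    then show "stat {d \<in> {d \<in> S. h d = \<beta>}. \<zeta> \<prec> d}"
      by (rule pos_above[OF admissible_stat h_stat \<zeta>K])
    fix d assume "d \<in> {d \<in> {d \<in> S. h d = \<beta>}. \<zeta> \<prec> d}"
    then have d: "d \<in> S" "h d = \<beta>" "\<zeta> \<prec> d" by simp_all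
    show "d \<in> S \<and> h d = \<beta>" "\<zeta> \<prec> d" using d by simp_all
    show "finite (P (y d))" using H y[OF d(1)] unfolding P_def by simp
    show "d \<prec> p" if "p \<in> P (y d)" for p
      using that y[OF d(1)] less_trans unfolding P_def by blast
  qed auto
  then obtain \<beta> d \<eta> where \<beta>: "t \<beta> = c0" and d: "d \<in> S" and \<eta>: "\<eta> \<in> T" "\<zeta> \<prec> \<eta>" "\<eta> \<prec> d"
    and let_p: "\<And>p. p \<in> P (y d) \<Longrightarrow> letter p \<eta> = \<beta>" by blast
  have V: "V \<eta> p \<longleftrightarrow> p = y d \<or> L p (y d) \<and> V (y d) p" if "p \<in> P (y d)" for p
    using c[of "y d"] y[OF d] that let_p[OF that] \<beta> unfolding V_def by metis
  have "V \<eta> (y d)" using V[of "y d"] unfolding P_def by simp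
  moreover have "V \<eta> p \<longleftrightarrow> L p (y d) \<and> V (y d) p" if "p \<in> H (y d)" "y d \<prec> p" for p
    using V[of p] that less_irrefl unfolding P_def by blast
  moreover have "g (y d) \<prec> \<eta>" "\<eta> \<prec> y d" "y d \<in> Y" using y[OF d] \<eta> less_trans by blast+
  ultimately show "\<exists>y\<in>Y. \<exists>\<eta>\<in>T. g y \<prec> \<eta> \<and> \<eta> \<prec> y \<and> U (t (letter y \<eta>)) y \<and>
      (\<forall>p\<in>H y. y \<prec> p \<longrightarrow> U (t (letter p \<eta>)) p = (L p y \<and> U (t (letter p y)) p))"
    using \<eta>(1) unfolding V_def by blast
qed

end

text \<open>
  A code consists of a finite set \<open>F\<close> and a set of subsets of \<open>F\<close>; with pairwise distinct sets
  \<open>R p\<close> it decides about \<open>p\<close> by the trace of \<open>R p\<close> on \<open>F\<close>, and any finitely many decisions are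
  possible.
\<close>

definition codes :: "'b set \<Rightarrow> ('b set \<times> 'b set set) set" where
  "codes A = Fpow A \<times> Fpow (Fpow A)"

definition decides :: "('a \<Rightarrow> 'b set) \<Rightarrow> 'b set \<times> 'b set set \<Rightarrow> 'a \<Rightarrow> bool" where
  "decides R c p \<longleftrightarrow> R p \<inter> fst c \<in> snd c"

lemma card_finite_subsets:
  assumes A: "infinite A"
  shows "|Fpow A| \<le>o |A|"
proof -
  have *: "|{X. X \<subseteq> A \<and> finite X \<and> card X = n}| \<le>o |A|" for n
  proof (induction n)
    case 0
    have "{X. X \<subseteq> A \<and> finite X \<and> card X = 0} = {{}}" by auto
    moreover have "A \<noteq> {}" using A by auto
    ultimately show ?case by (simp add: card_of_singl_ordLeq)
  next
    case (Suc n)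
    let ?G = "{X. X \<subseteq> A \<and> finite X \<and> card X = n}"
    have "{X. X \<subseteq> A \<and> finite X \<and> card X = Suc n} \<subseteq> (\<lambda>(a, X). insert a X) ` (A \<times> ?G)"
    proof
      fix X assume "X \<in> {X. X \<subseteq> A \<and> finite X \<and> card X = Suc n}"
      then have X: "X \<subseteq> A" "finite X" "card X = Suc n" by auto
      then obtain a Y where "X = insert a Y" "a \<notin> Y" "card Y = n" by (metis card_Suc_eq)
      then show "X \<in> (\<lambda>(a, X). insert a X) ` (A \<times> ?G)" using X by (intro image_eqI[of _ _ "(a, Y)"]) auto
    qed
    then have "|{X. X \<subseteq> A \<and> finite X \<and> card X = Suc n}| \<le>o |A \<times> ?G|"
      by (rule ordLeq_transitive[OF card_of_mono1 card_of_image])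
    also have "|A \<times> ?G| \<le>o |A|"
      by (rule card_of_Times_ordLeq_infinite_Field[OF _ _ Suc.IH]) (use A in \<open>simp_all add: Field_card_of card_of_card_order_on card_of_refl ordIso_imp_ordLeq\<close>)
    finally (ordLeq_transitive) show ?case .
  qed
  have "Fpow A = (\<Union>n. {X. X \<subseteq> A \<and> finite X \<and> card X = n})" unfolding Fpow_def by blast
  moreover have nat: "|UNIV :: nat set| \<le>o |A|" using A infinite_iff_card_of_nat by blast
  have "|\<Union>n. {X. X \<subseteq> A \<and> finite X \<and> card X = n}| \<le>o |A|"
    by (rule card_of_UNION_ordLeq_infinite[OF A nat]) (intro ballI *)
  ultimately show ?thesis by simp
qed

lemma card_codes: "infinite A \<Longrightarrow> |codes A| \<le>o |A|"
proof -
  assume A: "infinite A"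
  have 1: "|Fpow A| \<le>o |A|" by (rule card_finite_subsets[OF A])
  have "(\<lambda>a. {a}) ` A \<subseteq> Fpow A" unfolding Fpow_def by auto
  moreover have "infinite ((\<lambda>a. {a}) ` A)" using A by (simp add: finite_image_iff)
  ultimately have "infinite (Fpow A)" using finite_subset by blast
  then have 2: "|Fpow (Fpow A)| \<le>o |A|" using card_finite_subsets 1 ordLeq_transitive by blast
  have "|Fpow A \<times> Fpow (Fpow A)| \<le>o |A|" 
    by (rule card_of_Times_ordLeq_infinite_Field[OF _ 1 2]) (use A in \<open>simp_all add: Field_card_of card_of_card_order_on\<close>)
  then show ?thesis unfolding codes_def .
qed

lemma decides_all:
  assumes R: "inj_on R K" "\<And>p. p \<in> K \<Longrightarrow> R p \<subseteq> A" and P: "finite P" "P \<subseteq> K"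
  shows "\<exists>c\<in>codes A. \<forall>p\<in>P. decides R c p \<longleftrightarrow> D p"
proof -
  define x where "x p q = (SOME x. (x \<in> R p) \<noteq> (x \<in> R q))" for p q
  have x: "(x p q \<in> R p) \<noteq> (x p q \<in> R q)" if "p \<in> P" "q \<in> P" "p \<noteq> q" for p q
  proof -
    have "R p \<noteq> R q" using R(1) P(2) that unfolding inj_on_def by blast
    then have "\<exists>x. (x \<in> R p) \<noteq> (x \<in> R q)" by blast
    then show ?thesis unfolding x_def by (rule someI_ex)
  qed
  define F where "F = A \<inter> (\<lambda>(p, q). x p q) ` (P \<times> P)"
  have F: "F \<in> Fpow A" using P(1) unfolding F_def Fpow_def by auto
  define W where "W = (\<lambda>p. R p \<inter> F) ` {p \<in> P. D p}"
  have W: "W \<in> Fpow (Fpow A)" using P(1) F unfolding W_def Fpow_def by auto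
  have "p = q" if pq: "p \<in> P" "q \<in> P" "R p \<inter> F = R q \<inter> F" for p q
  proof (rule ccontr)
    assume ne: "p \<noteq> q"
    have "x p q \<in> A" using x[OF pq(1,2) ne] R(2) pq(1,2) P(2) by blast
    then have "x p q \<in> F" using pq(1,2) unfolding F_def by auto
    then show False using pq(3) x[OF pq(1,2) ne] by blast
  qed
  then have "\<forall>p\<in>P. decides R (F, W) p \<longleftrightarrow> D p" unfolding decides_def W_def by auto
  then show ?thesis using F W unfolding codes_def by blast
qed

section \<open>Pullbacks and products of well-orders\<close>

lemma ordLess_imp_strictly_monotone:
  assumes "s <o r"
  shows "\<exists>a\<in>Field r. \<exists>g. (\<forall>x\<in>Field s. g x \<prec>\<^bsub>r\<^esub> a) \<and> (\<forall>x y. x \<prec>\<^bsub>s\<^esub> y \<longrightarrow> g x \<prec>\<^bsub>r\<^esub> g y)"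
proof -
  have wo: "Well_order r" "Well_order s" using assms unfolding ordLess_def by blast+
  obtain a where a: "a \<in> Field r" "s =o Restr r (underS r a)"
    using ordLess_iff_ordIso_Restr[OF wo] assms by blast
  then obtain g where "iso s (Restr r (underS r a)) g" unfolding ordIso_def by blast
  note iso = this[unfolded iso_iff2]
  note bij = iso[THEN conjunct1, unfolded bij_betw_def] and g = iso[THEN conjunct2]
  have "g x \<prec>\<^bsub>r\<^esub> a" if "x \<in> Field s" for x
  proof -
    have "g x \<in> Field (Restr r (underS r a))" using bij that by blast
    then have "g x \<in> underS r a" unfolding Field_def by blast
    then show ?thesis unfolding underS_def lt_def by blast
  qed
  moreover have "g x \<prec>\<^bsub>r\<^esub> g y" if xy: "x \<prec>\<^bsub>s\<^esub> y" for x y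
  proof -
    have F: "x \<in> Field s" "y \<in> Field s" "(x, y) \<in> s" "x \<noteq> y"
      using xy unfolding lt_def Field_def by blast+
    then have "(g x, g y) \<in> r" using g by blast
    moreover have "g x \<noteq> g y" using bij F unfolding inj_on_def by blast
    ultimately show ?thesis unfolding lt_def by blast
  qed
  ultimately show ?thesis by (intro bexI[of _ a] exI[of _ g] a(1)) simp
qed

text \<open>
  Otherwise \<open>s\<close> embeds below a point of \<open>r\<close>, and one gets a strictly monotone map of \<open>r\<close> to itself
  that decreases this point.
\<close>

lemma strictly_monotone_imp_ordLeq:
  assumes r: "Well_order r" and s: "Well_order s"
    and f: "\<And>x. x \<in> Field r \<Longrightarrow> f x \<in> Field s"
    and mono: "\<And>x y. x \<prec>\<^bsub>r\<^esub> y \<Longrightarrow> f x \<prec>\<^bsub>s\<^esub> f y"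
  shows "r \<le>o s"
proof (rule ccontr)
  interpret r: wellorder_rel r by unfold_locales (rule r)
  assume "\<not> r \<le>o s"
  then have "s <o r" using r s not_ordLeq_iff_ordLess by blast
  then obtain a g where a: "a \<in> Field r" and g: "\<forall>x\<in>Field s. g x \<prec>\<^bsub>r\<^esub> a"
    and g_mono: "\<forall>x y. x \<prec>\<^bsub>s\<^esub> y \<longrightarrow> g x \<prec>\<^bsub>r\<^esub> g y"
    using ordLess_imp_strictly_monotone by meson
  have "x \<in> Field r \<Longrightarrow> \<not> g (f x) \<prec>\<^bsub>r\<^esub> x" for x
  proof (induction x rule: r.less_induct)
    case (less x)
    show ?case
    proof
      assume kx: "g (f x) \<prec>\<^bsub>r\<^esub> x"
      then have "\<not> g (f (g (f x))) \<prec>\<^bsub>r\<^esub> g (f x)" using less.IH r.less_in(1) by blast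
      then show False using g_mono mono[OF kx] by blast
    qed
  qed
  then show False using g f a by blast
qed

lemma well_order_pullback:
  assumes s: "Well_order s" and f: "inj_on f A" "\<And>x. x \<in> A \<Longrightarrow> f x \<in> Field s"
  defines "r \<equiv> {(x, y). x \<in> A \<and> y \<in> A \<and> (f x, f y) \<in> s}"
  shows "well_order_on A r" "r \<le>o s"
proof -
  interpret s: wellorder_rel s by unfold_locales (rule s)
  have wf: "wf (r - Id)"
  proof (rule wf_subset)
    show "wf (inv_image {(x, y). x \<prec>\<^bsub>s\<^esub> y} f)" by (rule wf_inv_image[OF s.wf_less])
    show "r - Id \<subseteq> inv_image {(x, y). x \<prec>\<^bsub>s\<^esub> y} f"
      unfolding r_def inv_image_def lt_def using f(1) by (auto dest: inj_onD)
  qed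
  have "r \<subseteq> A \<times> A" "refl_on A r"
    unfolding r_def refl_on_def using s.leq_refl[OF f(2)] by auto
  moreover have "trans r" unfolding r_def trans_def using s.leq_trans by blast
  moreover have "antisym r"
    unfolding r_def antisym_def using s.leq_antisym f(1) by (auto dest: inj_onD)
  moreover have "total_on A r"
    unfolding r_def total_on_def
  proof (intro ballI impI)
    fix x y assume "x \<in> A" "y \<in> A"
    then show "(x, y) \<in> {(x, y). x \<in> A \<and> y \<in> A \<and> (f x, f y) \<in> s} \<or>
        (y, x) \<in> {(x, y). x \<in> A \<and> y \<in> A \<and> (f x, f y) \<in> s}"
      using s.linear[of "f x" "f y"] f(2) s.leq_refl[of "f x"] unfolding lt_def by auto
  qed
  ultimately show wo: "well_order_on A r"
    unfolding order_on_defs well_order_on_def using wf by blast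
  then have fld: "Field r = A" "Well_order r" using well_order_on_Well_order by blast+
  show "r \<le>o s"
  proof (rule strictly_monotone_imp_ordLeq[OF fld(2) s])
    show "f x \<in> Field s" if "x \<in> Field r" for x using that f(2) fld(1) by simp
    show "f x \<prec>\<^bsub>s\<^esub> f y" if "x \<prec>\<^bsub>r\<^esub> y" for x y
      using that f(1) unfolding lt_def r_def by (auto dest: inj_onD)
  qed
qed

lemma Field_ord_prod:
  assumes "Well_order r" "Well_order s"
  shows "Field (ord_prod r s) = Field r \<times> Field s"
proof -
  interpret r: wellorder_rel r by unfold_locales (rule assms(1))
  interpret s: wellorder_rel s by unfold_locales (rule assms(2))
  show ?thesis
  proof (intro equalityI subsetI)
    fix p assume "p \<in> Field (ord_prod r s)"
    then show "p \<in> Field r \<times> Field s"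
      unfolding ord_prod_def Field_def by (auto intro: r.leq_in s.leq_in simp: Field_def)
  next
    fix p assume "p \<in> Field r \<times> Field s"
    then have "(p, p) \<in> ord_prod r s" unfolding ord_prod_def using r.leq_refl by auto
    then show "p \<in> Field (ord_prod r s)" by (rule FieldI1)
  qed
qed

lemma ord_prod_less:
  assumes "Well_order r" "Well_order s"
  shows "(x1, y1) \<prec>\<^bsub>ord_prod r s\<^esub> (x2, y2) \<longleftrightarrow>
    x1 \<in> Field r \<and> x2 \<in> Field r \<and> y1 \<in> Field s \<and> y2 \<in> Field s \<and>
    (y1 \<prec>\<^bsub>s\<^esub> y2 \<or> y1 = y2 \<and> x1 \<prec>\<^bsub>r\<^esub> x2)"
proof -
  interpret r: wellorder_rel r by unfold_locales (rule assms(1))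
  interpret s: wellorder_rel s by unfold_locales (rule assms(2))
  show ?thesis unfolding lt_def ord_prod_def using r.leq_in s.leq_in by auto
qed

lemma Well_order_ord_prod:
  assumes "Well_order r" "Well_order s"
  shows "Well_order (ord_prod r s)"
proof -
  interpret r: wellorder_rel r by unfold_locales (rule assms(1))
  interpret s: wellorder_rel s by unfold_locales (rule assms(2))
  let ?P = "ord_prod r s"
  have wf: "wf (?P - Id)"
  proof (rule wf_subset)
    show "wf (inv_image ({(x, y). x \<prec>\<^bsub>s\<^esub> y} <*lex*> {(x, y). x \<prec>\<^bsub>r\<^esub> y}) (\<lambda>(x, y). (y, x)))"
      by (intro wf_inv_image wf_lex_prod r.wf_less s.wf_less)
    show "?P - Id \<subseteq> inv_image ({(x, y). x \<prec>\<^bsub>s\<^esub> y} <*lex*> {(x, y). x \<prec>\<^bsub>r\<^esub> y}) (\<lambda>(x, y). (y, x))"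
      unfolding ord_prod_def inv_image_def lex_prod_def lt_def by auto
  qed
  have sub: "?P \<subseteq> Field ?P \<times> Field ?P" by (auto simp: Field_def)
  have refl: "refl_on (Field ?P) ?P"
    unfolding Field_ord_prod[OF assms] refl_on_def by (auto simp: ord_prod_def r.leq_refl)
  have "trans ?P"
  proof (rule transI)
    fix p q t assume "(p, q) \<in> ?P" "(q, t) \<in> ?P"
    then show "(p, t) \<in> ?P"
      unfolding ord_prod_def using r.leq_in r.leq_trans[of "fst p" "fst q" "fst t"]
        s.leq_trans[of "snd p" "snd q" "snd t"] s.leq_antisym[of "snd p" "snd q"] by auto
  qed
  moreover have "antisym ?P"
    unfolding antisym_def ord_prod_def using r.leq_antisym s.leq_antisym by auto
  moreover have "total_on (Field ?P) ?P"
    unfolding Field_ord_prod[OF assms] total_on_def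
  proof (intro ballI impI)
    fix p q assume "p \<in> Field r \<times> Field s" "q \<in> Field r \<times> Field s" "p \<noteq> q"
    then show "(p, q) \<in> ?P \<or> (q, p) \<in> ?P"
      using r.linear[of "fst p" "fst q"] s.linear[of "snd p" "snd q"] r.leq_refl
      unfolding ord_prod_def lt_def by auto
  qed
  ultimately show ?thesis unfolding order_on_defs well_order_on_def using wf sub refl by blast
qed

section \<open>The space\<close>

text \<open>
  A point of kind \<open>(i, False)\<close> is in layer \<open>i\<close>. The layers of the points of kind \<open>(i, True)\<close> rise
  towards \<open>i\<close>: the layer of \<open>d\<close> exceeds all those below \<open>i\<close> that are enumerated before \<open>d\<close>.
  Points of both kinds are needed as limits of misplaced points.
\<close>

locale layered = regular_rel r + A: wellorder_rel \<alpha>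
  for r :: "'a rel" and \<alpha> :: "'c rel" +
  fixes S :: "'a set" and h :: "'a \<Rightarrow> 'b" and \<Theta> :: "'b set"
    and layer :: "'a \<Rightarrow> 'c" and kind :: "'a \<Rightarrow> 'c \<times> bool" and enum :: "'a \<Rightarrow> 'c"
    and V :: "'a \<Rightarrow> 'a \<Rightarrow> bool"
  assumes S_limit: "\<And>d. d \<in> S \<Longrightarrow> limit_pt d"
    and letters: "\<Theta> \<noteq> {}"
    and enum: "enum ` K = Field \<alpha>"
    and layer_in: "layer d \<in> Field \<alpha>"
    and kinds: "i \<in> Field \<alpha> \<Longrightarrow> \<beta> \<in> \<Theta> \<Longrightarrow> stat {d \<in> S. kind d = (i, k) \<and> h d = \<beta>}"
    and constant_layer: "d \<in> S \<Longrightarrow> i \<in> Field \<alpha> \<Longrightarrow> kind d = (i, False) \<Longrightarrow> layer d = i"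
    and rising_layer: "d \<in> S \<Longrightarrow> i \<in> Field \<alpha> \<Longrightarrow> kind d = (i, True) \<Longrightarrow>
      layer d = A.lst {j \<in> Field \<alpha>. \<forall>x. x \<prec> d \<longrightarrow> enum x \<prec>\<^bsub>\<alpha>\<^esub> i \<longrightarrow> enum x \<prec>\<^bsub>\<alpha>\<^esub> j}"
    and V: "captures S h \<Theta> (\<lambda>p y. layer p \<prec>\<^bsub>\<alpha>\<^esub> layer y) V"
begin

abbreviation layer_less (infix "\<lhd>" 50) where "i \<lhd> j \<equiv> i \<prec>\<^bsub>\<alpha>\<^esub> j"

lemma S_in: "d \<in> S \<Longrightarrow> d \<in> K"
  using S_limit less_in unfolding limit_pt_def by blast

definition nbhd :: "'a \<Rightarrow> 'a set" where
  "nbhd p = insert p {\<eta>. \<eta> \<prec> p \<and> layer p \<lhd> layer \<eta> \<and> V \<eta> p}"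

definition cell :: "'a \<Rightarrow> 'a set \<Rightarrow> 'a set" where
  "cell y H = {x \<in> K. \<forall>p\<in>H. x \<in> nbhd p \<longleftrightarrow> y \<in> nbhd p}"

definition is_open :: "'a set \<Rightarrow> bool" where
  "is_open W \<longleftrightarrow> W \<subseteq> K \<and> (\<forall>y\<in>W. \<exists>H. finite H \<and> H \<subseteq> K \<and> cell y H \<subseteq> W)"

definition space :: "'a topology" where "space = topology is_open"

lemma cell_Un: "cell y (H \<union> H') = cell y H \<inter> cell y H'"
  unfolding cell_def by blast

lemma in_cell: "y \<in> K \<Longrightarrow> y \<in> cell y H"
  unfolding cell_def by blast

lemma cell_eq: "x \<in> cell y H \<Longrightarrow> cell x H = cell y H"
  unfolding cell_def by blast

lemma openin_space:
  "openin space W \<longleftrightarrow> W \<subseteq> K \<and> (\<forall>y\<in>W. \<exists>H. finite H \<and> H \<subseteq> K \<and> cell y H \<subseteq> W)"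
proof -
  have inter: "is_open (W \<inter> W')" if o: "is_open W" "is_open W'" for W W'
    unfolding is_open_def
  proof (intro conjI ballI)
    show "W \<inter> W' \<subseteq> K" using o unfolding is_open_def by blast
    fix y assume y: "y \<in> W \<inter> W'"
    obtain H where H: "finite H" "H \<subseteq> K" "cell y H \<subseteq> W" using o(1) y unfolding is_open_def by blast
    obtain H' where H': "finite H'" "H' \<subseteq> K" "cell y H' \<subseteq> W'" using o(2) y unfolding is_open_def by blast
    show "\<exists>H. finite H \<and> H \<subseteq> K \<and> cell y H \<subseteq> W \<inter> W'"
      by (rule exI[of _ "H \<union> H'"]) (use H H' in \<open>auto simp: cell_Un\<close>)
  qed
  have union: "is_open (\<Union>\<W>)" if o: "\<forall>W\<in>\<W>. is_open W" for \<W>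
    unfolding is_open_def
  proof (intro conjI ballI)
    show "\<Union>\<W> \<subseteq> K" using o unfolding is_open_def by blast
    fix y assume "y \<in> \<Union>\<W>"
    then obtain W where W: "W \<in> \<W>" "y \<in> W" by blast
    have "is_open W" using o W(1) by (rule bspec)
    then obtain H where "finite H" "H \<subseteq> K" "cell y H \<subseteq> W" using W(2) unfolding is_open_def by blast
    then show "\<exists>H. finite H \<and> H \<subseteq> K \<and> cell y H \<subseteq> \<Union>\<W>" using W(1) by (intro exI[of _ H]) auto
  qed
  have "istopology is_open" unfolding istopology_def using inter union by blast
  then have "openin space = is_open" unfolding space_def by (rule topology_inverse')
  then show ?thesis unfolding is_open_def by simp
qed

lemma topspace_space: "topspace space = K"
proof -
  have "openin space K" unfolding openin_space using cell_def by blast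
  then show ?thesis using openin_subset[of space] openin_topspace[of space] openin_space by blast
qed

lemma clopen_cell:
  assumes "finite H" "H \<subseteq> K"
  shows "openin space (cell y H)" "closedin space (cell y H)"
proof -
  show "openin space (cell y H)"
    unfolding openin_space
  proof (intro conjI ballI)
    fix x assume "x \<in> cell y H"
    then show "\<exists>H'. finite H' \<and> H' \<subseteq> K \<and> cell x H' \<subseteq> cell y H" using cell_eq assms by blast
  qed (auto simp: cell_def)
  have "openin space (K - cell y H)"
    unfolding openin_space
  proof (intro conjI ballI)
    fix x assume x: "x \<in> K - cell y H"
    have "cell x H \<subseteq> K - cell y H"
    proof
      fix z assume z: "z \<in> cell x H"
      have "z \<notin> cell y H"
      proof
        assume "z \<in> cell y H"
        then have "cell y H = cell x H" using cell_eq[OF z] cell_eq by metis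
        then show False using x in_cell by blast
      qed
      then show "z \<in> K - cell y H" using z unfolding cell_def by blast
    qed
    then show "\<exists>H'. finite H' \<and> H' \<subseteq> K \<and> cell x H' \<subseteq> K - cell y H" using assms by blast
  qed blast
  moreover have "cell y H \<subseteq> K" unfolding cell_def by blast
  ultimately show "closedin space (cell y H)" unfolding closedin_def topspace_space by blast
qed

lemma zero_dimensional_space: "zero_dimensional space"
proof -
  define B where "B = {cell y H | y H. finite H \<and> H \<subseteq> K}"
  have clopen: "openin space U \<and> closedin space U" if "U \<in> B" for U
    using that clopen_cell unfolding B_def by blast
  have base: "\<exists>U\<in>B. y \<in> U \<and> U \<subseteq> W" if W: "openin space W" "y \<in> W" for W y
  proof -
    obtain H where "finite H" "H \<subseteq> K" "cell y H \<subseteq> W" using W unfolding openin_space by blast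
    moreover have "y \<in> K" using W unfolding openin_space by blast
    ultimately show ?thesis unfolding B_def using in_cell by (intro bexI[of _ "cell y H"]) auto
  qed
  have "openin space W \<longleftrightarrow> (arbitrary union_of (\<lambda>U. U \<in> B)) W" for W
  proof
    assume W: "openin space W"
    have "\<Union>{U \<in> B. U \<subseteq> W} = W" using base[OF W] by blast
    then show "(arbitrary union_of (\<lambda>U. U \<in> B)) W"
      unfolding union_of_def arbitrary_def by (intro exI[of _ "{U \<in> B. U \<subseteq> W}"]) auto
  next
    assume "(arbitrary union_of (\<lambda>U. U \<in> B)) W"
    then obtain \<W> where \<W>: "\<W> \<subseteq> {U. U \<in> B}" "\<Union>\<W> = W" unfolding union_of_def by blast
    then have "\<forall>U\<in>\<W>. openin space U" using clopen by blast
    then show "openin space W" using \<W>(2) openin_Union by blast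
  qed
  then have "openin space = arbitrary union_of (\<lambda>U. U \<in> B)" by (rule ext)
  then show ?thesis unfolding zero_dimensional_def using clopen by (intro exI[of _ B]) simp
qed

text \<open>
  \<open>nbhd p\<close> consists of \<open>p\<close> and of points of higher layers, hence final segments of the
  lexicographic order are open.
\<close>

definition lex :: "'a rel" where
  "lex = {(p, q). p \<in> K \<and> q \<in> K \<and> ((p, layer p), (q, layer q)) \<in> ord_prod r \<alpha>}"

lemma lex: "well_order_on K lex" "lex \<le>o ord_prod r \<alpha>"
proof -
  have wo: "Well_order (ord_prod r \<alpha>)" by (rule Well_order_ord_prod[OF well_order A.well_order])
  have inj: "inj_on (\<lambda>p. (p, layer p)) K" unfolding inj_on_def by blast
  have "(p, layer p) \<in> Field (ord_prod r \<alpha>)" if "p \<in> K" for p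
    unfolding Field_ord_prod[OF well_order A.well_order] using that layer_in by blast
  from well_order_pullback[OF wo inj this]
  show "well_order_on K lex" "lex \<le>o ord_prod r \<alpha>" unfolding lex_def by blast+
qed

lemma lex_less: "p \<prec>\<^bsub>lex\<^esub> q \<longleftrightarrow>
    p \<in> K \<and> q \<in> K \<and> (layer p \<lhd> layer q \<or> layer p = layer q \<and> p \<prec> q)"
proof -
  have "p \<prec>\<^bsub>lex\<^esub> q \<longleftrightarrow> p \<in> K \<and> q \<in> K \<and> (p, layer p) \<prec>\<^bsub>ord_prod r \<alpha>\<^esub> (q, layer q)"
    unfolding lt_def lex_def by (auto simp: lt_def ord_prod_def)
  then show ?thesis
    unfolding ord_prod_less[OF well_order A.well_order] using layer_in by blast
qed

lemma left_separating_lex: "left_separating space lex"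
  unfolding left_separating_def topspace_space
proof (intro conjI ballI)
  show "well_order_on K lex" by (rule lex(1))
  fix q assume q: "q \<in> K"
  have uS: "underS lex q = {p. p \<prec>\<^bsub>lex\<^esub> q}" unfolding underS_def lt_def by blast
  have "openin space (K - underS lex q)"
    unfolding openin_space
  proof (intro conjI ballI)
    fix p assume p: "p \<in> K - underS lex q"
    have "cell p {p} \<subseteq> K - underS lex q"
    proof
      fix x assume "x \<in> cell p {p}"
      then have x: "x \<in> K" "x \<in> nbhd p" unfolding cell_def nbhd_def by blast+
      have "\<not> x \<prec>\<^bsub>lex\<^esub> q"
      proof (cases "x = p")
        case True
        then show ?thesis using p uS by blast
      next
        case False
        then have px: "layer p \<lhd> layer x" using x(2) unfolding nbhd_def by blast
        have "\<not> layer p \<lhd> layer q" using p q uS lex_less by blast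
        then have "layer q \<lhd> layer x"
          using px A.not_less[OF layer_in layer_in] A.leq_less_trans by blast
        then show ?thesis unfolding lex_less using A.less_asym A.less_irrefl by metis
      qed
      then show "x \<in> K - underS lex q" using x(1) uS by blast
    qed
    then show "\<exists>H. finite H \<and> H \<subseteq> K \<and> cell p H \<subseteq> K - underS lex q" using p by blast
  qed blast
  moreover have "underS lex q \<subseteq> K" unfolding uS using lex_less by blast
  ultimately show "closedin space (underS lex q)" unfolding closedin_def topspace_space by blast
qed

section \<open>No shorter left-separating order\<close>

text \<open>
  Otherwise some cell of each \<open>y\<close> misses \<open>C y\<close>; but the \<open>\<eta>\<close> that is captured for the finite
  sets defining these cells belongs to the cell of its \<open>y\<close> and to \<open>C y\<close>.
\<close>

lemma accumulation_point:
  assumes T: "unbdd T" and Y: "Y \<subseteq> S" "\<And>\<beta>. \<beta> \<in> \<Theta> \<Longrightarrow> stat {y \<in> Y. h y = \<beta>}"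
    and up: "\<And>y t. y \<in> Y \<Longrightarrow> t \<in> T \<Longrightarrow> t \<prec> y \<Longrightarrow> layer y \<lhd> layer t"
    and C: "\<And>y. y \<in> Y \<Longrightarrow> closedin space (C y)" "\<And>y t. y \<in> Y \<Longrightarrow> t \<in> T \<Longrightarrow> t \<prec> y \<Longrightarrow> t \<in> C y"
  shows "\<exists>y\<in>Y. y \<in> C y"
proof (rule ccontr)
  assume neg: "\<not> ?thesis"
  have "\<exists>H. finite H \<and> H \<subseteq> K \<and> cell y H \<subseteq> K - C y" if y: "y \<in> Y" for y
  proof -
    have "openin space (K - C y)" using C(1)[OF y] unfolding closedin_def topspace_space by blast
    moreover have "y \<in> K - C y" using neg y Y(1) S_in by blast
    ultimately show ?thesis unfolding openin_space by blast
  qed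
  then obtain H where H: "\<And>y. y \<in> Y \<Longrightarrow> finite (H y)" "\<And>y. y \<in> Y \<Longrightarrow> cell y (H y) \<subseteq> K - C y" by metis
  have "\<exists>g. g \<prec> y \<and> (\<forall>p\<in>H y. p \<prec> y \<longrightarrow> p \<preceq> g)" if y: "y \<in> Y" for y
  proof -
    obtain z where z: "z \<prec> y" using S_limit Y(1) y unfolding limit_pt_def by blast
    have fin: "finite {p \<in> H y. p \<prec> y}" using H(1)[OF y] by simp
    have below: "p \<prec> y" if "p \<in> {p \<in> H y. p \<prec> y}" for p using that by simp
    obtain m where "m \<prec> y" "\<forall>p\<in>{p \<in> H y. p \<prec> y}. p \<preceq> m" using finite_bound[OF fin below z] by blast
    then show ?thesis by (intro exI[of _ m]) simp
  qed
  then obtain g where g: "\<And>y. y \<in> Y \<Longrightarrow> g y \<prec> y" "\<And>y p. y \<in> Y \<Longrightarrow> p \<in> H y \<Longrightarrow> p \<prec> y \<Longrightarrow> p \<preceq> g y"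
    by metis
  have "\<exists>y\<in>Y. \<exists>\<eta>\<in>T. g y \<prec> \<eta> \<and> \<eta> \<prec> y \<and> V \<eta> y \<and>
        (\<forall>p\<in>H y. y \<prec> p \<longrightarrow> (V \<eta> p \<longleftrightarrow> layer p \<lhd> layer y \<and> V y p))"
    using V[unfolded captures_def, rule_format, of T Y H g] T Y H(1) g(1) by simp
  then obtain y \<eta> where y: "y \<in> Y" "\<eta> \<in> T" "g y \<prec> \<eta>" "\<eta> \<prec> y" "V \<eta> y"
    and Vp: "\<And>p. p \<in> H y \<Longrightarrow> y \<prec> p \<Longrightarrow> V \<eta> p \<longleftrightarrow> layer p \<lhd> layer y \<and> V y p" by blast
  have l: "layer y \<lhd> layer \<eta>" by (rule up[OF y(1,2,4)])
  have "\<eta> \<in> nbhd p \<longleftrightarrow> y \<in> nbhd p" if p: "p \<in> H y" for p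
  proof -
    consider "p = y" | "y \<prec> p" | "p \<prec> y" | "p \<notin> K" using linear[of p y] less_in(2)[OF y(4)] by blast
    then show ?thesis
    proof cases
      case 1
      then show ?thesis unfolding nbhd_def using y(4,5) l by blast
    next
      case 2
      then have "\<eta> \<prec> p" "\<eta> \<noteq> p" "y \<noteq> p" using y(4) less_trans less_irrefl by blast+
      then show ?thesis unfolding nbhd_def using Vp[OF p 2] 2 l A.less_trans by blast
    next
      case 3
      then have "p \<prec> \<eta>" using g(2)[OF y(1) p] y(3) leq_less_trans by blast
      then show ?thesis unfolding nbhd_def using 3 less_asym less_irrefl by blast
    next
      case 4
      then show ?thesis unfolding nbhd_def using less_in y(4) by blast
    qed
  qed
  then have "\<eta> \<in> cell y (H y)" unfolding cell_def using less_in(1)[OF y(4)] by blast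
  then show False using H(2)[OF y(1)] C(2)[OF y(1,2,4)] by blast
qed

lemma stat_meet:
  assumes "i \<in> Field \<alpha>" and "\<forall>z\<in>K. b z \<in> K" "c \<in> K" and "\<beta> \<in> \<Theta>"
  shows "stat {y \<in> {d \<in> S. kind d = (i, k) \<and> d \<in> cl b \<and> c \<prec> d}. h y = \<beta>}"
proof -
  have "stat {d \<in> {d \<in> {d \<in> S. kind d = (i, k) \<and> h d = \<beta>}. d \<in> cl b}. c \<prec> d}"
    by (rule pos_above[OF admissible_stat pos_cl[OF admissible_stat kinds[OF assms(1,4)]] assms(3)])
       (use assms(2) in simp)
  then show ?thesis by (rule pos_mono) blast
qed

end

context regular_rel
begin

lemma not_unbdd_bound:
  assumes "\<not> unbdd A" "A \<subseteq> K"
  shows "\<exists>c\<in>K. \<forall>a\<in>A. a \<prec> c"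
  using bounded[OF assms(2)] not_unbdd_iff[OF assms(2)] assms(1) unfolding small_def by blast

lemma small_Un:
  assumes "small A" "small B"
  shows "small (A \<union> B)"
proof -
  have "small (\<Union>i\<in>UNIV. if i then A else B)"
    by (rule small_UN[OF small_countable]) (use assms in auto)
  moreover have "A \<union> B = (\<Union>i\<in>UNIV. if i then A else B)" by (auto split: if_splits)
  ultimately show ?thesis by metis
qed

lemma injective_regressive_not_stat:
  assumes f: "inj_on f A" "\<And>d. d \<in> A \<Longrightarrow> f d \<prec> d"
  shows "\<not> stat A"
proof
  assume A: "stat A"
  have "\<exists>v. stat {d \<in> A. f d = v}" by (rule fodor[OF admissible_stat A f(2)])
  then obtain v where v: "stat {d \<in> A. f d = v}" ..
  obtain d where d: "d \<in> A" "f d = v" using pos_nonempty[OF v] by blast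
  have "d \<in> K" using f(2)[OF d(1)] less_in by blast
  then obtain d' where d': "d' \<in> A" "f d' = v" "d \<prec> d'"
    using pos_nonempty[OF pos_above[OF admissible_stat v]] by blast
  then have "d = d'" using f(1) d d' unfolding inj_on_def by blast
  then show False using d'(3) less_irrefl by blast
qed

end

context layered
begin

text \<open>
  Suppose that a shorter left-separating order places \<open>y\<close> into the \<open>\<rho> y\<close>-th position of its
  \<open>lev y\<close>-th copy of \<open>\<kappa>\<close>. By induction on \<open>i\<close>, only boundedly many points of the layers from \<open>i\<close>
  on are placed below level \<open>i\<close>: from unboundedly many of them, one would get an accumulation
  point that has to lie in a closed initial segment and thus be misplaced too, which is excluded
  by the induction hypothesis. If unboundedly many have the same level \<open>i'\<close>, one accumulates them
  at points of the layer \<open>i'\<close>; otherwise at points whose layers rise to \<open>i\<close> along with their levels.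
\<close>

lemma misplaced_bounded:
  assumes lev: "\<And>y. y \<in> K \<Longrightarrow> lev y \<in> Field \<alpha>" and \<rho>: "\<And>y. y \<in> K \<Longrightarrow> \<rho> y \<in> K"
    and inj: "\<And>y y'. y \<in> K \<Longrightarrow> y' \<in> K \<Longrightarrow> lev y = lev y' \<Longrightarrow> \<rho> y = \<rho> y' \<Longrightarrow> y = y'"
    and closed_lev: "\<And>j. closedin space {y \<in> K. lev y \<lhd> j}"
    and closed_pos: "\<And>j x. closedin space {y \<in> K. lev y \<lhd> j \<or> lev y = j \<and> \<rho> y \<prec> x}"
  shows "\<not> unbdd {y \<in> K. (i, layer y) \<in> \<alpha> \<and> lev y \<lhd> i}"
proof (induction i rule: A.less_induct)
  case (less i)
  define Bad where "Bad i = {y \<in> K. (i, layer y) \<in> \<alpha> \<and> lev y \<lhd> i}" for i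
  have BadK: "Bad j \<subseteq> K" for j unfolding Bad_def by blast
  define T where "T = Bad i"
  have "\<not> unbdd T"
  proof
    assume T: "unbdd T"
    have "\<exists>c\<in>K. \<forall>y\<in>Bad j. y \<prec> c" if "j \<lhd> i" for j
      using not_unbdd_bound[OF _ BadK] less.IH[OF that] unfolding Bad_def by blast
    then obtain c where c: "\<And>j. j \<lhd> i \<Longrightarrow> c j \<in> K" "\<And>j y. j \<lhd> i \<Longrightarrow> y \<in> Bad j \<Longrightarrow> y \<prec> c j"
      by metis
    have TK: "T \<subseteq> K" and Tl: "\<And>t. t \<in> T \<Longrightarrow> (i, layer t) \<in> \<alpha>" and Tlev: "\<And>t. t \<in> T \<Longrightarrow> lev t \<lhd> i"
      unfolding T_def Bad_def by blast+
    show False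
    proof (cases "\<exists>i'. i' \<lhd> i \<and> unbdd {t \<in> T. lev t = i'}")
      case True
      then obtain i' where i': "i' \<lhd> i" and T': "unbdd {t \<in> T. lev t = i'}" by blast
      define Z where "Z = {y \<in> K. lev y = i' \<and> \<rho> y \<prec> y}"
      have "\<not> stat Z"
        by (rule injective_regressive_not_stat[of \<rho>]) (use inj in \<open>auto simp: Z_def inj_on_def\<close>)
      then obtain b where b: "\<forall>z\<in>K. b z \<in> K" "\<forall>d\<in>Z. d \<notin> cl b" unfolding pos_def by blast
      define b' where "b' z = mx (b z) (\<rho> z)" for z
      have b'K: "\<forall>z\<in>K. b' z \<in> K" using mx(3) b(1) \<rho> unfolding b'_def by blast
      have cl_b: "d \<in> cl b" and cl_\<rho>: "d \<in> cl \<rho>" if d: "d \<in> cl b'" for d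
      proof -
        have "b z \<preceq> b' z" "\<rho> z \<preceq> b' z" if "z \<prec> d" for z
          using mx(1,2)[of "b z" "\<rho> z"] b(1) \<rho> less_in(1)[OF that] unfolding b'_def by blast+
        then show "d \<in> cl b" "d \<in> cl \<rho>" using cl_mono[OF d] by blast+
      qed
      define Y where "Y = {d \<in> S. kind d = (i', False) \<and> d \<in> cl b' \<and> c i' \<prec> d}"
      define C where "C y = {x \<in> K. lev x \<lhd> i' \<or> lev x = i' \<and> \<rho> x \<prec> y}" for y
      have YD: "y \<in> S" "layer y = i'" "y \<in> cl b'" "c i' \<prec> y" "y \<in> K" if "y \<in> Y" for y
        using that constant_layer[OF _ A.less_in(1)[OF i']] S_in unfolding Y_def by blast+
      have "\<exists>y\<in>Y. y \<in> C y"
      proof (rule accumulation_point[OF T'])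
        show "Y \<subseteq> S" using YD(1) by blast
        show "stat {y \<in> Y. h y = \<beta>}" if "\<beta> \<in> \<Theta>" for \<beta>
          unfolding Y_def by (rule stat_meet[OF A.less_in(1)[OF i'] b'K c(1)[OF i'] that])
        show "layer y \<lhd> layer t" if "y \<in> Y" "t \<in> {t \<in> T. lev t = i'}" for y t
          using YD(2)[OF that(1)] Tl[of t] that(2) A.less_leq_trans[OF i'] by blast
        show "closedin space (C y)" for y unfolding C_def by (rule closed_pos)
        show "t \<in> C y" if "y \<in> Y" "t \<in> {t \<in> T. lev t = i'}" "t \<prec> y" for y t
          using clD[OF cl_\<rho>[OF YD(3)[OF that(1)]] that(3)] that(2) TK unfolding C_def by blast
      qed
      then obtain y where y: "y \<in> Y" "y \<in> C y" by blast
      show False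
      proof (cases "lev y \<lhd> i'")
        case True
        then have "y \<in> Bad i'"
          unfolding Bad_def using YD(2,5)[OF y(1)] A.leq_refl[OF A.less_in(1)[OF i']] by blast
        then show False using c(2)[OF i'] YD(4)[OF y(1)] less_asym by blast
      next
        case False
        then have "y \<in> Z" using y(2) unfolding C_def Z_def by blast
        then show False using b(2) cl_b YD(3)[OF y(1)] by blast
      qed
    next
      case False
      have small_lev: "small {t \<in> T. (lev t, i') \<in> \<alpha>}" if i': "i' \<lhd> i" for i'
      proof -
        have "small {t \<in> T. lev t = i'}" using False i' not_unbdd_iff[of "{t \<in> T. lev t = i'}"] TK by blast
        moreover have "small (Bad i')" using less.IH[OF i'] not_unbdd_iff[OF BadK] unfolding Bad_def by blast
        ultimately have "small ({t \<in> T. lev t = i'} \<union> Bad i')" by (rule small_Un)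
        moreover have "{t \<in> T. (lev t, i') \<in> \<alpha>} \<subseteq> {t \<in> T. lev t = i'} \<union> Bad i'"
        proof
          fix t assume t: "t \<in> {t \<in> T. (lev t, i') \<in> \<alpha>}"
          then have "(i', layer t) \<in> \<alpha>" using Tl A.leq_trans[OF A.less_imp_leq[OF i']] by blast
          then show "t \<in> {t \<in> T. lev t = i'} \<union> Bad i'"
            unfolding Bad_def using t TK A.leq_neq by blast
        qed
        ultimately show ?thesis by (rule small_subset)
      qed
      have iA: "i \<in> Field \<alpha>" using T Tlev A.less_in(2) pos_nonempty[OF stat_K] unfolding unbdd_def by blast
      define J where "J y = {j \<in> Field \<alpha>. \<forall>x. x \<prec> y \<longrightarrow> enum x \<lhd> i \<longrightarrow> enum x \<lhd> j}" for y
      have iJ: "i \<in> J y" for y unfolding J_def using iA by blast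
      have JA: "J y \<subseteq> Field \<alpha>" for y unfolding J_def by blast
      have notJ: "\<exists>x. x \<prec> y \<and> enum x \<lhd> i \<and> (j, enum x) \<in> \<alpha>" if jJ: "j \<in> Field \<alpha>" "j \<notin> J y" for j y
      proof -
        obtain x where "x \<prec> y" "enum x \<lhd> i" "\<not> enum x \<lhd> j" using jJ unfolding J_def by blast
        then show ?thesis using A.not_less[of "enum x" j] A.less_in(1) jJ(1) by blast
      qed
      have layerJ: "layer y \<in> J y" "\<And>j. j \<in> J y \<Longrightarrow> (layer y, j) \<in> \<alpha>" if "y \<in> S" "kind y = (i, True)" for y
        using A.lst(1)[OF JA, of y] A.lst(2)[OF JA, of _ y] iJ[of y] rising_layer[OF that(1) iA that(2)]
        unfolding J_def[symmetric] by auto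
      have layer_i: "layer y \<lhd> i" if y: "y \<in> S" "kind y = (i, True)" for y
      proof (rule A.leq_neq[OF layerJ(2)[OF y iJ]])
        show "layer y \<noteq> i"
        proof
          assume eq: "layer y = i"
          have "T \<subseteq> (\<Union>x\<in>{x. x \<prec> y \<and> enum x \<lhd> i}. {t \<in> T. (lev t, enum x) \<in> \<alpha>})"
          proof
            fix t assume t: "t \<in> T"
            have "lev t \<notin> J y" using layerJ(2)[OF y] eq Tlev[OF t] A.less_leq_trans A.less_irrefl by metis
            then obtain x where "x \<prec> y" "enum x \<lhd> i" "(lev t, enum x) \<in> \<alpha>"
              using notJ lev t TK by blast
            then show "t \<in> (\<Union>x\<in>{x. x \<prec> y \<and> enum x \<lhd> i}. {t \<in> T. (lev t, enum x) \<in> \<alpha>})" using t by blast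
          qed
          moreover have "small (\<Union>x\<in>{x. x \<prec> y \<and> enum x \<lhd> i}. {t \<in> T. (lev t, enum x) \<in> \<alpha>})"
            by (rule small_UN[OF small_subset[OF small_below]]) (use small_lev in auto)
          ultimately have "small T" using small_subset by blast
          then show False using T not_unbdd_iff[OF TK] by blast
        qed
      qed
      define ex where "ex t = (SOME x. x \<in> K \<and> enum x = lev t)" for t
      have ex: "ex t \<in> K \<and> enum (ex t) = lev t" if "t \<in> K" for t
      proof -
        have "\<exists>x. x \<in> K \<and> enum x = lev t" using lev[OF that] enum by (metis imageE)
        then show ?thesis unfolding ex_def by (rule someI_ex)
      qed
      define s where "s x = A.lst {j \<in> Field \<alpha>. enum x \<lhd> j}" for x
      have s: "enum x \<lhd> s x" "(s x, j) \<in> \<alpha>" if j: "enum x \<lhd> j" for x j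
      proof -
        have sub: "{j \<in> Field \<alpha>. enum x \<lhd> j} \<subseteq> Field \<alpha>" by blast
        have mem: "j \<in> {j \<in> Field \<alpha>. enum x \<lhd> j}" using j A.less_in(2) by blast
        then have ne: "{j \<in> Field \<alpha>. enum x \<lhd> j} \<noteq> {}" by blast
        show "enum x \<lhd> s x" using A.lst(1)[OF sub ne] unfolding s_def by blast
        show "(s x, j) \<in> \<alpha>" unfolding s_def by (rule A.lst(2)[OF sub mem])
      qed
      define bd where "bd x = (if s x \<lhd> i then c (s x) else x)" for x
      define b where "b z = mx (ex z) (bd z)" for z
      have exK: "ex z \<in> K" and bdK: "bd z \<in> K" if "z \<in> K" for z
        using ex[OF that] c(1) that unfolding bd_def by auto
      have bK: "\<forall>z\<in>K. b z \<in> K" unfolding b_def using mx(3) exK bdK by blast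
      have cl_b: "ex z \<prec> d" "bd z \<prec> d" if "d \<in> cl b" "z \<prec> d" for d z
        using clD[OF that] mx_less[OF exK bdK] less_in(1)[OF that(2)] unfolding b_def by blast+
      obtain z0 where z0: "z0 \<in> K" using pos_nonempty[OF stat_K] by blast
      define Y where "Y = {d \<in> S. kind d = (i, True) \<and> d \<in> cl b \<and> z0 \<prec> d}"
      define C where "C y = {x \<in> K. lev x \<lhd> layer y}" for y
      have YD: "y \<in> S" "kind y = (i, True)" "y \<in> cl b" "y \<in> K" if "y \<in> Y" for y
        using that S_in unfolding Y_def by blast+
      have "\<exists>y\<in>Y. y \<in> C y"
      proof (rule accumulation_point[OF T])
        show "Y \<subseteq> S" using YD(1) by blast
        show "stat {y \<in> Y. h y = \<beta>}" if "\<beta> \<in> \<Theta>" for \<beta>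
          unfolding Y_def by (rule stat_meet[OF iA bK z0 that])
        show "layer y \<lhd> layer t" if "y \<in> Y" "t \<in> T" for y t
          using layer_i[OF YD(1,2)[OF that(1)]] Tl[OF that(2)] by (rule A.less_leq_trans)
        show "closedin space (C y)" for y unfolding C_def by (rule closed_lev)
        show "t \<in> C y" if "y \<in> Y" "t \<in> T" "t \<prec> y" for y t
        proof -
          have tK: "t \<in> K" using that TK by blast
          have "ex t \<prec> y" "enum (ex t) \<lhd> i"
            using cl_b(1)[OF YD(3)[OF that(1)] that(3)] ex[OF tK] Tlev[OF that(2)] by simp_all
          then have "enum (ex t) \<lhd> layer y" using layerJ(1)[OF YD(1,2)[OF that(1)]] unfolding J_def by blast
          then show ?thesis unfolding C_def using ex[OF tK] tK by simp
        qed
      qed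
      then obtain y where y: "y \<in> Y" "y \<in> C y" by blast
      note yS = YD(1,2)[OF y(1)]
      have ylev: "lev y \<lhd> layer y" using y(2) unfolding C_def by blast
      then have "lev y \<notin> J y" using layerJ(2)[OF yS] A.less_leq_trans A.less_irrefl by blast
      then obtain x where x: "x \<prec> y" "enum x \<lhd> i" "(lev y, enum x) \<in> \<alpha>"
        using notJ lev[OF YD(4)[OF y(1)]] by blast
      have xl: "enum x \<lhd> layer y" using layerJ(1)[OF yS] x(1,2) unfolding J_def by blast
      have "lev y \<lhd> s x" using x(3) s(1)[OF xl] by (rule A.leq_less_trans)
      then have "y \<in> Bad (s x)" unfolding Bad_def using s(2)[OF xl] YD(4)[OF y(1)] by blast
      moreover have si: "s x \<lhd> i" using s(2)[OF xl] layer_i[OF yS] by (rule A.leq_less_trans)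
      ultimately have "y \<prec> bd x" unfolding bd_def using c(2) by simp
      then show False using cl_b(2)[OF YD(3)[OF y(1)] x(1)] less_asym by blast
    qed
  qed
  then show ?case unfolding T_def Bad_def .
qed

lemma left_separating_lower_bound:
  assumes "left_separating space r'"
  shows "ord_prod r \<alpha> \<le>o r'"
proof (rule ccontr)
  let ?P = "ord_prod r \<alpha>"
  have wo': "well_order_on K r'" and cl': "\<And>y. y \<in> K \<Longrightarrow> closedin space (underS r' y)"
    using assms unfolding left_separating_def topspace_space by blast+
  then have fld: "Field r' = K" and WO: "Well_order r'" using well_order_on_Well_order by blast+
  interpret R: wellorder_rel r' by unfold_locales (rule WO)
  have closed: "closedin space D" if D: "D \<subseteq> K" "\<And>y y'. y \<in> D \<Longrightarrow> y' \<prec>\<^bsub>r'\<^esub> y \<Longrightarrow> y' \<in> D" for D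
  proof (cases "D = K")
    case True
    then show ?thesis using closedin_topspace[of space] topspace_space by simp
  next
    case False
    then obtain m where m: "m \<in> K - D" "\<forall>x\<in>K - D. (m, x) \<in> r'"
      using R.least_ex[of "K - D"] D(1) fld by blast
    have "D = underS r' m"
    proof (intro equalityI subsetI)
      fix y assume y: "y \<in> D"
      then have "\<not> m \<prec>\<^bsub>r'\<^esub> y" "y \<noteq> m" using D(2) m(1) by blast+
      then have "y \<prec>\<^bsub>r'\<^esub> m" using R.linear[of y m] y D(1) m(1) fld by blast
      then show "y \<in> underS r' m" unfolding underS_def lt_def by blast
    next
      fix y assume "y \<in> underS r' m"
      then have y: "y \<prec>\<^bsub>r'\<^esub> m" unfolding underS_def lt_def by blast
      then have "\<not> (m, y) \<in> r'" using R.less_leq_trans R.less_irrefl by blast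
      then show "y \<in> D" using m(2) R.less_in(1)[OF y] fld by blast
    qed
    then show ?thesis using cl' m(1) by simp
  qed
  assume "\<not> ?P \<le>o r'"
  then have shorter: "r' <o ?P"
    using Well_order_ord_prod[OF well_order A.well_order] WO not_ordLeq_iff_ordLess by blast
  obtain a g where g: "\<forall>x\<in>Field r'. g x \<prec>\<^bsub>?P\<^esub> a"
    and g_mono: "\<forall>x y. x \<prec>\<^bsub>r'\<^esub> y \<longrightarrow> g x \<prec>\<^bsub>?P\<^esub> g y"
    using ordLess_imp_strictly_monotone[OF shorter] by (elim bexE exE conjE) (rule that)
  define \<rho> where "\<rho> y = fst (g y)" for y
  define lev where "lev y = snd (g y)" for y
  obtain x0 i0 where a: "a = (x0, i0)" by (cases a)
  note less = ord_prod_less[OF well_order A.well_order]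
  have gK: "\<rho> y \<in> K" "lev y \<in> Field \<alpha>" "i0 \<in> Field \<alpha>" "lev y \<lhd> i0 \<or> lev y = i0 \<and> \<rho> y \<prec> x0"
    if "y \<in> K" for y
  proof -
    have "(\<rho> y, lev y) \<prec>\<^bsub>?P\<^esub> (x0, i0)" using g that fld a unfolding \<rho>_def lev_def by simp
    then show "\<rho> y \<in> K" "lev y \<in> Field \<alpha>" "i0 \<in> Field \<alpha>" "lev y \<lhd> i0 \<or> lev y = i0 \<and> \<rho> y \<prec> x0"
      unfolding less by blast+
  qed
  have mono: "lev y' \<lhd> lev y \<or> lev y' = lev y \<and> \<rho> y' \<prec> \<rho> y" if "y' \<prec>\<^bsub>r'\<^esub> y" for y y'
  proof -
    have "(\<rho> y', lev y') \<prec>\<^bsub>?P\<^esub> (\<rho> y, lev y)" using g_mono that unfolding \<rho>_def lev_def by simp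
    then show ?thesis unfolding less by blast
  qed
  have inj: "y = y'" if "y \<in> K" "y' \<in> K" "lev y = lev y'" "\<rho> y = \<rho> y'" for y y'
    using R.linear[of y y'] that fld mono[of y y'] mono[of y' y] less_irrefl A.less_irrefl by metis
  have bounded_bad: "\<not> unbdd {y \<in> K. (i, layer y) \<in> \<alpha> \<and> lev y \<lhd> i}" for i
  proof (rule misplaced_bounded[OF gK(2,1) inj])
    show "closedin space {y \<in> K. lev y \<lhd> j}" for j
    proof (rule closed)
      fix y y' assume y: "y \<in> {y \<in> K. lev y \<lhd> j}" and y': "y' \<prec>\<^bsub>r'\<^esub> y"
      then have "lev y' \<lhd> j" using mono[OF y'] A.less_trans by auto
      then show "y' \<in> {y \<in> K. lev y \<lhd> j}" using R.less_in(1)[OF y'] fld by blast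
    qed blast
    show "closedin space {y \<in> K. lev y \<lhd> j \<or> lev y = j \<and> \<rho> y \<prec> x}" for j x
    proof (rule closed)
      fix y y' assume y: "y \<in> {y \<in> K. lev y \<lhd> j \<or> lev y = j \<and> \<rho> y \<prec> x}" and y': "y' \<prec>\<^bsub>r'\<^esub> y"
      then have "lev y' \<lhd> j \<or> lev y' = j \<and> \<rho> y' \<prec> x"
        using mono[OF y'] A.less_trans less_trans by auto
      then show "y' \<in> {y \<in> K. lev y \<lhd> j \<or> lev y = j \<and> \<rho> y \<prec> x}"
        using R.less_in(1)[OF y'] fld by blast
    qed blast
  qed
  obtain z0 where z0: "z0 \<in> K" using pos_nonempty[OF stat_K] by blast
  note i0 = gK(3)[OF z0]
  obtain c where c: "c \<in> K" "\<forall>y\<in>{y \<in> K. (i0, layer y) \<in> \<alpha> \<and> lev y \<lhd> i0}. y \<prec> c"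
    using not_unbdd_bound[OF bounded_bad] by blast
  obtain \<beta> where \<beta>: "\<beta> \<in> \<Theta>" using letters by blast
  define Y where "Y = {d \<in> {d \<in> S. kind d = (i0, False) \<and> h d = \<beta>}. c \<prec> d}"
  have YK: "Y \<subseteq> K" unfolding Y_def using S_in by blast
  have "unbdd Y"
    unfolding Y_def
    by (rule pos_unbdd[OF admissible_stat pos_above[OF admissible_stat kinds[OF i0 \<beta>] c(1)]])
       (use S_in in blast)
  have Y: "lev y = i0 \<and> \<rho> y \<prec> x0" if "y \<in> Y" for y
  proof -
    have y: "y \<in> S" "kind y = (i0, False)" "c \<prec> y" "y \<in> K" using that YK unfolding Y_def by blast+
    have "(i0, layer y) \<in> \<alpha>" using constant_layer[OF y(1) i0 y(2)] A.leq_refl[OF i0] by simp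
    then have "\<not> lev y \<lhd> i0" using c(2) y(3,4) less_asym by blast
    then show ?thesis using gK(4)[OF y(4)] by blast
  qed
  have "inj_on \<rho> Y" using inj Y YK unfolding inj_on_def by blast
  moreover have "small (\<rho> ` Y)" by (rule small_subset[OF small_below[of x0]]) (use Y in blast)
  ultimately have "small Y" using small_image[of "\<rho> ` Y" "inv_into Y \<rho>"] by (simp add: inv_into_image_cancel)
  then show False using \<open>unbdd Y\<close> not_unbdd_iff[OF YK] by blast
qed

theorem ord_l_space: "\<exists>Y :: 'a topology. zero_dimensional Y \<and> (\<exists>t. ord_l Y = Some t \<and> t =o ord_prod r \<alpha>)"
proof -
  have "left_separated space" unfolding left_separated_def using left_separating_lex by blast
  then obtain t where t: "ord_l space = Some t" unfolding ord_l_def by simp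
  then have "left_separating space t" "t \<le>o lex"
    using ord_l_minimal[OF t] left_separating_lex by blast+
  then have "t =o ord_prod r \<alpha>"
    unfolding ordIso_iff_ordLeq using left_separating_lower_bound ordLeq_transitive lex(2) by blast
  then show ?thesis using zero_dimensional_space t by (intro exI[of _ space] conjI exI[of _ t])
qed

end

section \<open>Choice of letters and layers\<close>

lemma regular_rel_cardSuc:
  assumes "Cinfinite k"
  shows "regular_rel (cardSuc k)"
proof unfold_locales
  have k: "Card_order k" using assms by blast
  show "Card_order (cardSuc k)" by (rule cardSuc_Card_order[OF k])
  then show "Well_order (cardSuc k)" unfolding card_order_on_def by blast
  show "regularCard (cardSuc k)" by (rule regularCard_cardSuc[OF assms])
  have "natLeq \<le>o k" using natLeq_ordLeq_cinfinite[OF assms] .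
  then show "natLeq <o cardSuc k" using cardSuc_greater[OF k] by (rule ordLeq_ordLess_trans)
qed

lemma regular_first_uncountable: "regular_rel (cardSuc natLeq)"
  by (rule regular_rel_cardSuc[OF natLeq_Cinfinite])

lemma ladder_below_first_uncountable:
  assumes "wellorder_rel.limit_pt (cardSuc natLeq) d"
  shows "\<exists>s. wellorder_rel.ladder (cardSuc natLeq) d s"
proof -
  interpret \<theta>: regular_rel "cardSuc natLeq" by (rule regular_first_uncountable)
  have "\<exists>z. z \<prec>\<^bsub>cardSuc natLeq\<^esub> d" using assms unfolding \<theta>.limit_pt_def by blast
  then have ne: "{x. x \<prec>\<^bsub>cardSuc natLeq\<^esub> d} \<noteq> {}" by blast
  have "|{x. x \<prec>\<^bsub>cardSuc natLeq\<^esub> d}| <o cardSuc natLeq"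
    using \<theta>.small_below unfolding \<theta>.small_def .
  then have "|{x. x \<prec>\<^bsub>cardSuc natLeq\<^esub> d}| \<le>o natLeq"
    using cardSuc_ordLeq_ordLess[OF natLeq_Card_order card_of_Card_order] by blast
  then have "|{x. x \<prec>\<^bsub>cardSuc natLeq\<^esub> d}| \<le>o |UNIV :: nat set|"
    using card_of_nat ordIso_symmetric ordLeq_ordIso_trans by blast
  then obtain s :: "nat \<Rightarrow> nat set" where s: "range s = {x. x \<prec>\<^bsub>cardSuc natLeq\<^esub> d}"
    using card_of_ordLeq2[OF ne, of "UNIV :: nat set"] by blast
  have 1: "s n \<prec>\<^bsub>cardSuc natLeq\<^esub> d" for n using s by blast
  have 2: "\<exists>n. z \<prec>\<^bsub>cardSuc natLeq\<^esub> s n" if z: "z \<prec>\<^bsub>cardSuc natLeq\<^esub> d" for z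
  proof -
    obtain y where "z \<prec>\<^bsub>cardSuc natLeq\<^esub> y" "y \<prec>\<^bsub>cardSuc natLeq\<^esub> d"
      using assms z unfolding \<theta>.limit_pt_def by blast
    then show ?thesis using s by (metis (mono_tags, lifting) mem_Collect_eq rangeE)
  qed
  obtain k :: "nat \<Rightarrow> nat" where "\<theta>.ladder d (s \<circ> k)" by (rule \<theta>.ladder_from_sequence[OF 1 2])
  then show ?thesis by (intro exI)
qed

context walk
begin

lemma captures_large:
  assumes large: "cardSuc (cardSuc natLeq) <o r"
    and h: "range h \<subseteq> Field (cardSuc (cardSuc natLeq))"
      "\<And>\<beta>. \<beta> \<in> Field (cardSuc (cardSuc natLeq)) \<Longrightarrow> stat {d \<in> S. h d = \<beta>}"
  shows "\<exists>V. captures S h (Field (cardSuc (cardSuc natLeq))) L V"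
proof -
  let ?\<theta> = "cardSuc (cardSuc natLeq)"
  have inf: "Cinfinite (cardSuc natLeq)" by (rule Cinfinite_cardSuc[OF natLeq_Cinfinite])
  interpret \<theta>: regular_rel ?\<theta> by (rule regular_rel_cardSuc[OF inf])
  define F where "F n = fst (prod_decode n)" for n
  have F: "infinite {n. F n = j}" for j
  proof -
    have "inj (\<lambda>m. prod_encode (j, m))" by (auto simp: inj_def)
    then have "infinite (range (\<lambda>m. prod_encode (j, m)))" by (rule range_inj_infinite)
    moreover have "range (\<lambda>m. prod_encode (j, m)) \<subseteq> {n. F n = j}" unfolding F_def by auto
    ultimately show ?thesis using finite_subset by blast
  qed
  have "cardSuc natLeq <o ?\<theta>" using cardSuc_greater inf by blast
  then have "\<exists>e. \<theta>.pos (ladder_system.guess ?\<theta> e F UNIV) (Field ?\<theta>)"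
    by (rule \<theta>.guessing_ladders[OF regular_first_uncountable _ F])
  then obtain e where e: "\<theta>.pos (ladder_system.guess ?\<theta> e F UNIV) (Field ?\<theta>)" ..
  have "small (Field ?\<theta>)"
    unfolding small_def using large card_of_Field_ordIso[OF \<theta>.card_order] ordIso_ordLess_trans by blast
  then interpret word_walk r S step ?\<theta> e h
    by unfold_locales (use h in auto)
  show ?thesis by (rule exI) (rule attached_captures[OF e])
qed

text \<open>
  The bound on \<open>r\<close> gives \<open>|K| \<le> |Pow (Field \<theta>)|\<close>, hence pairwise distinct sets \<open>R p\<close> of letters.
\<close>

lemma captures_table:
  assumes "r \<le>o cardSuc (cardSuc natLeq)" and small_\<theta>: "cardSuc natLeq <o r"
    and h: "range h \<subseteq> Field (cardSuc natLeq)"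
      "\<And>\<beta>. \<beta> \<in> Field (cardSuc natLeq) \<Longrightarrow> stat {d \<in> S. h d = \<beta>}"
  shows "\<exists>V. captures S h (Field (cardSuc natLeq)) L V"
proof -
  let ?\<theta> = "cardSuc natLeq"
  interpret \<theta>: regular_rel ?\<theta> by (rule regular_first_uncountable)
  define e where "e d = (SOME s. \<theta>.ladder d s)" for d
  have e: "\<theta>.ladder d (e d)" if "\<theta>.limit_pt d" for d
    unfolding e_def by (rule someI_ex[OF ladder_below_first_uncountable[OF that]])
  define Lim where "Lim = {d \<in> Field ?\<theta>. \<theta>.limit_pt d}"
  have "\<exists>st. \<theta>.stepping Lim st"
    by (rule \<theta>.stepping_exists) (use ladder_below_first_uncountable in \<open>auto simp: Lim_def\<close>)
  then obtain st where st: "\<theta>.stepping Lim st" ..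
  interpret \<omega>: walk ?\<theta> Lim st
    using st \<theta>.stat_limit_pts[OF \<theta>.stat_K] by unfold_locales (simp_all add: Lim_def)
  have codes: "|codes (Field ?\<theta>)| \<le>o |Field ?\<theta>|" by (rule card_codes[OF \<theta>.infinite_K])
  then have codes': "|codes (Field ?\<theta>)| \<le>o ?\<theta>"
    using card_of_Field_ordIso[OF \<theta>.card_order] ordLeq_ordIso_trans by blast
  then obtain t where t: "\<forall>c\<in>codes (Field ?\<theta>). \<theta>.stat {d \<in> Lim. t d = c}"
    using \<omega>.stationary_partition by blast
  have "small (Field ?\<theta>)"
    unfolding small_def using small_\<theta> card_of_Field_ordIso[OF \<theta>.card_order] ordIso_ordLess_trans by blast
  then interpret word_walk r S step ?\<theta> e h
    by unfold_locales (use h in auto)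
  have pos: "\<theta>.pos (T.guess (\<lambda>_. 0) {0}) {\<beta> \<in> Field ?\<theta>. t \<beta> = c}" if c: "c \<in> codes (Field ?\<theta>)" for c
  proof (rule \<theta>.pos_mono)
    show "\<theta>.pos (T.guess (\<lambda>_. 0) {0}) {d \<in> Lim. t d = c}"
    proof (rule T.guess_limits)
      show "\<theta>.stat {d \<in> Lim. t d = c}" using t c by (rule bspec)
      show "T.lad d" if "d \<in> {d \<in> Lim. t d = c}" for d using e that unfolding Lim_def by simp
    qed
    show "{d \<in> Lim. t d = c} \<subseteq> {\<beta> \<in> Field ?\<theta>. t \<beta> = c}" unfolding Lim_def by blast
  qed
  have C: "small (codes (Field ?\<theta>))"
    unfolding small_def using codes' small_\<theta> by (rule ordLeq_ordLess_trans)
  have "?\<theta> <o |Pow (Field ?\<theta>)|"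
    using card_of_Pow card_of_Field_ordIso[OF \<theta>.card_order] ordIso_ordLess_trans ordIso_symmetric by blast
  then have "cardSuc ?\<theta> \<le>o |Pow (Field ?\<theta>)|" by (rule cardSuc_least[OF \<theta>.card_order card_of_Card_order])
  then have "r \<le>o |Pow (Field ?\<theta>)|" using assms(1) ordLeq_transitive by blast
  then have "|K| \<le>o |Pow (Field ?\<theta>)|"
    using card_of_Field_ordIso[OF card_order] ordIso_ordLeq_trans by blast
  then obtain R where R: "inj_on R K" "R ` K \<subseteq> Pow (Field ?\<theta>)" unfolding card_of_ordLeq[symmetric] by blast
  have U: "\<exists>c\<in>codes (Field ?\<theta>). \<forall>p\<in>P. decides R c p \<longleftrightarrow> D p" if P: "finite P" "P \<subseteq> K" for P D
    by (rule decides_all[OF R(1) _ P]) (use R(2) in blast)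
  show ?thesis by (rule exI) (rule table_captures[OF pos C U])
qed

text \<open>
  The points of \<open>S\<close> receive a layer, constant or rising, and a letter; all combinations occur on
  stationary sets.
\<close>

lemma layered_space:
  fixes \<alpha> :: "'c rel" and \<Theta> :: "'b set"
  assumes \<alpha>: "Well_order \<alpha>" "\<alpha> <o cardSuc r" "Field \<alpha> \<noteq> {}" and \<Theta>: "\<Theta> \<noteq> {}" "|\<Theta>| \<le>o r"
    and cap: "\<And>h L. range h \<subseteq> \<Theta> \<Longrightarrow> (\<And>\<beta>. \<beta> \<in> \<Theta> \<Longrightarrow> stat {d \<in> S. h d = \<beta>}) \<Longrightarrow> \<exists>V. captures S h \<Theta> L V"
  shows "\<exists>Y :: 'a topology. zero_dimensional Y \<and> (\<exists>t. ord_l Y = Some t \<and> t =o ord_prod r \<alpha>)"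
proof -
  interpret A: wellorder_rel \<alpha> by unfold_locales (rule \<alpha>(1))
  have "|Field \<alpha>| \<le>o \<alpha>" using \<alpha>(1) by (rule card_of_least)
  then have "|Field \<alpha>| <o cardSuc r" using \<alpha>(2) by (rule ordLeq_ordLess_trans)
  then have \<alpha>r: "|Field \<alpha>| \<le>o r"
    using cardSuc_ordLeq_ordLess[OF card_order card_of_Card_order] by blast
  have bool_r: "|UNIV :: bool set| \<le>o r"
    using small_countable[of "UNIV :: bool set"] ordLess_imp_ordLeq unfolding small_def by simp
  have "|(Field \<alpha> \<times> (UNIV :: bool set)) \<times> \<Theta>| \<le>o r"
    by (intro card_of_Times_ordLeq_infinite_Field infinite_K card_order \<alpha>r bool_r \<Theta>(2))
  then have "\<exists>f. \<forall>i\<in>(Field \<alpha> \<times> (UNIV :: bool set)) \<times> \<Theta>. stat {d \<in> S. f d = i}"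
    by (rule stationary_partition)
  then obtain f where f: "\<forall>i\<in>(Field \<alpha> \<times> (UNIV :: bool set)) \<times> \<Theta>. stat {d \<in> S. f d = i}" ..
  obtain \<beta>0 where \<beta>0: "\<beta>0 \<in> \<Theta>" using \<Theta>(1) by blast
  obtain i0 where i0: "i0 \<in> Field \<alpha>" using \<alpha>(3) by blast
  have "|Field \<alpha>| \<le>o |K|"
    using \<alpha>r card_of_Field_ordIso[OF card_order] ordIso_symmetric ordLeq_ordIso_trans by blast
  then have "\<exists>enum. enum ` K = Field \<alpha>" unfolding card_of_ordLeq2[OF \<alpha>(3)] .
  then obtain enum where enum: "enum ` K = Field \<alpha>" ..
  define h where "h d = (if snd (f d) \<in> \<Theta> then snd (f d) else \<beta>0)" for d
  define kind where "kind d = fst (f d)" for d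
  define rising where "rising d = A.lst {j \<in> Field \<alpha>. \<forall>x. x \<prec> d \<longrightarrow> enum x \<prec>\<^bsub>\<alpha>\<^esub> fst (kind d) \<longrightarrow> enum x \<prec>\<^bsub>\<alpha>\<^esub> j}" for d
  define layer where "layer d = (if fst (kind d) \<in> Field \<alpha>
      then if snd (kind d) then rising d else fst (kind d) else i0)" for d
  have kinds: "stat {d \<in> S. kind d = (i, k) \<and> h d = \<beta>}" if "i \<in> Field \<alpha>" "\<beta> \<in> \<Theta>" for i k \<beta>
  proof (rule pos_mono)
    show "stat {d \<in> S. f d = ((i, k), \<beta>)}" using f that by simp
    show "{d \<in> S. f d = ((i, k), \<beta>)} \<subseteq> {d \<in> S. kind d = (i, k) \<and> h d = \<beta>}"
      unfolding kind_def h_def using that(2) by auto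
  qed
  have "stat {d \<in> S. h d = \<beta>}" if "\<beta> \<in> \<Theta>" for \<beta>
    by (rule pos_mono[OF kinds[OF i0 that, of True]]) blast
  moreover have "range h \<subseteq> \<Theta>" unfolding h_def using \<beta>0 by auto
  ultimately obtain V where V: "captures S h \<Theta> (\<lambda>p y. layer p \<prec>\<^bsub>\<alpha>\<^esub> layer y) V"
    using cap by blast
  have "rising d \<in> Field \<alpha>" if "fst (kind d) \<in> Field \<alpha>" for d
  proof -
    define J where "J = {j \<in> Field \<alpha>. \<forall>x. x \<prec> d \<longrightarrow> enum x \<prec>\<^bsub>\<alpha>\<^esub> fst (kind d) \<longrightarrow> enum x \<prec>\<^bsub>\<alpha>\<^esub> j}"
    have "J \<subseteq> Field \<alpha>" "fst (kind d) \<in> J" unfolding J_def using that by blast+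
    then show ?thesis using A.lst(1)[of J] unfolding rising_def J_def[symmetric] by blast
  qed
  then have layer_in: "layer d \<in> Field \<alpha>" for d unfolding layer_def using i0 by simp
  interpret layered r \<alpha> S h \<Theta> layer kind enum V
  proof unfold_locales
    show "layer d = i" if "i \<in> Field \<alpha>" "kind d = (i, False)" for d i
      using that unfolding layer_def by simp
    show "layer d = A.lst {j \<in> Field \<alpha>. \<forall>x. x \<prec> d \<longrightarrow> enum x \<prec>\<^bsub>\<alpha>\<^esub> i \<longrightarrow> enum x \<prec>\<^bsub>\<alpha>\<^esub> j}"
      if "i \<in> Field \<alpha>" "kind d = (i, True)" for d i
      using that unfolding layer_def rising_def by simp
  qed (use S_limit \<Theta>(1) enum layer_in kinds V in auto)
  show ?thesis by (rule ord_l_space)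
qed

end

lemma empty_left_separated:
  "\<exists>Y :: 'a topology. zero_dimensional Y \<and> (\<exists>t. ord_l Y = Some t \<and> t =o ({} :: 'b rel))"
proof -
  let ?Y = "discrete_topology {} :: 'a topology"
  have "openin ?Y = arbitrary union_of (\<lambda>U. U \<in> {{}})"
    by (auto simp: union_of_def arbitrary_def fun_eq_iff)
  then have "zero_dimensional ?Y" unfolding zero_dimensional_def by (intro exI[of _ "{{}}"]) auto
  moreover have "left_separating ?Y {}"
    unfolding left_separating_def well_order_on_def order_on_defs
    by (auto simp: refl_on_def trans_def antisym_def total_on_def)
  then have "left_separated ?Y" unfolding left_separated_def by blast
  then obtain t where t: "ord_l ?Y = Some t" unfolding ord_l_def by simp
  then have "well_order_on {} t" using ord_l_minimal[OF t] unfolding left_separating_def by simp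
  then have "t = {}" unfolding well_order_on_def order_on_defs by blast
  moreover have "({} :: 'a rel) =o ({} :: 'b rel)"
    unfolding ordIso_def iso_def embed_def well_order_on_def order_on_defs
    by (auto simp: refl_on_def trans_def antisym_def total_on_def bij_betw_def)
  ultimately show ?thesis using t by blast
qed

theorem theorem1p2:
  fixes \<kappa> :: "'a rel" and S :: "'a set" and \<alpha> :: "'b rel"
  assumes "Card_order \<kappa>" and "regularCard \<kappa>" and "cardSuc natLeq <o \<kappa>"
    and "stationary S \<kappa>" and "non_reflecting S \<kappa>"
    and "Well_order \<alpha>" and "\<alpha> <o cardSuc \<kappa>"
  shows "\<exists>Y :: 'a topology. zero_dimensional Y \<and>
           (\<exists>t. ord_l Y = Some t \<and> t =o ord_prod \<kappa> \<alpha>)"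
proof (cases "Field \<alpha> = {}")
  case True
  then have "ord_prod \<kappa> \<alpha> = {}" unfolding ord_prod_def by (auto simp: Field_def)
  then show ?thesis using empty_left_separated by simp
next
  case False
  have "natLeq <o \<kappa>"
    using cardSuc_greater[OF natLeq_Card_order] assms(3) by (rule ordLess_transitive)
  then interpret \<kappa>: regular_rel \<kappa>
    using assms(1,2) by unfold_locales (auto simp: card_order_on_def)
  have SK: "S \<subseteq> Field \<kappa>" using assms(4) unfolding stationary_def by blast
  obtain step where step: "\<kappa>.stepping {d \<in> S. \<kappa>.limit_pt d} step"
    using \<kappa>.non_reflecting_stepping[OF assms(5) SK] ..
  have st: "\<kappa>.stat {d \<in> S. \<kappa>.limit_pt d}"
    by (rule \<kappa>.stat_limit_pts[OF \<kappa>.stationary_imp_stat[OF assms(4)]])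
  interpret walk \<kappa> "{d \<in> S. \<kappa>.limit_pt d}" step
    using step st by unfold_locales simp_all
  show ?thesis
  proof (cases "cardSuc (cardSuc natLeq) <o \<kappa>")
    case True
    interpret \<theta>: regular_rel "cardSuc (cardSuc natLeq)"
      by (rule regular_rel_cardSuc[OF Cinfinite_cardSuc[OF natLeq_Cinfinite]])
    show ?thesis
    proof (rule layered_space[OF assms(6,7) False])
      show "Field (cardSuc (cardSuc natLeq)) \<noteq> {}" using \<theta>.infinite_K by auto
      show "|Field (cardSuc (cardSuc natLeq))| \<le>o \<kappa>"
        using card_of_Field_ordIso[OF \<theta>.card_order] True ordIso_ordLess_trans ordLess_imp_ordLeq by blast
    qed (rule captures_large[OF True])
  next
    case small: False
    interpret \<theta>: regular_rel "cardSuc natLeq" by (rule regular_first_uncountable)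
    have le: "\<kappa> \<le>o cardSuc (cardSuc natLeq)"
      using small assms(1) cardSuc_Card_order[OF \<theta>.card_order] not_ordLess_iff_ordLeq
      unfolding card_order_on_def by blast
    show ?thesis
    proof (rule layered_space[OF assms(6,7) False])
      show "Field (cardSuc natLeq) \<noteq> {}" using \<theta>.infinite_K by auto
      show "|Field (cardSuc natLeq)| \<le>o \<kappa>"
        using card_of_Field_ordIso[OF \<theta>.card_order] assms(3) ordIso_ordLess_trans ordLess_imp_ordLeq by blast
    qed (rule captures_table[OF le assms(3)])
  qed
qed

end
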